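(* Let $h^{(7)},h^{(15)},h^{(31)},h^{(63)},h^{(127)}$ be the explicit stepsize patterns of lengths $t=7,15,31,63,127$ listed in the context. For $t\in\{7,15,31,63,127\}$, the pattern $h^{(t)}$ is $\epsilon$-straightforward with parameter $\Delta$, where respectively $\epsilon=10^{-9},10^{-9},10^{-11},10^{-3},10^{-4}$ and $\Delta=10^{-5},10^{-6},10^{-8},10^{-7},10^{-8}$. Hence, for every convex $L$-smooth $f:\mathbb{R}^n\to\mathbb{R}$ with minimizer $x_\star$ and every $x_0\in\mathbb{R}^n$ with $D=\sup\{\|x-x_\star\|_2\mid f(x)\le f(x_0)\}<\infty$, gradient descent $x_{k+1}=x_k-\frac{h^{(t)}_{(k\bmod t)}}{L}\nabla f(x_k)$ satisfies, for $T=st$, $$ f(x_T)-f(x_\star)\le\frac{LD^2}{c_t\times T}+O(1/T^2),$$ with $c_7=3.1999999$, $c_{15}=3.8599999$, $c_{31}=4.6032258$, $c_{63}=5.2253968$, $c_{127}=5.8346303$.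
   Context: $L$-smooth means differentiable with $L$-Lipschitz gradient ($L>0$, Euclidean norm). Patterns (commas denote concatenation). $h^{(7)}=(1.5,2.2,1.5,12.0,1.5,2.2,1.5)$. $h^{(15)}=(u,29.7,u)$ with $u=(1.4,2.0,1.4,4.5,1.4,2.0,1.4)$. Let $b=(1.4,2.0,1.4,3.9,1.4,2.0,1.4)$. Then $h^{(31)}=(b,8.2,b,72.3,b,8.2,b)$; $h^{(63)}=(v,164.0,v)$ with $v=(b,7.2,b,14.2,b,7.2,b)$; $h^{(127)}=(w,370.0,w)$ with $w=(b,7.2,b,12.6,b,7.2,b,23.5,b,7.2,b,12.6,b,7.2,b)$. Straightforwardness: for a pattern $h=(h_0,\dots,h_{t-1})\in\mathbb{R}^t$, problem dimension $n$, and $L,D>0$, $p_{L,D}(\delta)$ is the supremum of $f(x_t)-f(x_\star)$ over all convex $L$-smooth $f:\mathbb{R}^n\to\mathbb{R}$ and $x_0,x_\star\in\mathbb{R}^n$ with $\nabla f(x_\star)=0$, $\|x_0-x_\star\|_2\le D$, $f(x_0)-f(x_\star)\le\delta$, where $x_{k+1}=x_k-\frac{h_k}{L}\nabla f(x_k)$ for $k=0,\dots,t-1$. $h$ is $\epsilon$-straightforward with parameter $\Delta\in(0,1/2]$ if for any $L,D>0$, $p_{L,D}(\delta)\le\delta-\frac{\sum_{i=0}^{t-1}(h_i-\epsilon)}{LD^2}\delta^2$ for all $\delta\in[0,LD^2\Delta]$. Convention: "$f(x_T)-f(x_\star)\le\frac{LD^2}{cT}+O(1/T^2)$ for $T=st$"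 abbreviates that there exist universal constants $\bar s$ and $C$ (depending only on the pattern, $\epsilon$ and $\Delta$) such that $f(x_T)-f(x_\star)\le\frac{LD^2}{cT-C}$ for all $T=st$ with $s>\bar s$. *)

theory Defs
  imports "HOL-Analysis.Analysis"
begin

section \<open>Euclidean spaces of arbitrary dimension inside one type\<close>

text \<open>
  The constants hidden in the O-term of the convergence rate must not depend on the dimension
  of the problem, so the dimension has to be quantified inside the formula, which is impossible
  for \<^typ>\<open>real ^ 'n\<close>.  Hence all spaces \<open>\<real>\<^sup>n\<close> are realised inside the inner product space of
  finitely supported real sequences: \<open>\<real>\<^sup>n\<close> is the set of sequences that vanish from index \<open>n\<close>
  on, with the inner product and norm of the ambient type.
\<close>

typedef fin_seq = "{x :: nat \<Rightarrow> real. finite {i. x i \<noteq> 0}}"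
  morphisms coord Abs_fin_seq
  by (rule exI[of _ "\<lambda>_. 0"]) simp

setup_lifting type_definition_fin_seq

lemma finite_support: "finite {i. coord x i \<noteq> 0}"
  using coord[of x] by simp

lemma fin_seq_eqI: "(\<And>i. coord x i = coord y i) \<Longrightarrow> x = y"
  by (metis coord_inject ext)

instantiation fin_seq :: real_vector
begin

lift_definition zero_fin_seq :: fin_seq is "\<lambda>_. 0" by simp

lift_definition plus_fin_seq :: "fin_seq \<Rightarrow> fin_seq \<Rightarrow> fin_seq" is "\<lambda>x y i. x i + y i"
proof -
  fix x y :: "nat \<Rightarrow> real"
  assume "finite {i. x i \<noteq> 0}" "finite {i. y i \<noteq> 0}"
  from finite_UnI[OF this] show "finite {i. x i + y i \<noteq> 0}" by (rule rev_finite_subset) auto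
qed

lift_definition minus_fin_seq :: "fin_seq \<Rightarrow> fin_seq \<Rightarrow> fin_seq" is "\<lambda>x y i. x i - y i"
proof -
  fix x y :: "nat \<Rightarrow> real"
  assume "finite {i. x i \<noteq> 0}" "finite {i. y i \<noteq> 0}"
  from finite_UnI[OF this] show "finite {i. x i - y i \<noteq> 0}" by (rule rev_finite_subset) auto
qed

lift_definition uminus_fin_seq :: "fin_seq \<Rightarrow> fin_seq" is "\<lambda>x i. - x i" by simp

lift_definition scaleR_fin_seq :: "real \<Rightarrow> fin_seq \<Rightarrow> fin_seq" is "\<lambda>r x i. r * x i"
  by (rule finite_subset[rotated]) auto

instance
  by standard (transfer; simp add: algebra_simps fun_eq_iff)+

end

lemma coord_simps [simp]:
  "coord 0 i = 0"
  "coord (x + y) i = coord x i + coord y i"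
  "coord (x - y) i = coord x i - coord y i"
  "coord (- x) i = - coord x i"
  "coord (r *\<^sub>R x) i = r * coord x i"
  by (transfer; simp)+

instantiation fin_seq :: real_inner
begin

definition inner_fin_seq :: "fin_seq \<Rightarrow> fin_seq \<Rightarrow> real" where
  "inner_fin_seq x y = (\<Sum>i | coord x i \<noteq> 0. coord x i * coord y i)"

definition norm_fin_seq :: "fin_seq \<Rightarrow> real" where
  "norm_fin_seq x = sqrt (inner x x)"

definition dist_fin_seq :: "fin_seq \<Rightarrow> fin_seq \<Rightarrow> real" where
  "dist_fin_seq x y = norm (x - y)"

definition sgn_fin_seq :: "fin_seq \<Rightarrow> fin_seq" where
  "sgn_fin_seq x = x /\<^sub>R norm x"

definition uniformity_fin_seq :: "(fin_seq \<times> fin_seq) filter" where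
  "uniformity_fin_seq = (INF e\<in>{0<..}. principal {(x, y). dist x y < e})"

definition open_fin_seq :: "fin_seq set \<Rightarrow> bool" where
  "open_fin_seq U \<longleftrightarrow> (\<forall>x\<in>U. eventually (\<lambda>(x', y). x' = x \<longrightarrow> y \<in> U) uniformity)"

lemma inner_fin_seq_superset:
  assumes "finite A" and "{i. coord x i \<noteq> 0} \<subseteq> A"
  shows "inner x y = (\<Sum>i\<in>A. coord x i * coord y i)"
  unfolding inner_fin_seq_def by (rule sum.mono_neutral_left) (use assms in auto)

instance
proof
  fix x y z :: fin_seq and r :: real
  define A where "A = {i. coord x i \<noteq> 0} \<union> {i. coord y i \<noteq> 0}"
  have *: "inner u v = (\<Sum>i\<in>A. coord u i * coord v i)" if "{i. coord u i \<noteq> 0} \<subseteq> A" for u v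
    using that by (intro inner_fin_seq_superset) (simp_all add: A_def finite_support)
  have sub: "{i. coord x i \<noteq> 0} \<subseteq> A" "{i. coord y i \<noteq> 0} \<subseteq> A"
    "{i. coord (x + y) i \<noteq> 0} \<subseteq> A" "{i. coord (r *\<^sub>R x) i \<noteq> 0} \<subseteq> A"
    by (auto simp: A_def)
  show "inner x y = inner y x"
    by (simp add: *[OF sub(1)] *[OF sub(2)] mult.commute)
  show "inner (x + y) z = inner x z + inner y z"
    unfolding *[OF sub(1)] *[OF sub(2)] *[OF sub(3)]
    by (simp add: distrib_right sum.distrib)
  show "inner (r *\<^sub>R x) y = r * inner x y"
    unfolding *[OF sub(1)] *[OF sub(4)] by (simp add: sum_distrib_left mult.assoc)
  show "0 \<le> inner x x"
    unfolding inner_fin_seq_def by (rule sum_nonneg) simp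
  show "inner x x = 0 \<longleftrightarrow> x = 0"
    by (auto simp: inner_fin_seq_def sum_nonneg_eq_0_iff finite_support intro!: fin_seq_eqI)
qed (simp_all add: norm_fin_seq_def dist_fin_seq_def sgn_fin_seq_def
       uniformity_fin_seq_def open_fin_seq_def)

end

definition Rn :: "nat \<Rightarrow> fin_seq set" where
  "Rn n = {x. \<forall>i\<ge>n. coord x i = 0}"

lemma subspace_Rn: "subspace (Rn n)"
  by (auto simp: subspace_def Rn_def)

lemma inner_Rn: "x \<in> Rn n \<Longrightarrow> x \<bullet> y = (\<Sum>i<n. coord x i * coord y i)"
  by (rule inner_fin_seq_superset) (auto simp: Rn_def intro: leI)

lemma norm_Rn: "x \<in> Rn n \<Longrightarrow> norm x = sqrt (\<Sum>i<n. (coord x i)\<^sup>2)"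
  by (simp add: norm_fin_seq_def inner_Rn power2_eq_square)

lemma coord_image_Rn: "coord ` Rn n = {x. \<forall>i\<ge>n. x i = 0}"
proof
  show "{x. \<forall>i\<ge>n. x i = 0} \<subseteq> coord ` Rn n"
  proof
    fix x :: "nat \<Rightarrow> real" assume "x \<in> {x. \<forall>i\<ge>n. x i = 0}"
    then have x: "x i = 0" if "n \<le> i" for i using that by blast
    have "{i. x i \<noteq> 0} \<subseteq> {..<n}"
      using x not_less by blast
    then have "finite {i. x i \<noteq> 0}" by (rule finite_subset) (rule finite_lessThan)
    then have eq: "coord (Abs_fin_seq x) = x" by (simp add: Abs_fin_seq_inverse)
    then have "Abs_fin_seq x \<in> Rn n" by (simp add: Rn_def x)
    with eq show "x \<in> coord ` Rn n" by (metis imageI)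
  qed
qed (auto simp: Rn_def)


section \<open>Gradient descent\<close>

text \<open>
  \<open>f\<close> is \<open>L\<close>-smooth on the space \<open>E\<close> and \<open>g\<close> is its gradient: the derivative clause is
  \<open>GDERIV\<close> relative to the subspace \<open>E\<close>.  The values of \<open>f\<close> and \<open>g\<close> outside \<open>E\<close> are irrelevant;
  on \<open>E\<close> the gradient is unique because its values are required to lie in \<open>E\<close>.
\<close>

definition smooth_with_gradient ::
    "real \<Rightarrow> 'a::real_inner set \<Rightarrow> ('a \<Rightarrow> real) \<Rightarrow> ('a \<Rightarrow> 'a) \<Rightarrow> bool" where
  "smooth_with_gradient L E f g \<longleftrightarrow>
     (\<forall>x\<in>E. g x \<in> E \<and> (f has_derivative (\<lambda>v. v \<bullet> g x)) (at x within E)) \<and>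
     L-lipschitz_on E g"

primrec grad_descent ::
    "(nat \<Rightarrow> real) \<Rightarrow> real \<Rightarrow> ('a \<Rightarrow> 'a) \<Rightarrow> 'a::real_vector \<Rightarrow> nat \<Rightarrow> 'a" where
  "grad_descent \<eta> L g x0 0 = x0"
| "grad_descent \<eta> L g x0 (Suc k) =
     grad_descent \<eta> L g x0 k - (\<eta> k / L) *\<^sub>R g (grad_descent \<eta> L g x0 k)"


section \<open>Straightforward stepsize patterns\<close>

text \<open>The supremum is taken in \<^typ>\<open>ereal\<close>, so it is meaningful without a boundedness proof.\<close>

definition worst_case_gap :: "nat \<Rightarrow> real list \<Rightarrow> real \<Rightarrow> real \<Rightarrow> real \<Rightarrow> ereal" where
  "worst_case_gap n h L D \<delta> =
     Sup {ereal (f (grad_descent (\<lambda>k. h ! k) L g x0 (length h)) - f xs) | f g x0 xs.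
            convex_on (Rn n) f \<and> smooth_with_gradient L (Rn n) f g \<and>
            x0 \<in> Rn n \<and> xs \<in> Rn n \<and> g xs = 0 \<and>
            norm (x0 - xs) \<le> D \<and> f x0 - f xs \<le> \<delta>}"

definition straightforward :: "nat \<Rightarrow> real list \<Rightarrow> real \<Rightarrow> real \<Rightarrow> bool" where
  "straightforward n h \<epsilon> \<Delta> \<longleftrightarrow>
     0 < \<Delta> \<and> \<Delta> \<le> 1/2 \<and>
     (\<forall>L>0. \<forall>D>0. \<forall>\<delta>\<in>{0..L * D\<^sup>2 * \<Delta>}.
        worst_case_gap n h L D \<delta>
          \<le> ereal (\<delta> - (\<Sum>i<length h. h ! i - \<epsilon>) / (L * D\<^sup>2) * \<delta>\<^sup>2))"


section \<open>The patterns\<close>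

definition h7 :: "real list" where
  "h7 = [1.5, 2.2, 1.5, 12.0, 1.5, 2.2, 1.5]"

definition h15 :: "real list" where
  "h15 = (let u = [1.4, 2.0, 1.4, 4.5, 1.4, 2.0, 1.4] in u @ [29.7] @ u)"

definition pat_b :: "real list" where
  "pat_b = [1.4, 2.0, 1.4, 3.9, 1.4, 2.0, 1.4]"

definition h31 :: "real list" where
  "h31 = pat_b @ [8.2] @ pat_b @ [72.3] @ pat_b @ [8.2] @ pat_b"

definition h63 :: "real list" where
  "h63 = (let v = pat_b @ [7.2] @ pat_b @ [14.2] @ pat_b @ [7.2] @ pat_b in v @ [164.0] @ v)"

definition h127 :: "real list" where
  "h127 = (let w = pat_b @ [7.2] @ pat_b @ [12.6] @ pat_b @ [7.2] @ pat_b @ [23.5] @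
                   pat_b @ [7.2] @ pat_b @ [12.6] @ pat_b @ [7.2] @ pat_b
           in w @ [370.0] @ w)"

lemma length_patterns:
  "length h7 = 7" "length h15 = 15" "length h31 = 31" "length h63 = 63" "length h127 = 127"
  by (simp_all add: h7_def h15_def h31_def h63_def h127_def pat_b_def Let_def)

end

theory Submission
  imports Defs
begin

text \<open>
  After rescaling to \<open>L = 1\<close>, all points of a convex 1-smooth function satisfy the interpolation
  inequalities \<open>f i \<ge> f j + g j \<bullet> (x i - x j) + (norm (g i - g j))\<^sup>2 / 2\<close>. Weights \<open>lam i j \<ge> 0\<close> that form a
  unit flow from the first to the last iterate yield \<open>f 0 - f t \<ge> Q g + (\<Sum>i. lam 0 i * W i)\<close>, where \<open>Q\<close> is a
  quadratic form with row sums \<open>r i\<close> of total \<open>S = \<Sum>i. h i\<close> and \<open>W i\<close> is the slack of the inequality from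
  the start to the \<open>i\<close>-th iterate. If \<open>Q\<close> is positive semidefinite, \<open>r i \<ge> 0\<close> and \<open>m\<close> is the mean of the
  gradients with weights \<open>r i / S\<close>, then \<open>Q g = S * (norm m)\<^sup>2 + Q (g - m)\<close>. Since also
  \<open>W i \<ge> \<delta> - g i \<bullet> (x 0 - x\<^sub>*) - (norm (g 0))\<^sup>2 / 2 + g 0 \<bullet> g i\<close> with \<open>\<delta> = f 0 - f\<^sub>*\<close>, the two conditions
  \<open>lam 0 i \<ge> 2 * \<Delta> * r i\<close> and \<open>Q d \<ge> \<Delta> * S * (norm (d 0))\<^sup>2\<close> suffice for a decrease of
  \<open>S * \<delta>\<^sup>2 / D\<^sup>2\<close> whenever \<open>\<delta> \<le> \<Delta> * D\<^sup>2\<close>: every pattern is straightforward even with \<open>\<epsilon> = 0\<close>. This is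
  needed, since for lengths 63 and 127 the constants \<open>c\<close> exceed \<open>S / t - \<epsilon>\<close>.

  Suitable weights were found by semidefinite programming and rounded; the forms are certified by
  approximate Cholesky factors with a diagonally dominant remainder. In the patterns of length 63 and
  127 the second half acts like one fictitious point whose gradient is a convex combination of
  gradients, so that a form in 33 resp. 65 vectors remains.
\<close>

section \<open>Interpolation inequalities of smooth convex functions\<close>

text \<open>The extremal case is a linear function: all gradients agree, and steps of total length S
  lower the value by exactly S times the squared norm of the gradient. Hence the forms below are
  exact on constant vectors: they equal S * (norm m)^2 there, or 0 for the second halves. The same
  case dictates what a fictitious endpoint must carry: its value is raised by s * (v \<bullet> v),
  where s is the total stepsize of the part it replaces. This is precisely the decrease of a linear
  function along that part, so nothing of the sum S is lost when half of a pattern is absorbed.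

  The bound for one pattern holds only for gaps up to \<Delta> * L * D^2, while a run may start with
  a larger one. There D, being only an upper bound of the distance, is enlarged until the gap
  becomes admissible. The quadratic decrease then turns into contraction by the constant factor 1 -
  S * \<Delta>, so the number of patterns spent in this phase depends neither on the function nor on
  L, D or the dimension. This is what makes the constants in the rate universal.\<close>

definition interpolates :: "'a::real_inner set \<Rightarrow> ('a \<Rightarrow> real) \<Rightarrow> ('a \<Rightarrow> 'a) \<Rightarrow> bool" where
  "interpolates E F G \<longleftrightarrow> subspace E \<and> (\<forall>x\<in>E. G x \<in> E) \<and>
     (\<forall>x\<in>E. \<forall>y\<in>E. F y + G y \<bullet> (x - y) + (norm (G x - G y))\<^sup>2 / 2 \<le> F x)"

text \<open>The gradient is a derivative only relative to \<open>E\<close>. A line through a point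
  of \<open>E\<close> in a direction of \<open>E\<close> stays in \<open>E\<close>, so along it
  there is an unrestricted derivative in one real variable; all uses of differentiability below go
  through this.\<close>

lemma has_field_derivative_along_line:
  assumes E: "subspace E" and f: "smooth_with_gradient L E f g" and x: "x \<in> E" and d: "d \<in> E"
  shows "((\<lambda>t. f (x + t *\<^sub>R d)) has_field_derivative d \<bullet> g (x + t *\<^sub>R d)) (at t)"
proof -
  have m: "x + s *\<^sub>R d \<in> E" for s
    using E x d by (simp add: subspace_add subspace_scale)
  have "((\<lambda>s. x + s *\<^sub>R d) has_derivative (\<lambda>s. s *\<^sub>R d)) (at t)"
    by (auto intro!: derivative_eq_intros)
  moreover have "(f has_derivative (\<lambda>v. v \<bullet> g (x + t *\<^sub>R d)))
      (at (x + t *\<^sub>R d) within range (\<lambda>s. x + s *\<^sub>R d))"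
  proof (rule has_derivative_subset)
    show "(f has_derivative (\<lambda>v. v \<bullet> g (x + t *\<^sub>R d))) (at (x + t *\<^sub>R d) within E)"
      using f m by (auto simp: smooth_with_gradient_def)
  qed (use m in auto)
  ultimately have "((\<lambda>s. f (x + s *\<^sub>R d)) has_derivative
      (\<lambda>s. (s *\<^sub>R d) \<bullet> g (x + t *\<^sub>R d))) (at t)"
    by (rule has_derivative_in_compose)
  then show ?thesis
    by (simp add: has_field_derivative_def mult_commute_abs)
qed

text \<open>By convexity the difference quotients at 0 from the right are at most the chord slope
  \<open>f x - f y\<close>, hence so is their limit.\<close>

lemma convex_on_above_tangent:
  assumes E: "subspace E" and cv: "convex_on E f" and f: "smooth_with_gradient L E f g"
    and x: "x \<in> E" and y: "y \<in> E"
  shows "f y + g y \<bullet> (x - y) \<le> f x"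
proof -
  let ?p = "\<lambda>t. f (y + t *\<^sub>R (x - y))"
  have d: "x - y \<in> E" using E x y by (simp add: subspace_diff)
  have "(?p has_field_derivative (x - y) \<bullet> g (y + 0 *\<^sub>R (x - y))) (at 0)"
    by (rule has_field_derivative_along_line[OF E f y d])
  then have "((\<lambda>t. (?p t - ?p 0) / (t - 0)) \<longlongrightarrow> (x - y) \<bullet> g y) (at 0)"
    unfolding has_field_derivative_iff by simp
  then have "((\<lambda>t. (?p t - ?p 0) / (t - 0)) \<longlongrightarrow> (x - y) \<bullet> g y) (at_right 0)"
    by (rule filterlim_mono) (auto simp: at_within_le_at)
  moreover have "eventually (\<lambda>t. (?p t - ?p 0) / (t - 0) \<le> f x - f y) (at_right (0::real))"
    using eventually_at_right_less[of 0] eventually_at_right_real[of 0 1, simplified]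
  proof eventually_elim
    case (elim t)
    then have t: "0 < t" "t < 1" by auto
    have "f ((1 - t) *\<^sub>R y + t *\<^sub>R x) \<le> (1 - t) * f y + t * f x"
      using cv t x y by (intro convex_onD) auto
    also have "(1 - t) *\<^sub>R y + t *\<^sub>R x = y + t *\<^sub>R (x - y)"
      by (simp add: algebra_simps)
    finally have "?p t - ?p 0 \<le> (f x - f y) * t" by (simp add: algebra_simps)
    then show ?case using t by (simp add: pos_divide_le_eq)
  qed
  ultimately have "(x - y) \<bullet> g y \<le> f x - f y"
    by (rule tendsto_upperbound) simp
  then show ?thesis by (simp add: inner_commute)
qed

lemma smooth_descent:
  assumes E: "subspace E" and f: "smooth_with_gradient L E f g" and x: "x \<in> E" and y: "y \<in> E"
  shows "f x \<le> f y + g y \<bullet> (x - y) + L / 2 * (norm (x - y))\<^sup>2"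
proof -
  define d where "d = x - y"
  have d: "d \<in> E" using E x y by (simp add: subspace_diff d_def)
  \<comment> \<open>Up to the constant \<open>f y\<close>, this is \<open>f\<close> minus its
    quadratic upper model along the segment; the Lipschitz bound makes its derivative nonpositive on
    [0, 1].\<close>
  let ?p = "\<lambda>t. f (y + t *\<^sub>R d) - t * (d \<bullet> g y) - L / 2 * t\<^sup>2 * (norm d)\<^sup>2"
  have "?p 1 \<le> ?p 0"
  proof (rule DERIV_nonpos_imp_nonincreasing[where f = ?p])
    fix t :: real assume t: "0 \<le> t" "t \<le> 1"
    have m: "y + t *\<^sub>R d \<in> E" using E y d by (simp add: subspace_add subspace_scale)
    have "d \<bullet> g (y + t *\<^sub>R d) - d \<bullet> g y = d \<bullet> (g (y + t *\<^sub>R d) - g y)"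
      by (simp add: inner_diff_right)
    also have "\<dots> \<le> norm d * norm (g (y + t *\<^sub>R d) - g y)"
      by (rule norm_cauchy_schwarz)
    also have "\<dots> \<le> norm d * (L * norm (t *\<^sub>R d))"
    proof -
      have "dist (g (y + t *\<^sub>R d)) (g y) \<le> L * dist (y + t *\<^sub>R d) y"
        using f m y by (auto simp: smooth_with_gradient_def intro: lipschitz_onD)
      then show ?thesis by (intro mult_left_mono) (auto simp: dist_norm)
    qed
    finally have "d \<bullet> g (y + t *\<^sub>R d) - d \<bullet> g y - L * t * (norm d)\<^sup>2 \<le> 0"
      using t by (simp add: power2_eq_square mult_ac)
    moreover have "(?p has_field_derivative
        d \<bullet> g (y + t *\<^sub>R d) - d \<bullet> g y - L * t * (norm d)\<^sup>2) (at t)"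
      by (rule derivative_eq_intros has_field_derivative_along_line[OF E f y d] refl
          | simp add: power2_eq_square)+
    ultimately show "\<exists>w. (?p has_real_derivative w) (at t) \<and> w \<le> 0" by blast
  qed simp
  then show ?thesis by (simp add: d_def inner_commute)
qed

lemma smooth_convex_interpolates:
  assumes E: "subspace E" and L: "L > 0" and cv: "convex_on E f"
    and f: "smooth_with_gradient L E f g"
  shows "interpolates E (\<lambda>x. f x / L) (\<lambda>x. g x /\<^sub>R L)"
proof -
  have gE: "g x \<in> E" if "x \<in> E" for x using f that by (auto simp: smooth_with_gradient_def)
  have "f y / L + (g y /\<^sub>R L) \<bullet> (x - y) + (norm (g x /\<^sub>R L - g y /\<^sub>R L))\<^sup>2 / 2 \<le> f x / L"
    if x: "x \<in> E" and y: "y \<in> E" for x y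
  proof -
    \<comment> \<open>The point \<open>z\<close> minimizes the quadratic upper model at
      \<open>x\<close> minus the tangent at \<open>y\<close>, so comparing the two bounds for
      \<open>f z\<close> gives the sharpest inequality.\<close>
    define q z where "q = g x - g y" and "z = x - q /\<^sub>R L"
    have z: "z \<in> E" unfolding z_def q_def using E x y gE by (intro subspace_diff subspace_scale) auto
    have "f y + g y \<bullet> (z - y) \<le> f x + g x \<bullet> (z - x) + L / 2 * (norm (z - x))\<^sup>2"
      using convex_on_above_tangent[OF E cv f z y] smooth_descent[OF E f z x] by linarith
    moreover have "g y \<bullet> (z - y) = g y \<bullet> (x - y) - (g y \<bullet> q) / L" "g x \<bullet> (z - x) = - (g x \<bullet> q) / L"
      by (simp_all add: z_def inner_diff_right divide_inverse mult.commute)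
    moreover have "L / 2 * (norm (z - x))\<^sup>2 = (q \<bullet> q) / (2 * L)"
    proof -
      have "(norm (z - x))\<^sup>2 = (q \<bullet> q) / (L * L)"
        using L by (simp add: z_def power2_norm_eq_inner[symmetric] power_mult_distrib power2_eq_square divide_inverse)
      then show ?thesis using L by simp
    qed
    moreover have "(g x \<bullet> q) / L - (g y \<bullet> q) / L = (q \<bullet> q) / L"
      by (simp add: q_def inner_diff_left diff_divide_distrib)
    moreover have "(q \<bullet> q) / L = 2 * ((q \<bullet> q) / (2 * L))" by simp
    ultimately have "f y + g y \<bullet> (x - y) + (q \<bullet> q) / (2 * L) \<le> f x"
      by linarith
    then have "f y + g y \<bullet> (x - y) + (norm (g x - g y))\<^sup>2 / (2 * L) \<le> f x"
      by (simp add: power2_norm_eq_inner q_def)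
    then have "(f y + g y \<bullet> (x - y) + (norm (g x - g y))\<^sup>2 / (2 * L)) / L \<le> f x / L"
      using L by (simp add: divide_right_mono)
    moreover have "norm (g x /\<^sub>R L - g y /\<^sub>R L) = norm (g x - g y) / L"
      using L by (metis abs_of_pos divide_inverse mult.commute norm_scaleR positive_imp_inverse_positive scaleR_diff_right)
    moreover have "(g y /\<^sub>R L) \<bullet> (x - y) = g y \<bullet> (x - y) / L"
      by (simp add: divide_inverse mult.commute)
    ultimately show ?thesis
      by (simp add: add_divide_distrib power_divide power2_eq_square)
  qed
  then show ?thesis
    using E gE by (auto simp: interpolates_def intro: subspace_scale)
qed

section \<open>Gradient descent along a pattern\<close>

primrec run :: "('a::real_vector \<Rightarrow> 'a) \<Rightarrow> real list \<Rightarrow> 'a \<Rightarrow> 'a" where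
  "run G [] x = x"
| "run G (a # as) x = run G as (x - a *\<^sub>R G x)"

lemma run_append: "run G (as @ bs) x = run G bs (run G as x)"
  by (induction as arbitrary: x) simp_all

lemma run_in_subspace:
  assumes "interpolates E F G" "x \<in> E"
  shows "run G h x \<in> E"
  using assms(2)
proof (induction h arbitrary: x)
  case (Cons a h)
  then have "x - a *\<^sub>R G x \<in> E"
    using assms(1) by (auto simp: interpolates_def intro: subspace_diff subspace_scale)
  then show ?case by (simp add: Cons.IH)
qed simp

text \<open>The offset \<open>m\<close> serves two uses: a single pattern from the start, and the
  periodic repetition, where each block begins at a multiple of \<open>length h\<close>.\<close>

lemma grad_descent_run:
  assumes "\<And>k. k < length h \<Longrightarrow> \<eta> (m + k) = h ! k"
  shows "grad_descent \<eta> L g x0 (m + length h) = run (\<lambda>x. g x /\<^sub>R L) h (grad_descent \<eta> L g x0 m)"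
  using assms
proof (induction h arbitrary: m)
  case (Cons a h)
  have "\<eta> (Suc m + k) = h ! k" if "k < length h" for k
    using Cons.prems[of "Suc k"] that by simp
  from Cons.IH[OF this] have "grad_descent \<eta> L g x0 (Suc m + length h)
    = run (\<lambda>x. g x /\<^sub>R L) h (grad_descent \<eta> L g x0 (Suc m))" by simp
  then show ?case
    using Cons.prems[of 0] by (simp add: divide_inverse)
qed simp

section \<open>Convergence rate of a straightforward pattern\<close>

lemma straightforward_decrease:
  assumes sf: "straightforward n h 0 \<Delta>" and LD: "L > 0" "D > 0"
    and \<delta>: "0 \<le> \<delta>" "\<delta> \<le> L * D\<^sup>2 * \<Delta>"
    and f: "convex_on (Rn n) f" "smooth_with_gradient L (Rn n) f g"
    and x: "x \<in> Rn n" "xs \<in> Rn n" "g xs = 0" "norm (x - xs) \<le> D" "f x - f xs \<le> \<delta>"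
  shows "f (run (\<lambda>x. g x /\<^sub>R L) h x) - f xs \<le> \<delta> - sum_list h / (L * D\<^sup>2) * \<delta>\<^sup>2"
proof -
  have "grad_descent (\<lambda>k. h ! k) L g x (length h) = run (\<lambda>x. g x /\<^sub>R L) h x"
    using grad_descent_run[of h "\<lambda>k. h ! k" 0 L g x] by simp
  then have "ereal (f (run (\<lambda>x. g x /\<^sub>R L) h x) - f xs) \<le> worst_case_gap n h L D \<delta>"
    unfolding worst_case_gap_def using f x
    by (intro Sup_upper) (smt (verit) mem_Collect_eq)
  also have "\<dots> \<le> ereal (\<delta> - (\<Sum>i<length h. h ! i - 0) / (L * D\<^sup>2) * \<delta>\<^sup>2)"
    using sf LD \<delta> unfolding straightforward_def by auto
  finally show ?thesis
    by (simp add: sum_list_sum_nth atLeast0LessThan)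
qed

text \<open>The usual argument lets the reciprocal of the gap grow by \<open>S / M\<close> in each
  step. The product form also covers a gap that has become 0. With \<open>u = S * a / M\<close> the
  next product is at most \<open>M * ((1 - u) * (u * real k + u))\<close>, where
  \<open>u * real k \<le> 1\<close> by the induction hypothesis.\<close>

lemma rate_recursion:
  fixes \<delta> :: "nat \<Rightarrow> real"
  assumes M: "M > 0" and S: "S > 0" and nn: "\<And>s. 0 \<le> \<delta> s"
    and st: "\<And>s. s \<ge> s0 \<Longrightarrow> \<delta> (Suc s) \<le> \<delta> s - S / M * (\<delta> s)\<^sup>2"
  shows "\<delta> (s0 + k) * (S * real k) \<le> M"
proof (induction k)
  case 0
  then show ?case using M by simp
next
  case (Suc k)
  define a b where "a = \<delta> (s0 + k)" and "b = \<delta> (s0 + Suc k)"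
  have ab: "0 \<le> a" "0 \<le> b" "b \<le> a - S / M * a\<^sup>2"
    using nn st[of "s0 + k"] by (auto simp: a_def b_def)
  have IH: "a * (S * real k) \<le> M" using Suc by (simp add: a_def)
  show ?case
  proof (cases "a = 0")
    case True
    then have "b = 0" using ab M by simp
    then show ?thesis unfolding b_def[symmetric] using M by simp
  next
    case False
    then have a: "a > 0" using ab by simp
    define u where "u = S * a / M"
    have u: "u > 0" using S a M by (simp add: u_def)
    have "b \<le> a * (1 - u)" using ab M by (simp add: u_def power2_eq_square field_simps)
    have "b * (S * real (Suc k)) = b * (S * real k) + b * S" by (simp add: algebra_simps)
    have ku: "u * real k \<le> 1" using IH M by (simp add: u_def field_simps)
    have le:  "(1 - u) * (u * real k + u) \<le> 1"
    proof (cases "u \<le> 1")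
      case True
      have "(1 - u) * (u * real k + u) \<le> (1 - u) * (1 + u)"
        using True ku by (intro mult_left_mono) auto
      also have "\<dots> \<le> 1" by (simp add: algebra_simps)
      finally show ?thesis .
    next
      case False
      then have "(1 - u) * (u * real k + u) \<le> 0"
        using u by (intro mult_nonpos_nonneg) auto
      then show ?thesis by simp
    qed
    have "b * (S * real (Suc k)) \<le> a * (1 - u) * (S * real (Suc k))"
      using \<open>b \<le> a * (1 - u)\<close> S by (intro mult_right_mono) auto
    also have "\<dots> = (a * S) * ((1 - u) * real (Suc k))" by (simp only: mult_ac)
    also have "a * S = M * u" using M by (simp add: u_def)
    also have "M * u * ((1 - u) * real (Suc k)) = M * ((1 - u) * (u * real k + u))"
      by (simp add: algebra_simps)
    also have "\<dots> \<le> M" using le M by simp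
    finally show ?thesis unfolding b_def .
  qed
qed

section \<open>Weighted sums of interpolation inequalities\<close>

text \<open>Inner products are symmetric, so a Gram form summed over all ordered pairs folds onto
  its upper triangle, the shape in which forms are stored and certified.\<close>

lemma sum_lessThan_pairs:
  fixes s :: "nat \<Rightarrow> nat \<Rightarrow> real"
  shows "(\<Sum>l<N. \<Sum>j<N. s l j) = (\<Sum>k<N. \<Sum>j\<in>{k..<N}. if k = j then s k k else s k j + s j k)"
proof (induction N)
  case (Suc N)
  have "(\<Sum>l<Suc N. \<Sum>j<Suc N. s l j)
      = (\<Sum>l<N. \<Sum>j<N. s l j) + (\<Sum>l<N. s l N) + (\<Sum>j<N. s N j) + s N N"
    by (simp add: sum.distrib)
  also have "\<dots> = (\<Sum>l<N. \<Sum>j<N. s l j) + (\<Sum>l<N. s l N + s N l) + s N N"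
    by (simp add: sum.distrib)
  also have "(\<Sum>l<N. \<Sum>j<N. s l j) + (\<Sum>l<N. s l N + s N l)
      = (\<Sum>k<N. \<Sum>j\<in>{k..<Suc N}. if k = j then s k k else s k j + s j k)"
    unfolding Suc sum.distrib[symmetric] by (rule sum.cong) auto
  finally show ?case by simp
qed simp

text \<open>In \<open>gram_entry\<close> the multipliers \<open>lam\<close>, \<open>mu\<close> are scaled by a common factor \<open>D\<close> and the
  stepsizes \<open>h\<close> by \<open>10\<close>; the entries are the coefficients of \<open>g k \<bullet> g j\<close>, \<open>k \<le> j\<close>, scaled by \<open>10 * D\<close>.\<close>

definition pre :: "(nat \<Rightarrow> nat \<Rightarrow> int) \<Rightarrow> (nat \<Rightarrow> int) \<Rightarrow> nat \<Rightarrow> nat \<Rightarrow> int" where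
  "pre lam mu k j = mu j + (\<Sum>i\<le>k. lam i j)"

definition gram_entry ::
    "nat \<Rightarrow> (nat \<Rightarrow> int) \<Rightarrow> (nat \<Rightarrow> nat \<Rightarrow> int) \<Rightarrow> (nat \<Rightarrow> int) \<Rightarrow> nat \<Rightarrow> nat \<Rightarrow> int" where
  "gram_entry n h lam mu k j =
     (if k = j then 5 * ((\<Sum>i\<le>n. lam k i) + pre lam mu n k)
                    - h k * (pre lam mu n k - pre lam mu k k) - 10 * lam k k
      else h k * pre lam mu k j - h j * (pre lam mu n k - pre lam mu j k) - 10 * (lam k j + lam j k))"

lemma weighted_interpolation:
  fixes x g :: "nat \<Rightarrow> 'a::real_inner" and \<phi> :: "nat \<Rightarrow> real" and z gz :: 'a and \<phi>z :: real
    and h mu :: "nat \<Rightarrow> int" and lam :: "nat \<Rightarrow> nat \<Rightarrow> int"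
  assumes step: "\<forall>k<n. x (Suc k) = x k - (real_of_int (h k) / 10) *\<^sub>R g k"
  shows "10 * ((\<Sum>i\<le>n. \<Sum>j\<le>n. lam i j * (\<phi> i - \<phi> j - g j \<bullet> (x i - x j) - (norm (g i - g j))\<^sup>2 / 2))
      + (\<Sum>j\<le>n. mu j * (\<phi>z - \<phi> j - g j \<bullet> (z - x j) - (norm (g j - gz))\<^sup>2 / 2)))
    = 10 * ((\<Sum>k\<le>n. ((\<Sum>j\<le>n. lam k j) - pre lam mu n k) * \<phi> k)
      + (\<Sum>j\<le>n. mu j) * (\<phi>z - (norm gz)\<^sup>2 / 2)
      + (gz - (z - x 0)) \<bullet> (\<Sum>j\<le>n. real_of_int (mu j) *\<^sub>R g j))
      - (\<Sum>k<Suc n. \<Sum>j\<in>{k..<Suc n}. gram_entry n h lam mu k j * (g k \<bullet> g j))"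
proof -
  let ?p = "\<lambda>k j. real_of_int (pre lam mu k j)"
  have x: "x i = x 0 - (\<Sum>l<i. (real_of_int (h l) / 10) *\<^sub>R g l)" if "i \<le> n" for i
    using that
  proof (induction i)
    case (Suc i)
    then show ?case using step by simp
  qed simp
  \<comment> \<open>Measuring from \<open>x 0\<close> splits \<open>x i - x j\<close> into two
    prefix sums of steps.\<close>
  define X where "X j i = 10 * (g j \<bullet> (x 0 - x i))" for i j
  have X: "X j i = (\<Sum>l<Suc n. if l < i then h l * (g l \<bullet> g j) else 0)" if "i \<le> n" for i j
  proof -
    have "X j i = (\<Sum>l<i. h l * (g l \<bullet> g j))"
      using x[OF that] by (simp add: X_def inner_sum_right sum_distrib_left inner_commute)
    also have "\<dots> = (\<Sum>l<Suc n. if l < i then h l * (g l \<bullet> g j) else 0)"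
      using that by (intro sum.mono_neutral_cong_left) auto
    finally show ?thesis .
  qed
  \<comment> \<open>The coefficient before symmetrization: \<open>l\<close> supplies the
    displacement, \<open>j\<close> the gradient in the inequality.\<close>
  define s where "s l j = (h l * ((if l < j then pre lam mu n j else 0) - (pre lam mu n j - pre lam mu l j))
      - 10 * lam l j + (if l = j then 5 * ((\<Sum>i\<le>n. lam l i) + pre lam mu n l) else 0)) * (g l \<bullet> g j)" for l j
  have gram: "(\<Sum>k<Suc n. \<Sum>j\<in>{k..<Suc n}. gram_entry n h lam mu k j * (g k \<bullet> g j))
      = (\<Sum>l<Suc n. \<Sum>j<Suc n. s l j)"
    unfolding sum_lessThan_pairs[of s]
    by (intro sum.cong refl) (auto simp: s_def gram_entry_def algebra_simps inner_commute)
  \<comment> \<open>The gradient \<open>g l\<close> moves exactly the points \<open>x i\<close> with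
    \<open>i > l\<close>, so it meets only the weights into \<open>j\<close> from those points.
    Their sum is a difference of prefix sums, in which \<open>mu\<close> cancels.\<close>
  have suffix: "(\<Sum>i\<le>n. if l < i then lam i j else 0) = pre lam mu n j - pre lam mu l j" if "l \<le> n" for l j
  proof -
    have "pre lam mu n j = mu j + (\<Sum>i\<le>n. if l < i then lam i j else 0) + (\<Sum>i\<le>n. if l < i then 0 else lam i j)"
      unfolding pre_def add.assoc sum.distrib[symmetric] by (intro arg_cong2[of _ _ _ _ "(+)"] sum.cong refl) auto
    also have "(\<Sum>i\<le>n. if l < i then 0 else lam i j) = (\<Sum>i\<le>l. lam i j)"
      using that by (intro sum.mono_neutral_cong_right) auto
    finally show ?thesis by (simp add: pre_def)
  qed
  have tot: "real_of_int (pre lam mu n j) = mu j + (\<Sum>i\<le>n. real_of_int (lam i j))" for j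
    by (simp add: pre_def)
  have lx: "(\<Sum>i\<le>n. \<Sum>j\<le>n. lam i j * X j i)
      = (\<Sum>j\<le>n. \<Sum>l<Suc n. h l * (?p n j - ?p l j) * (g l \<bullet> g j))"
  proof -
    have "(\<Sum>i\<le>n. \<Sum>j\<le>n. lam i j * X j i)
        = (\<Sum>i\<le>n. \<Sum>j\<le>n. \<Sum>l<Suc n. (if l < i then lam i j else 0) * (h l * (g l \<bullet> g j)))"
      by (intro sum.cong refl) (auto simp: X sum_distrib_left intro!: sum.cong)
    also have "\<dots> = (\<Sum>j\<le>n. \<Sum>i\<le>n. \<Sum>l<Suc n. (if l < i then lam i j else 0) * (h l * (g l \<bullet> g j)))"
      by (rule sum.swap)
    also have "\<dots> = (\<Sum>j\<le>n. \<Sum>l<Suc n. \<Sum>i\<le>n. (if l < i then lam i j else 0) * (h l * (g l \<bullet> g j)))"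
      by (intro sum.cong refl sum.swap)
    also have "\<dots> = (\<Sum>j\<le>n. \<Sum>l<Suc n. (?p n j - ?p l j) * (h l * (g l \<bullet> g j)))"
    proof (intro sum.cong refl)
      fix j l assume "l \<in> {..<Suc n}"
      then have "l \<le> n" by simp
      have "(\<Sum>i\<le>n. (if l < i then lam i j else 0) * (h l * (g l \<bullet> g j)))
        = real_of_int (\<Sum>i\<le>n. if l < i then lam i j else 0) * (h l * (g l \<bullet> g j))"
        by (simp add: sum_distrib_right)
      then show "(\<Sum>i\<le>n. (if l < i then lam i j else 0) * (h l * (g l \<bullet> g j)))
        = (?p n j - ?p l j) * (h l * (g l \<bullet> g j))"
        unfolding suffix[OF \<open>l \<le> n\<close>] by simp
    qed
    finally show ?thesis by (simp only: mult_ac)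
  qed
  have xx: "(\<Sum>j\<le>n. ?p n j * X j j)
      = (\<Sum>j\<le>n. \<Sum>l<Suc n. h l * (if l < j then ?p n j else 0) * (g l \<bullet> g j))"
    by (intro sum.cong refl) (auto simp: X sum_distrib_left intro!: sum.cong)
  have sq: "(\<Sum>l<Suc n. \<Sum>j<Suc n. s l j)
      = (\<Sum>j\<le>n. ?p n j * X j j) - (\<Sum>i\<le>n. \<Sum>j\<le>n. lam i j * X j i)
        - 10 * (\<Sum>i\<le>n. \<Sum>j\<le>n. lam i j * (g i \<bullet> g j))
        + 5 * (\<Sum>k\<le>n. ((\<Sum>i\<le>n. lam k i) + ?p n k) * (g k \<bullet> g k))"
  proof -
    have "(\<Sum>l<Suc n. \<Sum>j<Suc n. s l j) =
        (\<Sum>l<Suc n. \<Sum>j<Suc n. h l * (if l < j then ?p n j else 0) * (g l \<bullet> g j)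
          - h l * (?p n j - ?p l j) * (g l \<bullet> g j) - 10 * (lam l j * (g l \<bullet> g j))
          + 5 * (if l = j then ((\<Sum>i\<le>n. lam l i) + ?p n l) * (g l \<bullet> g l) else 0))"
      by (intro sum.cong refl) (auto simp: s_def algebra_simps)
    also have "\<dots> = (\<Sum>l<Suc n. \<Sum>j<Suc n. h l * (if l < j then ?p n j else 0) * (g l \<bullet> g j))
        - (\<Sum>l<Suc n. \<Sum>j<Suc n. h l * (?p n j - ?p l j) * (g l \<bullet> g j))
        - 10 * (\<Sum>l<Suc n. \<Sum>j<Suc n. lam l j * (g l \<bullet> g j))
        + 5 * (\<Sum>l<Suc n. \<Sum>j<Suc n. if l = j then ((\<Sum>i\<le>n. lam l i) + ?p n l) * (g l \<bullet> g l) else 0)"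
      by (simp only: sum.distrib sum_subtractf sum_distrib_left)
    also have "(\<Sum>l<Suc n. \<Sum>j<Suc n. h l * (if l < j then ?p n j else 0) * (g l \<bullet> g j))
        = (\<Sum>j\<le>n. ?p n j * X j j)"
      unfolding xx lessThan_Suc_atMost by (rule sum.swap)
    also have "(\<Sum>l<Suc n. \<Sum>j<Suc n. h l * (?p n j - ?p l j) * (g l \<bullet> g j))
        = (\<Sum>i\<le>n. \<Sum>j\<le>n. lam i j * X j i)"
      unfolding lx lessThan_Suc_atMost by (rule sum.swap)
    also have "(\<Sum>l<Suc n. \<Sum>j<Suc n. if l = j then ((\<Sum>i\<le>n. lam l i) + ?p n l) * (g l \<bullet> g l) else 0)
        = (\<Sum>k\<le>n. ((\<Sum>i\<le>n. lam k i) + ?p n k) * (g k \<bullet> g k))"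
      by (simp only: sum.delta' finite_lessThan lessThan_Suc_atMost)
         (intro sum.cong refl, simp)
    finally show ?thesis by (simp only: lessThan_Suc_atMost)
  qed
  have n2: "(norm (a - b))\<^sup>2 / 2 = (a \<bullet> a) / 2 + (b \<bullet> b) / 2 - a \<bullet> b" for a b :: 'a
    by (simp add: power2_norm_eq_inner inner_diff_left inner_diff_right inner_commute field_simps)
  have xd: "10 * (g j \<bullet> (x i - x j)) = X j j - X j i" for i j
    by (simp add: X_def inner_diff_right)
  have zd: "10 * (g j \<bullet> (z - x j)) = 10 * ((z - x 0) \<bullet> g j) + X j j" for j
    by (simp add: X_def inner_diff_right inner_diff_left inner_commute)
  have A: "10 * (\<Sum>i\<le>n. \<Sum>j\<le>n. lam i j * (\<phi> i - \<phi> j - g j \<bullet> (x i - x j) - (norm (g i - g j))\<^sup>2 / 2))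
    = 10 * (\<Sum>i\<le>n. (\<Sum>j\<le>n. lam i j) * \<phi> i) - 10 * (\<Sum>j\<le>n. (\<Sum>i\<le>n. lam i j) * \<phi> j)
      - (\<Sum>j\<le>n. (\<Sum>i\<le>n. lam i j) * X j j) + (\<Sum>i\<le>n. \<Sum>j\<le>n. lam i j * X j i)
      - 5 * (\<Sum>i\<le>n. (\<Sum>j\<le>n. lam i j) * (g i \<bullet> g i)) - 5 * (\<Sum>j\<le>n. (\<Sum>i\<le>n. lam i j) * (g j \<bullet> g j))
      + 10 * (\<Sum>i\<le>n. \<Sum>j\<le>n. lam i j * (g i \<bullet> g j))"
  proof -
    have "10 * (\<Sum>i\<le>n. \<Sum>j\<le>n. lam i j * (\<phi> i - \<phi> j - g j \<bullet> (x i - x j) - (norm (g i - g j))\<^sup>2 / 2))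
      = (\<Sum>i\<le>n. \<Sum>j\<le>n. lam i j * (10 * \<phi> i - 10 * \<phi> j - 10 * (g j \<bullet> (x i - x j)) - 10 * ((norm (g i - g j))\<^sup>2 / 2)))"
      by (simp add: sum_distrib_left algebra_simps)
    also have "\<dots> = (\<Sum>i\<le>n. \<Sum>j\<le>n. 10 * (lam i j * \<phi> i) - 10 * (lam i j * \<phi> j) - lam i j * X j j
        + lam i j * X j i - 5 * (lam i j * (g i \<bullet> g i)) - 5 * (lam i j * (g j \<bullet> g j))
        + 10 * (lam i j * (g i \<bullet> g j)))"
      unfolding xd n2 by (intro sum.cong refl) (simp add: algebra_simps)
    also have "\<dots> = 10 * (\<Sum>i\<le>n. \<Sum>j\<le>n. lam i j * \<phi> i) - 10 * (\<Sum>i\<le>n. \<Sum>j\<le>n. lam i j * \<phi> j)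
      - (\<Sum>i\<le>n. \<Sum>j\<le>n. lam i j * X j j) + (\<Sum>i\<le>n. \<Sum>j\<le>n. lam i j * X j i)
      - 5 * (\<Sum>i\<le>n. \<Sum>j\<le>n. lam i j * (g i \<bullet> g i)) - 5 * (\<Sum>i\<le>n. \<Sum>j\<le>n. lam i j * (g j \<bullet> g j))
      + 10 * (\<Sum>i\<le>n. \<Sum>j\<le>n. lam i j * (g i \<bullet> g j))"
      by (simp only: sum.distrib sum_subtractf sum_distrib_left)
    also have "(\<Sum>i\<le>n. \<Sum>j\<le>n. lam i j * \<phi> j) = (\<Sum>j\<le>n. (\<Sum>i\<le>n. lam i j) * \<phi> j)"
      by (subst sum.swap) (simp add: sum_distrib_right)
    also have "(\<Sum>i\<le>n. \<Sum>j\<le>n. lam i j * X j j) = (\<Sum>j\<le>n. (\<Sum>i\<le>n. lam i j) * X j j)"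
      by (subst sum.swap) (simp add: sum_distrib_right)
    also have "(\<Sum>i\<le>n. \<Sum>j\<le>n. lam i j * (g j \<bullet> g j)) = (\<Sum>j\<le>n. (\<Sum>i\<le>n. lam i j) * (g j \<bullet> g j))"
      by (subst sum.swap) (simp add: sum_distrib_right)
    also have "(\<Sum>i\<le>n. \<Sum>j\<le>n. lam i j * \<phi> i) = (\<Sum>i\<le>n. (\<Sum>j\<le>n. lam i j) * \<phi> i)"
      by (simp add: sum_distrib_right)
    also have "(\<Sum>i\<le>n. \<Sum>j\<le>n. lam i j * (g i \<bullet> g i)) = (\<Sum>i\<le>n. (\<Sum>j\<le>n. lam i j) * (g i \<bullet> g i))"
      by (simp add: sum_distrib_right)
    finally show ?thesis .
  qed
  have B: "10 * (\<Sum>j\<le>n. mu j * (\<phi>z - \<phi> j - g j \<bullet> (z - x j) - (norm (g j - gz))\<^sup>2 / 2))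
    = 10 * ((\<Sum>j\<le>n. mu j) * (\<phi>z - (norm gz)\<^sup>2 / 2)) - 10 * (\<Sum>j\<le>n. mu j * \<phi> j)
      + 10 * ((gz - (z - x 0)) \<bullet> (\<Sum>j\<le>n. real_of_int (mu j) *\<^sub>R g j))
      - (\<Sum>j\<le>n. mu j * X j j) - 5 * (\<Sum>j\<le>n. mu j * (g j \<bullet> g j))"
  proof -
    have "10 * (\<Sum>j\<le>n. mu j * (\<phi>z - \<phi> j - g j \<bullet> (z - x j) - (norm (g j - gz))\<^sup>2 / 2))
      = (\<Sum>j\<le>n. mu j * (10 * \<phi>z - 10 * \<phi> j - 10 * (g j \<bullet> (z - x j)) - 10 * ((norm (g j - gz))\<^sup>2 / 2)))"
      by (simp add: sum_distrib_left algebra_simps)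
    also have "\<dots> = (\<Sum>j\<le>n. 10 * (mu j * (\<phi>z - (norm gz)\<^sup>2 / 2)) - 10 * (mu j * \<phi> j)
        + 10 * (mu j * ((gz - (z - x 0)) \<bullet> g j)) - mu j * X j j - 5 * (mu j * (g j \<bullet> g j)))"
      unfolding zd n2 by (intro sum.cong refl)
        (simp add: power2_norm_eq_inner inner_diff_left inner_commute algebra_simps)
    also have "\<dots> = 10 * (\<Sum>j\<le>n. mu j * (\<phi>z - (norm gz)\<^sup>2 / 2)) - 10 * (\<Sum>j\<le>n. mu j * \<phi> j)
        + 10 * (\<Sum>j\<le>n. mu j * ((gz - (z - x 0)) \<bullet> g j)) - (\<Sum>j\<le>n. mu j * X j j)
        - 5 * (\<Sum>j\<le>n. mu j * (g j \<bullet> g j))"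
      by (simp only: sum.distrib sum_subtractf sum_distrib_left)
    finally show ?thesis
      by (simp add: sum_distrib_right inner_sum_right)
  qed
  show ?thesis
    unfolding gram sq distrib_left[of 10] A B
    by (simp add: tot sum.distrib sum_subtractf distrib_right left_diff_distrib)
qed

section \<open>Quadratic forms in triangular lists\<close>

fun lincomb :: "int list \<Rightarrow> 'a::real_vector list \<Rightarrow> 'a" where
  "lincomb (a # as) (v # vs) = real_of_int a *\<^sub>R v + lincomb as vs"
| "lincomb _ _ = 0"

text \<open>Off-diagonal entries are full coefficients of inner products, that is, twice the entries
  of the symmetric matrix. This keeps them integral and explains the factors 2 in
  \<open>sub_outer\<close>, \<open>psd\<close> and \<open>rsum\<close>.\<close>

fun qform :: "int list list \<Rightarrow> 'a::real_inner list \<Rightarrow> real" where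
  "qform ((a # as) # rs) (v # vs) = a * (v \<bullet> v) + v \<bullet> lincomb as vs + qform rs vs"
| "qform _ _ = 0"

fun wnorm :: "int list \<Rightarrow> 'a::real_inner list \<Rightarrow> real" where
  "wnorm (b # bs) (v # vs) = b * (v \<bullet> v) + wnorm bs vs"
| "wnorm _ _ = 0"

fun triangular :: "int list list \<Rightarrow> bool" where
  "triangular [] = True"
| "triangular (r # rs) = (length r = Suc (length rs) \<and> triangular rs)"

lemma lincomb_map: "lincomb (map a xs) (map g xs) = (\<Sum>i\<leftarrow>xs. real_of_int (a i) *\<^sub>R g i)"
  by (induction xs) simp_all

lemma lincomb_upt: "lincomb (map a [m..<N]) (map g [m..<N]) = (\<Sum>i\<in>{m..<N}. real_of_int (a i) *\<^sub>R g i)"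
  by (simp add: lincomb_map interv_sum_list_conv_sum_set_nat)

lemma triangular_upt: "triangular (map (\<lambda>k. map (c k) [k..<N]) [m..<N])"
proof (induction "N - m" arbitrary: m)
  case (Suc d)
  then have "m < N" "d = N - Suc m" by simp_all
  then show ?case using Suc(1)[of "Suc m"] by (simp add: upt_conv_Cons)
qed simp

lemma qform_upt:
  "qform (map (\<lambda>k. map (c k) [k..<N]) [m..<N]) (map g [m..<N])
    = (\<Sum>k\<in>{m..<N}. \<Sum>j\<in>{k..<N}. c k j * (g k \<bullet> g j))"
proof (induction "N - m" arbitrary: m)
  case (Suc d)
  then have m: "m < N" "d = N - Suc m" by simp_all
  then show ?case using Suc(1)[of "Suc m"]
    by (simp add: upt_conv_Cons lincomb_upt inner_sum_right sum.atLeast_Suc_lessThan)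
qed simp

section \<open>Semidefiniteness by rank-one subtraction and diagonal dominance\<close>

fun sub_row :: "int \<Rightarrow> int list \<Rightarrow> int list \<Rightarrow> int list" where
  "sub_row d (a # as) (y # ys) = (a - d * y) # sub_row d as ys"
| "sub_row _ _ _ = []"

fun sub_outer :: "int \<Rightarrow> int list \<Rightarrow> int list list \<Rightarrow> int list list" where
  "sub_outer c (l # ls) ((a # as) # rs) =
     ((a - c * l * l) # sub_row (2 * c * l) as ls) # sub_outer c ls rs"
| "sub_outer _ _ _ = []"

lemma sub_row:
  assumes "length as = length ys"
  shows "length (sub_row d as ys) = length as"
    and "lincomb (sub_row d as ys) vs = lincomb as vs - real_of_int d *\<^sub>R lincomb ys vs"
proof -
  show "length (sub_row d as ys) = length as"
    using assms by (induction as ys rule: list_induct2) auto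
  show "lincomb (sub_row d as ys) vs = lincomb as vs - real_of_int d *\<^sub>R lincomb ys vs"
    using assms
  proof (induction as ys arbitrary: vs rule: list_induct2)
    case (Cons a as y ys)
    then show ?case by (cases vs) (auto simp: algebra_simps)
  qed simp
qed

lemma sub_outer:
  assumes "triangular M" "length l = length M"
  shows "length (sub_outer c l M) = length M" and "triangular (sub_outer c l M)"
    and "length vs = length M \<Longrightarrow> qform M vs = c * (lincomb l vs \<bullet> lincomb l vs) + qform (sub_outer c l M) vs"
proof -
  have len: "length (sub_outer c l M) = length M" if "triangular M" "length l = length M" for M l
    using that
  proof (induction M arbitrary: l)
    case (Cons r M)
    then show ?case by (cases l; cases r) auto
  qed simp
  then show "length (sub_outer c l M) = length M" using assms .
  show "triangular (sub_outer c l M)"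
    using assms
  proof (induction M arbitrary: l)
    case (Cons r M)
    then show ?case by (cases l; cases r) (auto simp: sub_row(1) len)
  qed simp
  show "qform M vs = c * (lincomb l vs \<bullet> lincomb l vs) + qform (sub_outer c l M) vs"
    if "length vs = length M"
    using assms that
  proof (induction M arbitrary: l vs)
    case (Cons r M)
    then obtain x xs a as v ws where *: "l = x # xs" "r = a # as" "vs = v # ws"
      by (cases l; cases r; cases vs) auto
    with Cons.prems have l: "length as = length xs" by simp
    have "qform M ws = c * (lincomb xs ws \<bullet> lincomb xs ws) + qform (sub_outer c xs M) ws"
      using Cons.prems * by (intro Cons.IH) auto
    then show ?case
      by (simp add: * sub_row(2)[OF l] inner_add_left inner_add_right inner_diff_right inner_commute algebra_simps)
  qed simp
qed

fun add_abs :: "int list \<Rightarrow> int list \<Rightarrow> int list" where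
  "add_abs (b # bs) (a # as) = (b + \<bar>a\<bar>) # add_abs bs as"
| "add_abs _ _ = []"

fun abs_sum :: "int list \<Rightarrow> int" where
  "abs_sum [] = 0"
| "abs_sum (a # as) = \<bar>a\<bar> + abs_sum as"

text \<open>\<open>psd c L bs M\<close> subtracts the rank-one forms \<open>c * l * l\<^sup>T\<close>, \<open>l \<in> L\<close>, from \<open>M\<close> and tests the
  remainder for diagonal dominance; \<open>bs\<close> accumulates the absolute column sums of the rows already
  passed.\<close>

fun psd :: "int \<Rightarrow> int list list \<Rightarrow> int list \<Rightarrow> int list list \<Rightarrow> bool" where
  "psd c ls [] M = True"
| "psd c [] (b # bs) ((a # as) # rs) = (b + abs_sum as \<le> 2 * a \<and> psd c [] (add_abs bs as) rs)"
| "psd c (l # ls) (b # bs) M = (length l = length M \<and>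
     (case sub_outer c l M of
        (a # as) # rs \<Rightarrow> b + abs_sum as \<le> 2 * a \<and> psd c ls (add_abs bs as) rs
      | _ \<Rightarrow> False))"
| "psd c [] (b # bs) _ = False"

lemma add_abs:
  assumes "length bs = length as"
  shows "length (add_abs bs as) = length bs"
    and "wnorm (add_abs bs as) vs = wnorm bs vs + wnorm (map abs as) vs"
proof -
  show "length (add_abs bs as) = length bs"
    using assms by (induction bs as rule: list_induct2) auto
  show "wnorm (add_abs bs as) vs = wnorm bs vs + wnorm (map abs as) vs"
    using assms
  proof (induction bs as arbitrary: vs rule: list_induct2)
    case (Cons a as y ys)
    then show ?case by (cases vs) (auto simp: algebra_simps)
  qed simp
qed

lemma inner_lincomb_ge:
  "- (abs_sum as * (v \<bullet> v)) - wnorm (map abs as) vs \<le> 2 * (v \<bullet> lincomb as vs)"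
proof (induction as arbitrary: vs)
  case (Cons a as)
  have nn: "0 \<le> real_of_int (abs_sum as)" by (induction as) auto
  show ?case
  proof (cases vs)
    case Nil
    then show ?thesis using nn by simp
  next
    case (Cons w ws)
    have sq: "\<bar>2 * (v \<bullet> w)\<bar> \<le> v \<bullet> v + w \<bullet> w"
    proof -
      have "0 \<le> (v - w) \<bullet> (v - w)" "0 \<le> (v + w) \<bullet> (v + w)" by simp_all
      then show ?thesis by (simp add: inner_diff_left inner_diff_right inner_add_left inner_add_right inner_commute)
    qed
    have "\<bar>a * (2 * (v \<bullet> w))\<bar> \<le> \<bar>real_of_int a\<bar> * (v \<bullet> v + w \<bullet> w)"
      unfolding abs_mult[of "real_of_int a"] by (rule mult_left_mono[OF sq]) simp
    then have "- (\<bar>real_of_int a\<bar> * (v \<bullet> v + w \<bullet> w)) \<le> a * (2 * (v \<bullet> w))" by linarith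
    then show ?thesis
      using Cons.IH[of ws] Cons by (simp add: inner_add_right algebra_simps)
  qed
qed simp

lemma psd_sound:
  assumes "psd c L bs M" "0 \<le> c" "triangular M" "length M = length bs" "length vs = length bs"
  shows "wnorm bs vs \<le> 2 * qform M vs"
  using assms
proof (induction c L bs M arbitrary: vs rule: psd.induct)
  case (2 c b bs a as rs)
  then obtain v ws where vs: "vs = v # ws" by (cases vs) auto
  have l: "length bs = length as" using 2 by simp
  have "wnorm (add_abs bs as) ws \<le> 2 * qform rs ws"
    using 2 vs by (intro 2(1)) (auto simp: add_abs)
  moreover have "(b + abs_sum as) * (v \<bullet> v) \<le> 2 * a * (v \<bullet> v)"
    using 2(2) by (intro mult_right_mono) (auto simp flip: of_int_add)
  ultimately show ?case
    using inner_lincomb_ge[of as v ws] by (simp add: vs add_abs[OF l] algebra_simps)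
next
  case (3 c l ls b bs M)
  let ?N = "sub_outer c l M"
  have lM: "length l = length M" using 3 by simp
  have N: "length ?N = length M" "triangular ?N"
    using sub_outer[OF 3(4) lM] by auto
  then obtain a as rs where R: "?N = (a # as) # rs"
    using 3 by (cases ?N; cases "hd ?N") auto
  obtain v ws where vs: "vs = v # ws" using 3 by (cases vs) auto
  have l: "length bs = length as" "length rs = length bs" using 3 N unfolding R by auto
  have chk: "b + abs_sum as \<le> 2 * a" "psd c ls (add_abs bs as) rs" using 3(2) R by auto
  have "wnorm (add_abs bs as) ws \<le> 2 * qform rs ws"
    using 3 chk l N R vs by (intro 3(1)[OF R refl]) (auto simp: add_abs)
  moreover have "real_of_int (b + abs_sum as) * (v \<bullet> v) \<le> real_of_int (2 * a) * (v \<bullet> v)"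
    using chk(1) by (intro mult_right_mono) (auto simp only: of_int_le_iff inner_ge_zero)
  ultimately have "wnorm (b # bs) vs \<le> 2 * qform ?N vs"
    using inner_lincomb_ge[of as v ws] by (simp add: R vs add_abs[OF l(1)] algebra_simps)
  moreover have "qform M vs = c * (lincomb l vs \<bullet> lincomb l vs) + qform ?N vs"
    using 3 by (intro sub_outer) auto
  moreover have "0 \<le> c * (lincomb l vs \<bullet> lincomb l vs)" using 3 by simp
  ultimately show ?case by linarith
qed auto

lemma psd_zero_sound:
  assumes "psd c L (map (\<lambda>_. 0) M) M" "0 \<le> c" "triangular M" "length vs = length M"
  shows "0 \<le> qform M vs"
proof -
  have "wnorm (map (\<lambda>_. 0) M) vs = 0" for M :: "int list list" and vs :: "'a list"
  proof (induction M arbitrary: vs)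
    case (Cons r M)
    then show ?case by (cases vs) auto
  qed simp
  then show ?thesis
    using psd_sound[OF assms(1-3), of vs] assms(4) by simp
qed

section \<open>Bordering a form by one more vector\<close>

fun snoc_rows :: "int list list \<Rightarrow> int list \<Rightarrow> int \<Rightarrow> int list list" where
  "snoc_rows [] _ y = [[y]]"
| "snoc_rows (r # rs) (x # xs) y = (r @ [x]) # snoc_rows rs xs y"
| "snoc_rows (r # rs) [] y = []"

lemma snoc_rows:
  assumes "triangular M" "length xs = length M"
  shows "length (snoc_rows M xs y) = Suc (length M)" and "triangular (snoc_rows M xs y)"
    and "length vs = length M \<Longrightarrow> qform (snoc_rows M xs y) (vs @ [w]) = qform M vs + lincomb xs vs \<bullet> w + y * (w \<bullet> w)"
proof -
  have len: "length (snoc_rows M xs y) = Suc (length M)" if "length xs = length M" for M xs y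
    using that by (induction M xs y rule: snoc_rows.induct) auto
  then show "length (snoc_rows M xs y) = Suc (length M)" using assms(2) .
  show "triangular (snoc_rows M xs y)"
    using assms by (induction M xs y rule: snoc_rows.induct) (auto simp: len)
  have snoc: "lincomb (as @ [x]) (ws @ [w]) = lincomb as ws + real_of_int x *\<^sub>R w"
    if "length as = length ws" for as x and ws :: "'a list"
    using that by (induction as ws rule: list_induct2) auto
  show "qform (snoc_rows M xs y) (vs @ [w]) = qform M vs + lincomb xs vs \<bullet> w + y * (w \<bullet> w)"
    if "length vs = length M"
    using assms that
  proof (induction M xs y arbitrary: vs rule: snoc_rows.induct)
    case (2 r rs x xs y)
    then obtain a as v ws where *: "r = a # as" "vs = v # ws"
      by (cases r; cases vs) auto
    have "qform (snoc_rows rs xs y) (ws @ [w]) = qform rs ws + lincomb xs ws \<bullet> w + y * (w \<bullet> w)"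
      using 2 * by (intro 2(1)) auto
    moreover have "length as = length ws" using 2 * by simp
    ultimately show ?case
      by (simp add: * snoc inner_add_right inner_add_left algebra_simps)
  qed auto
qed

text \<open>\<open>rsum\<close> computes twice the row sums of the symmetric matrix of the form.\<close>

fun rsum :: "int list \<Rightarrow> int list list \<Rightarrow> int list" where
  "rsum (b # bs) ((a # as) # rs) = (b + 2 * a + sum_list as) # rsum (map2 (+) bs as) rs"
| "rsum _ _ = []"

lemma lincomb_add:
  "length as = length bs \<Longrightarrow> lincomb (map2 (+) as bs) vs = lincomb as vs + lincomb bs vs"
proof (induction as bs arbitrary: vs rule: list_induct2)
  case (Cons a as b bs)
  then show ?case by (cases vs) (auto simp: algebra_simps)
qed simp

lemma sum_list_add:
  "length as = length bs \<Longrightarrow> sum_list (map2 (+) as bs) = sum_list as + (sum_list bs :: int)"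
  by (induction as bs rule: list_induct2) auto

lemma lincomb_translate:
  "length as = length vs \<Longrightarrow> lincomb as (map (\<lambda>v. v + c) vs) = lincomb as vs + real_of_int (sum_list as) *\<^sub>R c"
  by (induction as vs rule: list_induct2) (auto simp: algebra_simps)

text \<open>A common shift meets the form only through its row sums. The accumulator
  \<open>bs\<close> holds what the rows already passed contribute to the remaining columns, hence
  its subtraction. With \<open>bs\<close> zero and \<open>c\<close> the mean weighted by the row
  sums, the linear term vanishes; this is the splitting into mean and deviations.\<close>

lemma qform_translate:
  assumes "triangular M" "length bs = length M" "length vs = length M"
  shows "qform M (map (\<lambda>v. v + c) vs) = qform M vs + c \<bullet> (lincomb (rsum bs M) vs - lincomb bs vs)
    + (sum_list (rsum bs M) - sum_list bs) / 2 * (c \<bullet> c)"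
  using assms
proof (induction M arbitrary: bs vs)
  case (Cons r M)
  then obtain b bs' a as v ws where *: "bs = b # bs'" "r = a # as" "vs = v # ws"
    by (cases bs; cases r; cases vs) auto
  have l: "length bs' = length as" "length as = length ws" using Cons.prems * by auto
  have "qform M (map (\<lambda>v. v + c) ws)
      = qform M ws + c \<bullet> (lincomb (rsum (map2 (+) bs' as) M) ws - lincomb (map2 (+) bs' as) ws)
        + (sum_list (rsum (map2 (+) bs' as) M) - sum_list (map2 (+) bs' as)) / 2 * (c \<bullet> c)"
    using Cons.prems * by (intro Cons.IH) auto
  then show ?case
    by (simp add: * lincomb_add[OF l(1)] sum_list_add[OF l(1)] lincomb_translate[OF l(2)]
        inner_add_left inner_add_right inner_diff_right inner_commute algebra_simps
        add_divide_distrib diff_divide_distrib)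
qed simp

lemma length_rsum: "triangular M \<Longrightarrow> length bs = length M \<Longrightarrow> length (rsum bs M) = length M"
proof (induction M arbitrary: bs)
  case (Cons r M)
  then show ?case by (cases bs; cases r) auto
qed simp

fun dec_first :: "int \<Rightarrow> int list list \<Rightarrow> int list list" where
  "dec_first e ((a # as) # rs) = ((a - e) # as) # rs"
| "dec_first _ rs = rs"

section \<open>Computing the Gram matrix of a certificate\<close>

fun psums :: "int \<Rightarrow> int list \<Rightarrow> int list" where
  "psums s [] = []"
| "psums s (x # xs) = (s + x) # psums (s + x) xs"

fun row_sums :: "int list list \<Rightarrow> int list" where
  "row_sums [] = []"
| "row_sums [c] = c"
| "row_sums (c # d # cs) = map2 (+) c (row_sums (d # cs))"

fun gram_row :: "int \<Rightarrow> int \<Rightarrow> int list list \<Rightarrow> int list list \<Rightarrow> int list \<Rightarrow> int list \<Rightarrow> int list \<Rightarrow> int list" where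
  "gram_row a t ((y # _) # cs) ((q # _) # ps) (h # hs) (x # xs) (p # pr) =
     (a * q - h * (t - p) - 10 * (y + x)) # gram_row a t cs ps hs xs pr"
| "gram_row _ _ _ _ _ _ _ = []"

text \<open>One entry needs both \<open>lam k j\<close> and \<open>lam j k\<close>. The columns lose
  their heads row by row, so at row \<open>k\<close> the heads of the later columns are the former,
  and the tail of column \<open>k\<close> lists the latter. The prefix sums are read in the same
  way, so no entry is ever looked up by index.\<close>

fun gram :: "int list list \<Rightarrow> int list list \<Rightarrow> int list \<Rightarrow> int list \<Rightarrow> int list \<Rightarrow> int list list" where
  "gram ((y # c) # cs) ((q # p) # ps) (a # as) (t # ts) (d # ds) =
     ((d - a * (t - q) - 10 * y) # gram_row a t cs ps as c p) # gram (map tl cs) (map tl ps) as ts ds"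
| "gram _ _ _ _ _ = []"

fun diag_list :: "int list \<Rightarrow> int list \<Rightarrow> int list \<Rightarrow> int list" where
  "diag_list (r # rs) (t # ts) (e # es) = (5 * (r + t) + e) # diag_list rs ts es"
| "diag_list _ _ _ = []"

definition gram_totals where
  "gram_totals h cols pc rs es = gram cols pc (h @ [0]) (map last pc) (diag_list rs (map last pc) es)"

definition gram_matrix :: "int list \<Rightarrow> int list list \<Rightarrow> int list \<Rightarrow> int list \<Rightarrow> int list list" where
  "gram_matrix h cols mu es = gram_totals h cols (map2 psums mu cols) (row_sums cols) es"

definition flow :: "int list list \<Rightarrow> int list \<Rightarrow> int list" where
  "flow cols mu = map2 (-) (row_sums cols) (map last (map2 psums mu cols))"

lemma map2_same: "map2 f (map g xs) (map h xs) = map (\<lambda>x. f (g x) (h x)) xs"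
  by (induction xs) auto

lemma gram_row_map:
  assumes "\<And>j. j \<in> set xs \<Longrightarrow> c j \<noteq> [] \<and> p j \<noteq> []"
  shows "gram_row a t (map c xs) (map p xs) (map h xs) (map x xs) (map r xs)
    = map (\<lambda>j. a * hd (p j) - h j * (t - r j) - 10 * (hd (c j) + x j)) xs"
  using assms
proof (induction xs)
  case (Cons j xs)
  then have "c j \<noteq> []" "p j \<noteq> []" by auto
  then show ?case using Cons by (cases "c j"; cases "p j") auto
qed simp

lemma gram_map:
  "gram (map (\<lambda>j. map (\<lambda>i. c i j) [m..<N]) [m..<N]) (map (\<lambda>j. map (\<lambda>k. p k j) [m..<N]) [m..<N])
      (map h [m..<N]) (map t [m..<N]) (map d [m..<N])
   = map (\<lambda>k. map (\<lambda>j. if k = j then d k - h k * (t k - p k k) - 10 * c k k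
        else h k * p k j - h j * (t k - p j k) - 10 * (c k j + c j k)) [k..<N]) [m..<N]"
proof (induction "N - m" arbitrary: m)
  case (Suc n)
  then have m: "m < N" "n = N - Suc m" by simp_all
  have tl: "map (tl \<circ> (\<lambda>j. f m j # map (\<lambda>i. f i j) [Suc m..<N])) [Suc m..<N]
      = map (\<lambda>j. map (\<lambda>i. f i j) [Suc m..<N]) [Suc m..<N]" for f :: "nat \<Rightarrow> nat \<Rightarrow> int"
    by simp
  show ?case
    using Suc(1)[OF m(2)] m(1)
    by (simp add: upt_conv_Cons tl gram_row_map)
qed simp

lemma psums_map: "psums s (map f [0..<N]) = map (\<lambda>k. s + (\<Sum>i\<le>k. f i)) [0..<N]"
proof -
  have app: "psums s (xs @ [x]) = psums s xs @ [s + sum_list xs + x]" for s xs x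
    by (induction xs arbitrary: s) (auto simp: add.assoc)
  show ?thesis
  proof (induction N)
    case (Suc N)
    have "sum_list (map f [0..<N]) + f N = (\<Sum>i\<le>N. f i)"
      by (simp add: interv_sum_list_conv_sum_set_nat atLeast0LessThan lessThan_Suc_atMost[symmetric])
    then show ?case using Suc by (simp add: app add.assoc)
  qed simp
qed

lemma row_sums_map:
  "xs \<noteq> [] \<Longrightarrow> row_sums (map (\<lambda>j. map (\<lambda>i. c i j) ys) xs) = map (\<lambda>i. \<Sum>j\<leftarrow>xs. c i j) ys"
proof (induction xs rule: induct_list012)
  case (3 x y zs)
  then show ?case by (simp add: map2_same)
qed auto

text \<open>Reads certificate lists as functions, so that the computed matrix can be compared entry
  by entry with \<open>gram_entry\<close>.\<close>

locale multipliers =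
  fixes n :: nat and cols :: "int list list" and mu :: "int list"
  assumes len: "length cols = Suc n" "\<forall>c\<in>set cols. length c = Suc n" "length mu = Suc n"
begin

definition lam where "lam i j = cols ! j ! i"
definition mul where "mul j = mu ! j"

lemma cols: "cols = map (\<lambda>j. map (\<lambda>i. lam i j) [0..<Suc n]) [0..<Suc n]"
proof (rule nth_equalityI)
  fix j assume j: "j < length cols"
  then have "length (cols ! j) = Suc n" using len nth_mem by blast
  then show "cols ! j = map (\<lambda>j. map (\<lambda>i. lam i j) [0..<Suc n]) [0..<Suc n] ! j"
    using j len map_nth[of "cols ! j"] by (simp add: lam_def del: upt_Suc)
qed (simp add: len)

lemma mu: "mu = map mul [0..<Suc n]"
  using map_nth[of mu] by (simp add: mul_def[abs_def] len)

lemma psums_cols: "map2 psums mu cols = map (\<lambda>j. map (\<lambda>k. pre lam mul k j) [0..<Suc n]) [0..<Suc n]"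
  by (subst cols, subst mu) (simp only: map2_same psums_map pre_def)

lemma last_psums: "map last (map2 psums mu cols) = map (pre lam mul n) [0..<Suc n]"
  by (simp add: psums_cols)

lemma row_sums: "row_sums cols = map (\<lambda>i. \<Sum>j\<le>n. lam i j) [0..<Suc n]"
proof -
  have "row_sums cols = map (\<lambda>i. \<Sum>j\<leftarrow>[0..<Suc n]. lam i j) [0..<Suc n]"
    by (subst cols, rule row_sums_map) simp
  then show ?thesis
    by (simp only: interv_sum_list_conv_sum_set_nat atLeast0LessThan lessThan_Suc_atMost set_upt)
qed

lemma flow: "flow cols mu = map (\<lambda>k. (\<Sum>j\<le>n. lam k j) - pre lam mul n k) [0..<Suc n]"
  unfolding flow_def last_psums row_sums by (rule map2_same)

lemma gram_matrix:
  assumes "length h = n" "length es = Suc n"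
  shows "gram_matrix h cols mu es = map (\<lambda>k. map (\<lambda>j. gram_entry n (\<lambda>k. (h @ [0]) ! k) lam mul k j
      + (if k = j then es ! k else 0)) [k..<Suc n]) [0..<Suc n]"
proof -
  \<comment> \<open>No step leaves the last point; the padding 0 meets only empty suffix sums of
    weights.\<close>
  have h: "h @ [0] = map (\<lambda>k. (h @ [0]) ! k) [0..<Suc n]"
    using map_nth[of "h @ [0]"] assms by simp
  have es: "es = map (\<lambda>k. es ! k) [0..<Suc n]"
    using map_nth[of es] assms by simp
  have dl: "diag_list (map r xs) (map t xs) (map e xs) = map (\<lambda>x. 5 * (r x + t x) + e x) xs"
    for r t e and xs :: "nat list" by (induction xs) auto
  have "gram_matrix h cols mu es = gram (map (\<lambda>j. map (\<lambda>i. lam i j) [0..<Suc n]) [0..<Suc n])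
     (map (\<lambda>j. map (\<lambda>k. pre lam mul k j) [0..<Suc n]) [0..<Suc n])
     (map (\<lambda>k. (h @ [0]) ! k) [0..<Suc n]) (map (pre lam mul n) [0..<Suc n])
     (map (\<lambda>k. 5 * ((\<Sum>j\<le>n. lam k j) + pre lam mul n k) + es ! k) [0..<Suc n])"
    unfolding gram_matrix_def gram_totals_def last_psums row_sums
    by (subst es, subst h) (simp only: dl psums_cols cols[symmetric])
  also have "\<dots> = map (\<lambda>k. map (\<lambda>j. gram_entry n (\<lambda>k. (h @ [0]) ! k) lam mul k j
      + (if k = j then es ! k else 0)) [k..<Suc n]) [0..<Suc n]"
    unfolding gram_map
    by (intro map_cong refl) (auto simp: gram_entry_def)
  finally show ?thesis .
qed

end

section \<open>Soundness of certificates\<close>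

text \<open>\<open>virtual_end E F G h s\<close> says that the run along \<open>h\<close> can be replaced by a single fictitious point
  at its start: the point \<open>x\<close> with gradient \<open>v\<close> and value \<open>F (run G h x) + s * (v \<bullet> v)\<close> satisfies
  all interpolation inequalities from genuine points \<open>z\<close> to it.\<close>

definition virtual_end where
  "virtual_end E F G h s \<longleftrightarrow> (\<forall>x\<in>E. \<exists>v\<in>E. \<forall>z\<in>E.
     F (run G h x) + s * (v \<bullet> v) + v \<bullet> (z - x) + (norm (v - G z))\<^sup>2 / 2 \<le> F z)"

lemma virtual_end_Nil:
  assumes "interpolates E F G"
  shows "virtual_end E F G [] 0"
  unfolding virtual_end_def
proof
  fix x assume x: "x \<in> E"
  with assms show "\<exists>v\<in>E. \<forall>z\<in>E.
      F (run G [] x) + 0 * (v \<bullet> v) + v \<bullet> (z - x) + (norm (v - G z))\<^sup>2 / 2 \<le> F z"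
    by (intro bexI[of _ "G x"]) (auto simp: interpolates_def norm_minus_commute)
qed

text \<open>Points before the end of \<open>h\<close> are genuine; the last one carries the
  fictitious gradient and value that stand for the tail \<open>h'\<close>. Its inequalities are
  available only towards it, hence \<open>i < length h\<close> for the source. The final claim
  admits sources off the trajectory, such as the minimizer.\<close>

lemma trajectory:
  assumes I: "interpolates E F G" and V: "virtual_end E F G h' s" and x0: "x0 \<in> E" and h: "h \<noteq> []"
  obtains x g :: "nat \<Rightarrow> 'a::real_inner" and \<phi> :: "nat \<Rightarrow> real"
  where "x 0 = x0" "g 0 = G x0" "\<phi> 0 = F x0"
    "\<phi> (length h) = F (run G (h @ h') x0) + s * (g (length h) \<bullet> g (length h))"
    "\<And>k. k < length h \<Longrightarrow> x (Suc k) = x k - (h ! k) *\<^sub>R g k"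
    "\<And>k. g k \<in> E"
    "\<And>i j. i < length h \<Longrightarrow> j \<le> length h \<Longrightarrow> \<phi> j + g j \<bullet> (x i - x j) + (norm (g i - g j))\<^sup>2 / 2 \<le> \<phi> i"
    "\<And>z j. z \<in> E \<Longrightarrow> j \<le> length h \<Longrightarrow> \<phi> j + g j \<bullet> (z - x j) + (norm (g j - G z))\<^sup>2 / 2 \<le> F z"
proof -
  let ?n = "length h"
  define x where "x k = run G (take k h) x0" for k
  have xE: "x k \<in> E" for k unfolding x_def using I x0 by (rule run_in_subspace)
  obtain v where v: "v \<in> E" "\<And>z. z \<in> E \<Longrightarrow>
      F (run G h' (x ?n)) + s * (v \<bullet> v) + v \<bullet> (z - x ?n) + (norm (v - G z))\<^sup>2 / 2 \<le> F z"
    using V xE unfolding virtual_end_def by blast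
  define g where "g k = (if k < ?n then G (x k) else v)" for k
  define \<phi> where "\<phi> k = (if k < ?n then F (x k) else F (run G h' (x ?n)) + s * (v \<bullet> v))" for k
  have step: "x (Suc k) = x k - (h ! k) *\<^sub>R g k" if "k < ?n" for k
    using that by (simp add: x_def g_def take_Suc_conv_app_nth run_append)
  have z: "\<phi> j + g j \<bullet> (z - x j) + (norm (g j - G z))\<^sup>2 / 2 \<le> F z" if "z \<in> E" "j \<le> ?n" for z j
  proof (cases "j < ?n")
    case True
    then show ?thesis
      using I xE that by (auto simp: interpolates_def g_def \<phi>_def norm_minus_commute)
  next
    case False
    then show ?thesis using v(2)[OF that(1)] that(2) by (simp add: g_def \<phi>_def)
  qed
  show ?thesis
  proof (rule that)
    show "x 0 = x0" "g 0 = G x0" "\<phi> 0 = F x0"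
      using h by (auto simp: x_def g_def \<phi>_def)
    show "\<phi> ?n = F (run G (h @ h') x0) + s * (g ?n \<bullet> g ?n)"
      by (simp add: \<phi>_def g_def x_def run_append)
    show "g k \<in> E" for k using v I xE by (auto simp: g_def interpolates_def)
    show "\<phi> j + g j \<bullet> (x i - x j) + (norm (g i - g j))\<^sup>2 / 2 \<le> \<phi> i" if "i < ?n" "j \<le> ?n" for i j
      using z[OF xE that(2), of i] that(1) by (simp add: g_def[of i] \<phi>_def[of i] norm_minus_commute)
  qed (use step z in auto)
qed

section \<open>Checkable certificates for a fictitious endpoint\<close>

definition well_formed :: "int list \<Rightarrow> int list list \<Rightarrow> int list \<Rightarrow> bool" where
  "well_formed h cols mu \<longleftrightarrow> h \<noteq> [] \<and> length cols = Suc (length h) \<and> length mu = Suc (length h)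
     \<and> list_all (\<lambda>c. length c = Suc (length h) \<and> list_all (\<lambda>x. 0 \<le> x) c \<and> last c = 0) cols
     \<and> list_all (\<lambda>x. 0 \<le> x) mu"

abbreviation zeros :: "'b list \<Rightarrow> int list" where
  "zeros xs \<equiv> map (\<lambda>_. 0) xs"

text \<open>Encoding: \<open>cols ! j ! i / D\<close> is the weight of the inequality from point \<open>i\<close> to point \<open>j\<close>, \<open>mu ! j / D\<close>
  that of the inequality from an arbitrary point to \<open>j\<close>; stepsizes, \<open>s0\<close> and \<open>s1\<close> are in tenths. The extra
  column of \<open>tail_form\<close> stands for the vector \<open>v = (\<Sum>j. (mu ! j / D) *\<^sub>R g j)\<close>; it makes
  \<open>- (s1 + 1/2) * (v \<bullet> v)\<close> linear in \<open>mu\<close>. A zero last entry of each column keeps the fictitious point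
  from being used as a genuine one.\<close>

definition tail_form :: "int list \<Rightarrow> int \<Rightarrow> int \<Rightarrow> int \<Rightarrow> int list list \<Rightarrow> int list \<Rightarrow> int list list" where
  "tail_form h s0 s1 D cols mu =
     snoc_rows (gram_matrix h cols mu (zeros h @ [D * s0])) (map (\<lambda>m. - (2 * s1 + 10) * m) mu) (D * (s1 + 5))"

definition psd0 :: "int \<Rightarrow> int list list \<Rightarrow> int list list \<Rightarrow> bool" where
  "psd0 c L M = psd c L (zeros M) M"

definition check_tail :: "int list \<Rightarrow> int \<Rightarrow> int \<Rightarrow> int \<Rightarrow> int list list \<Rightarrow> int list \<Rightarrow> int \<Rightarrow> int list list \<Rightarrow> bool" where
  "check_tail h s0 s1 D cols mu c L \<longleftrightarrow> 0 < D \<and> 0 \<le> c \<and> well_formed h cols mu \<and> sum_list mu = D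
     \<and> flow cols mu = zeros h @ [- D] \<and> psd0 c L (tail_form h s0 s1 D cols mu)"

lemma well_formed_multipliers:
  assumes "well_formed h cols mu"
  shows "multipliers (length h) cols mu"
  using assms by unfold_locales (auto simp: well_formed_def list_all_iff)

lemma well_formed_nonneg:
  assumes "well_formed h cols mu" "i \<le> length h" "j \<le> length h"
  shows "0 \<le> cols ! j ! i" and "0 \<le> mu ! j" and "cols ! j ! length h = 0"
proof -
  have j: "cols ! j \<in> set cols" "mu ! j \<in> set mu"
    using assms by (auto simp: well_formed_def)
  then have c: "length (cols ! j) = Suc (length h)" "list_all (\<lambda>x. 0 \<le> x) (cols ! j)" "last (cols ! j) = 0"
    using assms(1) by (auto simp: well_formed_def list_all_iff)
  show "0 \<le> cols ! j ! i"
    using c assms(2) by (simp add: list_all_length)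
  show "0 \<le> mu ! j" using j assms(1) by (auto simp: well_formed_def list_all_iff)
  show "cols ! j ! length h = 0" using c last_conv_nth[of "cols ! j"] by fastforce
qed

lemma sum_last: "(\<Sum>k<Suc n. \<Sum>j\<in>{k..<Suc n}. real_of_int (if k = j then (zeros h @ [e]) ! k else 0) * (g k \<bullet> g j))
    = e * (g n \<bullet> g n)" if "length h = n" for g :: "nat \<Rightarrow> 'a::real_inner"
proof -
  have "(\<Sum>j\<in>{k..<Suc n}. real_of_int (if k = j then (zeros h @ [e]) ! k else 0) * (g k \<bullet> g j))
      = (if k = n then e * (g n \<bullet> g n) else 0)" if k: "k \<in> {..<Suc n}" for k
  proof -
    have "(\<Sum>j\<in>{k..<Suc n}. real_of_int (if k = j then (zeros h @ [e]) ! k else 0) * (g k \<bullet> g j))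
      = (\<Sum>j\<in>{k..<Suc n}. if j = k then real_of_int ((zeros h @ [e]) ! k) * (g k \<bullet> g k) else 0)"
      by (intro sum.cong) auto
    also have "\<dots> = real_of_int ((zeros h @ [e]) ! k) * (g k \<bullet> g k)"
      using k by (simp only: sum.delta finite_atLeastLessThan) simp
    finally show ?thesis using k \<open>length h = n\<close> by (auto simp: nth_append)
  qed
  then have "(\<Sum>k<Suc n. \<Sum>j\<in>{k..<Suc n}. real_of_int (if k = j then (zeros h @ [e]) ! k else 0) * (g k \<bullet> g j))
      = (\<Sum>k<Suc n. if k = n then e * (g n \<bullet> g n) else 0)"
    by (intro sum.cong refl)
  then show ?thesis by simp
qed

lemma qform_gram_matrix:
  fixes g :: "nat \<Rightarrow> 'a::real_inner" and e :: int
  assumes wf: "well_formed h cols mu" and n: "length h = n"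
  defines "M \<equiv> gram_matrix h cols mu (zeros h @ [e])"
  shows "triangular M" "length M = Suc n"
    "qform M (map g [0..<Suc n]) = (\<Sum>k<Suc n. \<Sum>j\<in>{k..<Suc n}.
        gram_entry n (\<lambda>k. (h @ [0]) ! k) (\<lambda>i j. cols ! j ! i) (\<lambda>j. mu ! j) k j * (g k \<bullet> g j)) + e * (g n \<bullet> g n)"
proof -
  interpret multipliers n cols mu using well_formed_multipliers[OF wf] n by simp
  have M: "M = map (\<lambda>k. map (\<lambda>j. gram_entry n (\<lambda>k. (h @ [0]) ! k) lam mul k j
      + (if k = j then (zeros h @ [e]) ! k else 0)) [k..<Suc n]) [0..<Suc n]"
    unfolding M_def using n by (intro gram_matrix) auto
  show "triangular M" unfolding M by (rule triangular_upt)
  show "length M = Suc n" unfolding M by simp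
  have "lam = (\<lambda>i j. cols ! j ! i)" "mul = (\<lambda>j. mu ! j)"
    by (simp_all add: fun_eq_iff lam_def mul_def)
  then show "qform M (map g [0..<Suc n]) = (\<Sum>k<Suc n. \<Sum>j\<in>{k..<Suc n}.
        gram_entry n (\<lambda>k. (h @ [0]) ! k) (\<lambda>i j. cols ! j ! i) (\<lambda>j. mu ! j) k j * (g k \<bullet> g j)) + e * (g n \<bullet> g n)"
    unfolding M qform_upt
    by (simp only: of_int_add distrib_right sum.distrib sum_last[OF n] atLeast0LessThan)
qed

lemma flow_sum:
  assumes wf: "well_formed h cols mu" and n: "length h = n" and fl: "flow cols mu = map f [0..<Suc n]"
  shows "(\<Sum>k\<le>n. real_of_int ((\<Sum>j\<le>n. cols ! j ! k) - pre (\<lambda>i j. cols ! j ! i) (\<lambda>j. mu ! j) n k) * \<phi> k)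
    = (\<Sum>k\<le>n. real_of_int (f k) * \<phi> k)"
proof -
  interpret multipliers n cols mu using well_formed_multipliers[OF wf] n by simp
  have "lam = (\<lambda>i j. cols ! j ! i)" "mul = (\<lambda>j. mu ! j)"
    by (simp_all add: fun_eq_iff lam_def mul_def)
  then have "map f [0..<Suc n] = map (\<lambda>k. (\<Sum>j\<le>n. cols ! j ! k) - pre (\<lambda>i j. cols ! j ! i) (\<lambda>j. mu ! j) n k) [0..<Suc n]"
    using flow fl by simp
  then have "f k = (\<Sum>j\<le>n. cols ! j ! k) - pre (\<lambda>i j. cols ! j ! i) (\<lambda>j. mu ! j) n k" if "k \<le> n" for k
    using that by (simp only: map_eq_conv) auto
  then show ?thesis by (intro sum.cong refl) auto
qed

text \<open>The weights carry \<open>D\<close> units from an arbitrary point \<open>z\<close>,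
  distributed over the trajectory by \<open>mu\<close>, to the old fictitious endpoint; all other
  values cancel. Neither the weights nor \<open>v\<close>, the \<open>mu\<close>-mean of the
  gradients, depend on \<open>z\<close>, so one vector serves all inequalities into the new
  fictitious point. The old correction enters the form as the extra diagonal entry
  \<open>D * s0\<close> of the last gradient.\<close>

lemma virtual_end_step:
  assumes chk: "check_tail h s0 s1 D cols mu c L" and I: "interpolates E F G"
    and V: "virtual_end E F G h' (real_of_int s0 / 10)"
  shows "virtual_end E F G (map (\<lambda>a. real_of_int a / 10) h @ h') (real_of_int s1 / 10)"
  unfolding virtual_end_def
proof
  fix x0 assume x0: "x0 \<in> E"
  define hr where "hr = map (\<lambda>a. real_of_int a / 10) h"
  define n where "n = length h"
  have D: "D > 0" and wf: "well_formed h cols mu" and c: "c \<ge> 0" and muD: "sum_list mu = D"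
    and fl: "flow cols mu = zeros h @ [- D]" and psd: "psd0 c L (tail_form h s0 s1 D cols mu)"
    using chk by (auto simp: check_tail_def)
  have ne: "hr \<noteq> []" and len: "length hr = n" "length mu = Suc n"
    using wf by (auto simp: well_formed_def hr_def n_def)
  obtain x g \<phi> where T: "x 0 = x0" "\<phi> n = F (run G (hr @ h') x0) + real_of_int s0 / 10 * (g n \<bullet> g n)"
    "\<And>k. k < n \<Longrightarrow> x (Suc k) = x k - (hr ! k) *\<^sub>R g k" "\<And>k. g k \<in> E"
    "\<And>i j. i < n \<Longrightarrow> j \<le> n \<Longrightarrow> \<phi> j + g j \<bullet> (x i - x j) + (norm (g i - g j))\<^sup>2 / 2 \<le> \<phi> i"
    "\<And>z j. z \<in> E \<Longrightarrow> j \<le> n \<Longrightarrow> \<phi> j + g j \<bullet> (z - x j) + (norm (g j - G z))\<^sup>2 / 2 \<le> F z"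
    using trajectory[OF I V x0 ne] unfolding len by metis
  define v where "v = (1 / D) *\<^sub>R (\<Sum>j\<le>n. real_of_int (mu ! j) *\<^sub>R g j)"
  have vs: "(\<Sum>j\<le>n. real_of_int (mu ! j) *\<^sub>R g j) = real_of_int D *\<^sub>R v"
    using D by (simp add: v_def)
  have vE: "v \<in> E"
    unfolding v_def using I T(4) by (auto simp: interpolates_def intro!: subspace_scale subspace_sum)
  have mu_map: "mu = map (\<lambda>j. mu ! j) [0..<Suc n]" using map_nth[of mu] len by simp
  have "F (run G (hr @ h') x0) + real_of_int s1 / 10 * (v \<bullet> v) + v \<bullet> (z - x0) + (norm (v - G z))\<^sup>2 / 2 \<le> F z"
    if z: "z \<in> E" for z
  proof -
    have h0: "\<forall>k<n. x (Suc k) = x k - (real_of_int ((h @ [0]) ! k) / 10) *\<^sub>R g k"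
      using T(3) by (simp add: hr_def n_def nth_append)
    let ?lam = "\<lambda>i j. cols ! j ! i" and ?mu = "\<lambda>j. mu ! j"
    let ?M = "gram_matrix h cols mu (zeros h @ [D * s0])"
    let ?gs = "map g [0..<Suc n]"
    note qg = qform_gram_matrix(1,2)[OF wf n_def[symmetric], where e = "D * s0"]
    note qg3 = qform_gram_matrix(3)[OF wf n_def[symmetric], where e = "D * s0" and g = g]
    have "0 \<le> qform (tail_form h s0 s1 D cols mu) (?gs @ [v])"
    proof (rule psd_zero_sound)
      show "psd c L (zeros (tail_form h s0 s1 D cols mu)) (tail_form h s0 s1 D cols mu)"
        using psd by (simp add: psd0_def)
      show "triangular (tail_form h s0 s1 D cols mu)"
        "length (?gs @ [v]) = length (tail_form h s0 s1 D cols mu)"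
        unfolding tail_form_def using qg len by (auto simp: snoc_rows)
    qed (rule c)
    also have "\<dots> = qform ?M ?gs + lincomb (map (\<lambda>m. - (2 * s1 + 10) * m) mu) ?gs \<bullet> v + D * (s1 + 5) * (v \<bullet> v)"
      unfolding tail_form_def using qg len by (subst snoc_rows) (auto simp: algebra_simps)
    also have "lincomb (map (\<lambda>m. - (2 * s1 + 10) * m) mu) ?gs
        = - real_of_int (2 * s1 + 10) *\<^sub>R (\<Sum>j\<le>n. real_of_int (mu ! j) *\<^sub>R g j)"
    proof -
      have "map (\<lambda>m. - (2 * s1 + 10) * m) mu = map (\<lambda>j. - (2 * s1 + 10) * mu ! j) [0..<Suc n]"
        by (subst mu_map) (simp only: map_map comp_def)
      then show ?thesis
        by (simp only: lincomb_upt atLeast0LessThan lessThan_Suc_atMost scaleR_sum_right scaleR_scaleR of_int_mult of_int_minus)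
    qed
    \<comment> \<open>For \<open>s1 + 5 > 0\<close> the two terms with \<open>v\<close>, taken as a
      free vector, are smallest at the \<open>mu\<close>-mean, and there they add up to
      \<open>- D * (s1 + 5) * (v \<bullet> v)\<close>. Testing semidefiniteness with
      \<open>v\<close> as an independent vector therefore loses nothing.\<close>
    finally have Q: "D * (s1 + 5) * (v \<bullet> v) \<le> qform ?M ?gs"
      unfolding vs by (simp add: algebra_simps)
    have S1: "0 \<le> (\<Sum>i\<le>n. \<Sum>j\<le>n. ?lam i j * (\<phi> i - \<phi> j - g j \<bullet> (x i - x j) - (norm (g i - g j))\<^sup>2 / 2))"
    proof (intro sum_nonneg)
      fix i j assume ij: "i \<in> {..n}" "j \<in> {..n}"
      show "0 \<le> ?lam i j * (\<phi> i - \<phi> j - g j \<bullet> (x i - x j) - (norm (g i - g j))\<^sup>2 / 2)"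
      proof (cases "i = n")
        case True
        then show ?thesis using well_formed_nonneg(3)[OF wf, of _ j] ij n_def by simp
      next
        case False
        then show ?thesis using well_formed_nonneg(1)[OF wf, of i j] T(5)[of i j] ij n_def
          by (intro mult_nonneg_nonneg) auto
      qed
    qed
    have S2: "0 \<le> (\<Sum>j\<le>n. ?mu j * (F z - \<phi> j - g j \<bullet> (z - x j) - (norm (g j - G z))\<^sup>2 / 2))"
    proof (intro sum_nonneg mult_nonneg_nonneg)
      fix j assume "j \<in> {..n}"
      then show "0 \<le> real_of_int (?mu j)" "0 \<le> F z - \<phi> j - g j \<bullet> (z - x j) - (norm (g j - G z))\<^sup>2 / 2"
        using well_formed_nonneg(2)[OF wf, of j j] T(6)[OF z, of j] n_def by auto
    qed
    note WI = weighted_interpolation[where h = "\<lambda>k. (h @ [0]) ! k" and x = x and g = g and n = n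
      and lam = ?lam and mu = ?mu and \<phi> = \<phi> and z = z and gz = "G z" and \<phi>z = "F z", OF h0]
    have flow: "(\<Sum>k\<le>n. real_of_int ((\<Sum>j\<le>n. ?lam k j) - pre ?lam ?mu n k) * \<phi> k) = - D * \<phi> n"
    proof -
      have "flow cols mu = map (\<lambda>k. if k = n then - D else 0) [0..<Suc n]"
        unfolding fl by (rule nth_equalityI) (auto simp: n_def nth_append simp del: upt_Suc)
      from flow_sum[OF wf n_def[symmetric] this, of \<phi>]
      have "(\<Sum>k\<le>n. real_of_int ((\<Sum>j\<le>n. ?lam k j) - pre ?lam ?mu n k) * \<phi> k)
          = (\<Sum>k\<le>n. if k = n then - D * \<phi> n else 0)"
        by (rule trans) (intro sum.cong refl, simp)
      then show ?thesis by simp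
    qed
    have total: "(\<Sum>j\<le>n. ?mu j) = D"
    proof -
      have "sum_list mu = (\<Sum>j\<le>n. ?mu j)"
        by (subst mu_map) (simp only: interv_sum_list_conv_sum_set_nat atLeast0LessThan lessThan_Suc_atMost set_upt)
      then show ?thesis using muD by simp
    qed
    have "qform ?M ?gs \<le> 10 * (- D * \<phi> n + D * (F z - (norm (G z))\<^sup>2 / 2)
        + (G z - (z - x 0)) \<bullet> (real_of_int D *\<^sub>R v)) + D * s0 * (g n \<bullet> g n)"
      using mult_nonneg_nonneg[OF _ add_nonneg_nonneg[OF S1 S2], of 10] qg3
      unfolding WI flow total vs by simp
    with Q have "0 \<le> 10 * (- D * \<phi> n + D * (F z - (norm (G z))\<^sup>2 / 2)
        + (G z - (z - x 0)) \<bullet> (real_of_int D *\<^sub>R v)) + D * s0 * (g n \<bullet> g n) - D * (s1 + 5) * (v \<bullet> v)"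
      by linarith
    also have "\<dots> = D * (10 * (F z - \<phi> n - (norm (G z))\<^sup>2 / 2 + (G z - (z - x 0)) \<bullet> v)
        + s0 * (g n \<bullet> g n) - (s1 + 5) * (v \<bullet> v))"
      by (simp add: algebra_simps)
    finally have "0 \<le> 10 * (F z - \<phi> n - (norm (G z))\<^sup>2 / 2 + (G z - (z - x 0)) \<bullet> v)
        + s0 * (g n \<bullet> g n) - (s1 + 5) * (v \<bullet> v)"
      using D by (simp add: zero_le_mult_iff)
    moreover have "(norm (v - G z))\<^sup>2 = v \<bullet> v - 2 * (G z \<bullet> v) + (norm (G z))\<^sup>2"
      by (simp add: power2_norm_eq_inner inner_diff_left inner_diff_right inner_commute)
    moreover have "(G z - (z - x 0)) \<bullet> v = G z \<bullet> v - v \<bullet> (z - x0)"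
      by (simp only: T(1) inner_diff_left[of "G z"] inner_commute[of v])
    ultimately show ?thesis
      unfolding T(2) by (simp add: algebra_simps)
  qed
  with vE show "\<exists>v\<in>E. \<forall>z\<in>E. F (run G (map (\<lambda>a. real_of_int a / 10) h @ h') x0) + real_of_int s1 / 10 * (v \<bullet> v)
      + v \<bullet> (z - x0) + (norm (v - G z))\<^sup>2 / 2 \<le> F z"
    unfolding hr_def by blast
qed

section \<open>Checkable certificates for a whole pattern\<close>

definition main_form :: "int list \<Rightarrow> int \<Rightarrow> int \<Rightarrow> int list list \<Rightarrow> int list list" where
  "main_form h s D cols = gram_matrix h cols (zeros cols) (zeros h @ [D * s])"

text \<open>The entries \<open>r\<close> are doubled row sums in the scaling \<open>10 * D\<close>,
  and \<open>x\<close>, the head of a column, is the scaled weight of the inequality from the start.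
  So \<open>r \<le> 10 * K * x\<close> is the condition
  \<open>lam 0 i \<ge> 2 * \<Delta> * r i\<close>.\<close>

fun reserve :: "int \<Rightarrow> int list \<Rightarrow> int list list \<Rightarrow> bool" where
  "reserve K (r # rs) ((x # _) # cs) = (0 \<le> r \<and> r \<le> 10 * K * x \<and> reserve K rs cs)"
| "reserve K rs cs = (rs = [] \<and> cs = [])"

text \<open>The start is exempt from \<open>reserve\<close> because its slack \<open>W 0 0\<close>
  is 0; its row sum has only to be nonnegative, like every weight of the mean gradient.\<close>

definition check_rows :: "int \<Rightarrow> int \<Rightarrow> int list list \<Rightarrow> int list \<Rightarrow> bool" where
  "check_rows K S cols R \<longleftrightarrow> sum_list R = 2 * S \<and> 0 \<le> hd R \<and> reserve K (tl R) (tl cols)"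

definition check_form :: "int \<Rightarrow> int \<Rightarrow> int \<Rightarrow> int list list \<Rightarrow> int \<Rightarrow> int list list \<Rightarrow> int list list \<Rightarrow> bool" where
  "check_form K S e cols c L M \<longleftrightarrow> check_rows K S cols (rsum (zeros M) M) \<and> psd0 c L (dec_first e M)"

text \<open>Here \<open>K = 1 / \<Delta>\<close>, and \<open>e\<close> is \<open>\<Delta> * S\<close> rounded up in the scaling \<open>10 * D\<close> of the form.\<close>

definition check_main :: "int list \<Rightarrow> int \<Rightarrow> int \<Rightarrow> int list list \<Rightarrow> int \<Rightarrow> int \<Rightarrow> int \<Rightarrow> int list list \<Rightarrow> bool" where
  "check_main h s D cols K e c L \<longleftrightarrow> 0 < D \<and> 0 \<le> c \<and> 0 < K \<and> 0 < sum_list h + s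
     \<and> D * (sum_list h + s) \<le> e * K \<and> well_formed h cols (zeros cols)
     \<and> flow cols (zeros cols) = (D # zeros (tl h)) @ [- D]
     \<and> check_form K (D * (sum_list h + s)) e cols c L (main_form h s D cols)"

lemma reserve_nth:
  "reserve K rs cs \<Longrightarrow> i < length rs \<Longrightarrow> 0 \<le> rs ! i \<and> rs ! i \<le> 10 * K * (cs ! i ! 0)"
proof (induction K rs cs arbitrary: i rule: reserve.induct)
  case (1 K r rs x xs cs)
  then show ?case by (cases i) auto
qed auto

lemma dec_first:
  assumes "triangular M" "M \<noteq> []" "length vs = length M"
  shows "length (dec_first e M) = length M" "triangular (dec_first e M)"
    "qform (dec_first e M) vs = qform M vs - e * (hd vs \<bullet> hd vs)"
proof -
  obtain a as rs v ws where "M = (a # as) # rs" "vs = v # ws"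
    using assms by (cases M; cases "hd M"; cases vs) auto
  then show "length (dec_first e M) = length M" "triangular (dec_first e M)"
    "qform (dec_first e M) vs = qform M vs - e * (hd vs \<bullet> hd vs)"
    using assms by (auto simp: algebra_simps)
qed

text \<open>The slack \<open>W i\<close> of the interpolation inequality from the starting point to the \<open>i\<close>-th point is at
  least \<open>\<delta> - g i \<bullet> e - (norm (g 0))\<^sup>2 / 2 + g 0 \<bullet> g i\<close>. Spending it with weights proportional to the row sums
  of the form, i.e. on the mean gradient \<open>m\<close>, costs only the term in \<open>g 0 - m\<close>.\<close>

lemma decrease_from_slack:
  fixes m g0 e :: "'a::real_inner"
  assumes S: "0 < S" and K: "0 < K" and D: "0 < D" and \<delta>: "0 \<le> \<delta>" "K * \<delta> \<le> D\<^sup>2" and e: "norm e \<le> D"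
    and gap: "S * (m \<bullet> m) + S / K * ((g0 - m) \<bullet> (g0 - m))
        + 2 * (\<delta> / D\<^sup>2) * S * (\<delta> - m \<bullet> e - (g0 \<bullet> g0) / 2 + g0 \<bullet> m) \<le> gap"
  shows "S / D\<^sup>2 * \<delta>\<^sup>2 \<le> gap"
proof -
  define t where "t = \<delta> / D\<^sup>2"
  have t: "0 \<le> t" "t \<le> 1 / K" "\<delta> = t * D\<^sup>2"
    using \<delta> K D by (auto simp: t_def field_simps)
  have "t\<^sup>2 * (e \<bullet> e) \<le> t\<^sup>2 * D\<^sup>2"
    using e D by (intro mult_left_mono) (auto simp: dot_square_norm power_mono)
  \<comment> \<open>Completing the square: together with
    \<open>2 * t * (\<delta> - m \<bullet> e)\<close> and the bound on \<open>e\<close>, the term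
    \<open>m \<bullet> m\<close> leaves at least \<open>t * \<delta>\<close>.\<close>
  moreover have "0 \<le> (m - t *\<^sub>R e) \<bullet> (m - t *\<^sub>R e)" by simp
  then have "0 \<le> m \<bullet> m - 2 * t * (m \<bullet> e) + t\<^sup>2 * (e \<bullet> e)"
    by (simp add: inner_diff_left inner_diff_right inner_commute power2_eq_square algebra_simps)
  \<comment> \<open>Since \<open>2 * t * (g0 \<bullet> m - (g0 \<bullet> g0) / 2)\<close> equals
    \<open>t * (m \<bullet> m) - t * ((g0 - m) \<bullet> (g0 - m))\<close>, the loss in
    \<open>g0 - m\<close> is covered by the reserve as long as \<open>t \<le> 1 / K\<close>.\<close>
  moreover have "0 \<le> (1 / K - t) * ((g0 - m) \<bullet> (g0 - m)) + t * (m \<bullet> m)"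
    using t by (intro add_nonneg_nonneg mult_nonneg_nonneg) auto
  ultimately have "t * \<delta> \<le> m \<bullet> m + (1 / K) * ((g0 - m) \<bullet> (g0 - m))
      + 2 * t * (\<delta> - m \<bullet> e - (g0 \<bullet> g0) / 2 + g0 \<bullet> m)"
    unfolding t(3) by (simp add: inner_diff_left inner_diff_right inner_commute power2_eq_square algebra_simps)
  from mult_left_mono[OF this, of S] S have "S * (t * \<delta>) \<le> gap"
    using gap unfolding t_def[symmetric] by (simp add: algebra_simps)
  then show ?thesis by (simp add: t_def power2_eq_square)
qed

text \<open>Ten times the decrease, scaled by \<open>D\<close>, is the form plus all weighted slacks
  (\<open>total\<close>). The form is split at the mean \<open>m\<close> (\<open>Q\<close>). Of the
  slacks only those from the start are kept, and of these the fraction \<open>t * K\<close> is spent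
  to bring in the minimizer.\<close>

lemma pattern_decrease:
  assumes chk: "check_main h s D cols K e c L" and I: "interpolates E F G"
    and V: "virtual_end E F G h' (real_of_int s / 10)"
    and x0: "x0 \<in> E" and xs: "xs \<in> E" "G xs = 0" and R: "0 < R" "norm (x0 - xs) \<le> R"
    and \<delta>: "K * (F x0 - F xs) \<le> R\<^sup>2"
  shows "real_of_int (sum_list h + s) / 10 / R\<^sup>2 * (F x0 - F xs)\<^sup>2
    \<le> F x0 - F (run G (map (\<lambda>a. real_of_int a / 10) h @ h') x0)"
proof -
  define hr where "hr = map (\<lambda>a. real_of_int a / 10) h"
  define n where "n = length h"
  define S where "S = sum_list h + s"
  define M where "M = main_form h s D cols"
  define \<rho> where "\<rho> = rsum (zeros M) M"
  have D: "D > 0" and wf: "well_formed h cols (zeros cols)" and c: "c \<ge> 0" and K: "K > 0" and S: "S > 0"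
    and e: "D * S \<le> e * K"
    and fl: "flow cols (zeros cols) = (D # zeros (tl h)) @ [- D]"
    and \<rho>S: "sum_list \<rho> = 2 * (D * S)" and \<rho>0: "0 \<le> hd \<rho>" and res: "reserve K (tl \<rho>) (tl cols)"
    and psd: "psd0 c L (dec_first e M)"
    using chk by (auto simp: check_main_def check_form_def check_rows_def S_def M_def \<rho>_def)
  have ne: "hr \<noteq> []" and n0: "n > 0" and len: "length hr = n" "length cols = Suc n"
    using wf by (auto simp: well_formed_def hr_def n_def)
  obtain x g \<phi> where T: "x 0 = x0" "g 0 = G x0" "\<phi> 0 = F x0"
    "\<phi> n = F (run G (hr @ h') x0) + real_of_int s / 10 * (g n \<bullet> g n)"
    "\<And>k. k < n \<Longrightarrow> x (Suc k) = x k - (hr ! k) *\<^sub>R g k" "\<And>k. g k \<in> E"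
    "\<And>i j. i < n \<Longrightarrow> j \<le> n \<Longrightarrow> \<phi> j + g j \<bullet> (x i - x j) + (norm (g i - g j))\<^sup>2 / 2 \<le> \<phi> i"
    "\<And>z j. z \<in> E \<Longrightarrow> j \<le> n \<Longrightarrow> \<phi> j + g j \<bullet> (z - x j) + (norm (g j - G z))\<^sup>2 / 2 \<le> F z"
    using trajectory[OF I V x0 ne] unfolding len by metis
  define W where "W i j = \<phi> i - \<phi> j - g j \<bullet> (x i - x j) - (norm (g i - g j))\<^sup>2 / 2" for i j
  have W: "0 \<le> W i j" if "i < n" "j \<le> n" for i j using T(7)[OF that] by (simp add: W_def)
  let ?lam = "\<lambda>i j. cols ! j ! i" and ?mu = "\<lambda>j. zeros cols ! j"
  let ?gs = "map g [0..<Suc n]"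
  note qg = qform_gram_matrix(1,2)[OF wf n_def[symmetric], where e = "D * s", folded main_form_def, folded M_def]
  note qg3 = qform_gram_matrix(3)[OF wf n_def[symmetric], where e = "D * s" and g = g, folded main_form_def, folded M_def]
  have lam0: "0 \<le> ?lam i j * W i j" if "i \<le> n" "j \<le> n" for i j
  proof (cases "i = n")
    case True
    then show ?thesis using well_formed_nonneg(3)[OF wf, of _ j] that n_def by simp
  next
    case False
    then show ?thesis using well_formed_nonneg(1)[OF wf, of i j] W[of i j] that n_def
      by (intro mult_nonneg_nonneg) auto
  qed
  have h0: "\<forall>k<n. x (Suc k) = x k - (real_of_int ((h @ [0]) ! k) / 10) *\<^sub>R g k"
    using T(5) by (simp add: hr_def n_def nth_append)
  have total: "10 * (\<Sum>i\<le>n. \<Sum>j\<le>n. ?lam i j * W i j) + qform M ?gs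
      = 10 * D * (F x0 - F (run G (hr @ h') x0))"
  proof -
    have flow: "(\<Sum>k\<le>n. real_of_int ((\<Sum>j\<le>n. ?lam k j) - pre ?lam ?mu n k) * \<phi> k) = D * \<phi> 0 - D * \<phi> n"
    proof -
      have "flow cols (zeros cols) = map (\<lambda>k. (if k = 0 then D else 0) + (if k = n then - D else 0)) [0..<Suc n]"
        unfolding fl using n0
        by (intro nth_equalityI) (auto simp: n_def nth_append nth_Cons simp del: upt_Suc split: nat.splits)
      from flow_sum[OF wf n_def[symmetric] this, of \<phi>]
      have "(\<Sum>k\<le>n. real_of_int ((\<Sum>j\<le>n. ?lam k j) - pre ?lam ?mu n k) * \<phi> k)
          = (\<Sum>k\<le>n. (if k = 0 then D * \<phi> 0 else 0) + (if k = n then - D * \<phi> n else 0))"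
        by (rule trans) (intro sum.cong refl, simp add: distrib_right)
      then show ?thesis by (simp add: sum.distrib)
    qed
    \<comment> \<open>All flow starts at the first iterate, so \<open>mu\<close> is zero and the
      values inserted below for the external point are placeholders.\<close>
    have mu0: "?mu j = 0" if "j \<in> {..n}" for j using that len by simp
    have mu: "(\<Sum>j\<le>n. ?mu j * (0 - \<phi> j - g j \<bullet> (xs - x j) - (norm (g j - 0))\<^sup>2 / 2)) = 0"
      "(\<Sum>j\<le>n. ?mu j) = 0" "(\<Sum>j\<le>n. real_of_int (?mu j) *\<^sub>R g j) = 0"
      by (auto intro!: sum.neutral simp: mu0)
    note WI = weighted_interpolation[where h = "\<lambda>k. (h @ [0]) ! k" and x = x and g = g and n = n
      and lam = ?lam and mu = ?mu and \<phi> = \<phi> and z = xs and gz = 0 and \<phi>z = 0, OF h0]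
    have "10 * (D * \<phi> n) = 10 * D * F (run G (hr @ h') x0) + D * s * (g n \<bullet> g n)"
      unfolding T(4) by (simp add: algebra_simps)
    moreover have "10 * D * (F x0 - F (run G (hr @ h') x0)) = 10 * (D * \<phi> 0) - 10 * D * F (run G (hr @ h') x0)"
      unfolding T(3) by (simp add: algebra_simps)
    moreover note WI[unfolded flow mu W_def[symmetric]] qg3
    ultimately show ?thesis by simp
  qed
  have l\<rho>: "length \<rho> = Suc n" using length_rsum[OF qg(1), of "zeros M"] qg by (simp add: \<rho>_def)
  have \<rho>nn: "0 \<le> \<rho> ! i" if "i \<le> n" for i
  proof (cases i)
    case 0
    then show ?thesis using \<rho>0 l\<rho> by (cases \<rho>) auto
  next
    case (Suc k)
    then show ?thesis using that l\<rho> reserve_nth[OF res, of k] by (simp add: nth_tl)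
  qed
  have \<rho>lam: "real_of_int (\<rho> ! i) * W 0 i \<le> 10 * K * (?lam 0 i * W 0 i)" if i: "i \<le> n" for i
  proof (cases i)
    case 0
    then show ?thesis by (simp add: W_def)
  next
    case (Suc k)
    then have "\<rho> ! i \<le> 10 * K * ?lam 0 i"
      using reserve_nth[OF res, of k] i l\<rho> len by (simp add: nth_tl)
    then have "real_of_int (\<rho> ! i) \<le> real_of_int (10 * K * ?lam 0 i)" by (simp only: of_int_le_iff)
    from mult_right_mono[OF this W[of 0 i]] i n0 show ?thesis by (simp add: mult.assoc)
  qed
  define m where "m = (1 / (2 * D * S)) *\<^sub>R (\<Sum>i\<le>n. real_of_int (\<rho> ! i) *\<^sub>R g i)"
  have DS: "real_of_int D * real_of_int S > 0" using D S by simp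
  have m: "(\<Sum>i\<le>n. real_of_int (\<rho> ! i) *\<^sub>R g i) = (2 * D * S) *\<^sub>R m"
    using D S by (simp add: m_def)
  have \<rho>_map: "\<rho> = map (\<lambda>i. \<rho> ! i) [0..<Suc n]" using map_nth[of \<rho>] l\<rho> by simp
  have \<rho>sum: "(\<Sum>i\<le>n. real_of_int (\<rho> ! i)) = 2 * D * S"
  proof -
    have "sum_list \<rho> = (\<Sum>i\<le>n. \<rho> ! i)"
      by (subst \<rho>_map) (simp only: interv_sum_list_conv_sum_set_nat atLeast0LessThan lessThan_Suc_atMost set_upt)
    then have "real_of_int (\<Sum>i\<le>n. \<rho> ! i) = real_of_int (2 * (D * S))" using \<rho>S by simp
    then show ?thesis by simp
  qed
  define ds where "ds = map (\<lambda>i. g i - m) [0..<Suc n]"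
  have Q: "D * S / K * ((g 0 - m) \<bullet> (g 0 - m)) + D * S * (m \<bullet> m) \<le> qform M ?gs"
  proof -
    \<comment> \<open>By the choice of \<open>m\<close> the deviations have weighted sum 0, which
      removes the linear term of the translation.\<close>
    have lc: "lincomb \<rho> ds = 0"
    proof -
      have "lincomb \<rho> ds = (\<Sum>i\<le>n. real_of_int (\<rho> ! i) *\<^sub>R (g i - m))"
        unfolding ds_def by (subst \<rho>_map) (simp only: lincomb_upt atLeast0LessThan lessThan_Suc_atMost)
      then show ?thesis
        by (simp add: scaleR_diff_right sum_subtractf m flip: scaleR_sum_left) (simp add: \<rho>sum)
    qed
    have z0: "lincomb (zeros xs) ws = 0" for xs :: "int list list" and ws :: "'a list"
    proof (induction xs arbitrary: ws)
      case (Cons r xs)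
      then show ?case by (cases ws) auto
    qed simp
    have gs: "?gs = map (\<lambda>v. v + m) ds" by (simp add: ds_def comp_def del: upt_Suc)
    have "qform M ?gs = qform M ds + m \<bullet> (lincomb \<rho> ds - lincomb (zeros M) ds)
        + (sum_list \<rho> - sum_list (zeros M)) / 2 * (m \<bullet> m)"
      unfolding gs \<rho>_def using qg(2) by (intro qform_translate qg(1)) (auto simp: ds_def)
    also have "\<dots> = qform M ds + D * S * (m \<bullet> m)"
      by (simp add: lc z0 \<rho>S)
    finally have "qform M ?gs = qform M ds + D * S * (m \<bullet> m)" .
    moreover have M0: "M \<noteq> []" using qg(2) by auto
    have "0 \<le> qform (dec_first e M) ds"
    proof (rule psd_zero_sound)
      show "psd c L (zeros (dec_first e M)) (dec_first e M)" using psd by (simp add: psd0_def)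
      show "triangular (dec_first e M)" "length ds = length (dec_first e M)"
        using dec_first(1,2)[OF qg(1) M0, of ds e] qg by (auto simp: ds_def)
    qed (rule c)
    then have "e * ((g 0 - m) \<bullet> (g 0 - m)) \<le> qform M ds"
      using dec_first(3)[OF qg(1) M0, of ds e] qg(2) by (simp add: ds_def upt_conv_Cons del: upt_Suc)
    moreover have "D * S / K * ((g 0 - m) \<bullet> (g 0 - m)) \<le> e * ((g 0 - m) \<bullet> (g 0 - m))"
    proof -
      have "real_of_int D * real_of_int S \<le> real_of_int e * real_of_int K"
        using e by (simp flip: of_int_mult)
      then show ?thesis using K by (intro mult_right_mono) (auto simp: pos_divide_le_eq)
    qed
    ultimately show ?thesis by simp
  qed
  let ?\<delta> = "F x0 - F xs"
  have \<delta>0: "0 \<le> ?\<delta>"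
  proof -
    have "F xs + G xs \<bullet> (x0 - xs) + (norm (G x0 - G xs))\<^sup>2 / 2 \<le> F x0"
      using I x0 xs(1) unfolding interpolates_def by blast
    moreover have "0 \<le> (norm (G x0 - G xs))\<^sup>2 / 2" "G xs \<bullet> (x0 - xs) = 0" by (simp_all add: xs(2))
    ultimately show ?thesis by linarith
  qed
  define t where "t = ?\<delta> / R\<^sup>2"
  have t: "0 \<le> t" "t * K \<le> 1" using \<delta>0 \<delta> R by (auto simp: t_def field_simps)
  \<comment> \<open>The value at point \<open>i\<close> is eliminated by the inequality from the
    minimizer, where the gradient is 0, to that point.\<close>
  have Wge: "?\<delta> - g i \<bullet> (x0 - xs) - (g 0 \<bullet> g 0) / 2 + g 0 \<bullet> g i \<le> W 0 i" if "i \<le> n" for i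
  proof -
    have "(norm (g 0 - g i))\<^sup>2 = g 0 \<bullet> g 0 - 2 * (g 0 \<bullet> g i) + g i \<bullet> g i" "(norm (g i))\<^sup>2 = g i \<bullet> g i"
      by (simp_all add: power2_norm_eq_inner inner_diff_left inner_diff_right inner_commute)
    then show ?thesis
      using T(8)[OF xs(1) that] by (simp add: W_def T(1,3) xs(2) inner_diff_right add_divide_distrib diff_divide_distrib)
  qed
  have "t * (2 * D * S * (?\<delta> - m \<bullet> (x0 - xs) - (g 0 \<bullet> g 0) / 2 + g 0 \<bullet> m))
      = t * (\<Sum>i\<le>n. real_of_int (\<rho> ! i) * (?\<delta> - g i \<bullet> (x0 - xs) - (g 0 \<bullet> g 0) / 2 + g 0 \<bullet> g i))"
  proof -
    have "(\<Sum>i\<le>n. real_of_int (\<rho> ! i) * (?\<delta> - g i \<bullet> (x0 - xs) - (g 0 \<bullet> g 0) / 2 + g 0 \<bullet> g i))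
      = (\<Sum>i\<le>n. real_of_int (\<rho> ! i)) * (?\<delta> - (g 0 \<bullet> g 0) / 2)
        + (g 0 - (x0 - xs)) \<bullet> (\<Sum>i\<le>n. real_of_int (\<rho> ! i) *\<^sub>R g i)"
      unfolding sum_distrib_right inner_sum_right sum.distrib[symmetric]
      by (intro sum.cong refl) (simp add: inner_diff_left inner_commute algebra_simps)
    also have "\<dots> = 2 * D * S * (?\<delta> - m \<bullet> (x0 - xs) - (g 0 \<bullet> g 0) / 2 + g 0 \<bullet> m)"
      unfolding m \<rho>sum by (simp add: inner_diff_left inner_diff_right inner_commute algebra_simps)
    finally show ?thesis by (simp only:)
  qed
  also have "\<dots> \<le> t * (\<Sum>i\<le>n. 10 * K * (?lam 0 i * W 0 i))"
  proof (intro mult_left_mono sum_mono t)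
    fix i assume "i \<in> {..n}"
    then have i: "i \<le> n" by simp
    have "real_of_int (\<rho> ! i) * (?\<delta> - g i \<bullet> (x0 - xs) - (g 0 \<bullet> g 0) / 2 + g 0 \<bullet> g i) \<le> real_of_int (\<rho> ! i) * W 0 i"
      using Wge[OF i] \<rho>nn[OF i] by (intro mult_left_mono) auto
    then show "real_of_int (\<rho> ! i) * (?\<delta> - g i \<bullet> (x0 - xs) - (g 0 \<bullet> g 0) / 2 + g 0 \<bullet> g i) \<le> 10 * K * (?lam 0 i * W 0 i)"
      using \<rho>lam[OF i] by linarith
  qed
  also have "\<dots> = (t * K) * (10 * (\<Sum>i\<le>n. ?lam 0 i * W 0 i))"
    by (simp add: sum_distrib_left mult_ac)
  \<comment> \<open>This is where the gap has to be small against \<open>R\<^sup>2\<close>: by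
    \<open>t * K \<le> 1\<close> no more slack is spent than the flow provides.\<close>
  also have "\<dots> \<le> 1 * (10 * (\<Sum>i\<le>n. ?lam 0 i * W 0 i))"
    using t lam0 by (intro mult_right_mono) (auto intro!: sum_nonneg simp del: of_int_0_le_iff zero_le_mult_iff)
  also have "(\<Sum>i\<le>n. ?lam 0 i * W 0 i) \<le> (\<Sum>i\<le>n. \<Sum>j\<le>n. ?lam i j * W i j)"
    using lam0 by (intro member_le_sum[of 0 "{..n}" "\<lambda>i. \<Sum>j\<le>n. ?lam i j * W i j"] sum_nonneg) auto
  finally have "D * S / K * ((g 0 - m) \<bullet> (g 0 - m)) + D * S * (m \<bullet> m)
      + t * (2 * D * S * (?\<delta> - m \<bullet> (x0 - xs) - (g 0 \<bullet> g 0) / 2 + g 0 \<bullet> m))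
      \<le> 10 * D * (F x0 - F (run G (hr @ h') x0))"
    using Q total by simp
  also have "D * S / K * ((g 0 - m) \<bullet> (g 0 - m)) + D * S * (m \<bullet> m)
      + t * (2 * D * S * (?\<delta> - m \<bullet> (x0 - xs) - (g 0 \<bullet> g 0) / 2 + g 0 \<bullet> m))
    = D * (S * (m \<bullet> m) + S / K * ((g 0 - m) \<bullet> (g 0 - m))
      + 2 * (?\<delta> / R\<^sup>2) * S * (?\<delta> - m \<bullet> (x0 - xs) - (g 0 \<bullet> g 0) / 2 + g 0 \<bullet> m))"
    unfolding t_def[symmetric] by (simp add: algebra_simps)
  finally have "S * (m \<bullet> m) + S / K * ((g 0 - m) \<bullet> (g 0 - m))
      + 2 * (?\<delta> / R\<^sup>2) * S * (?\<delta> - m \<bullet> (x0 - xs) - (g 0 \<bullet> g 0) / 2 + g 0 \<bullet> m)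
      \<le> 10 * (F x0 - F (run G (hr @ h') x0))"
    using D by simp
  from decrease_from_slack[OF _ _ R(1) \<delta>0 _ R(2) this] S K \<delta>
  have final: "S / R\<^sup>2 * ?\<delta>\<^sup>2 \<le> 10 * (F x0 - F (run G (hr @ h') x0))" by simp
  have tenth: "a / 10 \<le> b" if "a \<le> 10 * b" for a b :: real using that by simp
  have "real_of_int S / 10 / R\<^sup>2 * ?\<delta>\<^sup>2 = S / R\<^sup>2 * ?\<delta>\<^sup>2 / 10" by simp
  also have "\<dots> \<le> F x0 - F (run G (hr @ h') x0)" by (rule tenth[OF final])
  finally show ?thesis unfolding S_def hr_def .
qed

section \<open>Straightforwardness and rate from a certificate\<close>

text \<open>Working with \<open>f / l\<close> removes the smoothness constant. In the definition
  \<open>\<delta>\<close> only bounds the actual gap, so the decrease proved for the actual gap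
  \<open>d\<close> has to be carried over to \<open>\<gamma>\<close>. The upper bound is increasing
  up to \<open>D\<^sup>2 / K\<close>; this is what \<open>2 * sum_list p \<le> K\<close> is
  for.\<close>

lemma pattern_straightforward:
  assumes chk: "check_main h s D cols K e c L"
    and V: "\<And>n F G. interpolates (Rn n) F G \<Longrightarrow> virtual_end (Rn n) F G h' (real_of_int s / 10)"
    and p: "p = map (\<lambda>a. real_of_int a / 10) h @ h'"
    and S: "sum_list p = real_of_int (sum_list h + s) / 10" and K: "2 \<le> K" "2 * sum_list p \<le> K"
  shows "straightforward n p 0 (1 / K)"
  unfolding straightforward_def
proof (intro conjI allI impI ballI)
  fix l D \<delta> :: real
  assume l: "0 < l" and D: "0 < D" and \<delta>: "\<delta> \<in> {0..l * D\<^sup>2 * (1 / K)}"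
  have S0: "0 \<le> sum_list p"
    using chk unfolding S by (simp add: check_main_def)
  have sum: "(\<Sum>i<length p. p ! i - 0) = sum_list p"
    by (simp add: sum_list_sum_nth atLeast0LessThan)
  show "worst_case_gap n p l D \<delta> \<le> ereal (\<delta> - (\<Sum>i<length p. p ! i - 0) / (l * D\<^sup>2) * \<delta>\<^sup>2)"
    unfolding worst_case_gap_def sum
  proof (rule Sup_least, clarify, unfold ereal_less_eq(3))
    fix f g x0 xs
    assume f: "convex_on (Rn n) f" "smooth_with_gradient l (Rn n) f g"
      and x: "x0 \<in> Rn n" "xs \<in> Rn n" "g xs = 0" "norm (x0 - xs) \<le> D" "f x0 - f xs \<le> \<delta>"
    let ?F = "\<lambda>x. f x / l" and ?G = "\<lambda>x. g x /\<^sub>R l"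
    have I: "interpolates (Rn n) ?F ?G"
      by (rule smooth_convex_interpolates[OF subspace_Rn l f])
    define d where "d = ?F x0 - ?F xs"
    define \<gamma> where "\<gamma> = \<delta> / l"
    have dg: "d \<le> \<gamma>" using x(5) l by (simp add: d_def \<gamma>_def divide_right_mono flip: diff_divide_distrib)
    have gK: "K * \<gamma> \<le> D\<^sup>2" using \<delta> l K by (simp add: \<gamma>_def field_simps)
    have "real_of_int K * d \<le> K * \<gamma>" using dg K by (intro mult_left_mono) auto
    with gK have dK: "K * d \<le> D\<^sup>2" by linarith
    have run: "grad_descent (\<lambda>k. p ! k) l g x0 (length p) = run ?G p x0"
      using grad_descent_run[of p "\<lambda>k. p ! k" 0 l g x0] by simp
    have "sum_list p / D\<^sup>2 * d\<^sup>2 \<le> ?F x0 - ?F (run ?G p x0)"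
    proof -
      have "?G xs = 0" by (simp add: x(3))
      from pattern_decrease[OF chk I V[OF I] x(1,2) this D x(4) dK[unfolded d_def]]
      show ?thesis unfolding S d_def unfolding p .
    qed
    then have "?F (run ?G p x0) - ?F xs \<le> d - sum_list p / D\<^sup>2 * d\<^sup>2"
      by (simp add: d_def)
    also have "\<dots> \<le> \<gamma> - sum_list p / D\<^sup>2 * \<gamma>\<^sup>2"
    proof -
      \<comment> \<open>The difference of the two bounds factors into \<open>\<gamma> - d\<close>
        and \<open>1 - sum_list p / D\<^sup>2 * (\<gamma> + d)\<close>, and the second factor is
        shown to be nonnegative.\<close>
      have "sum_list p / D\<^sup>2 * (\<gamma> + d) \<le> sum_list p / D\<^sup>2 * (2 * \<gamma>)"
        using dg S0 by (intro mult_left_mono) auto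
      also have "\<dots> = (2 * sum_list p) * \<gamma> / D\<^sup>2" by simp
      also have "\<dots> \<le> K * \<gamma> / D\<^sup>2"
        using K(2) \<delta> l by (intro divide_right_mono mult_right_mono) (auto simp: \<gamma>_def)
      also have "\<dots> \<le> 1" using gK D by simp
      finally have "(sum_list p / D\<^sup>2 * (\<gamma> + d)) * (\<gamma> - d) \<le> 1 * (\<gamma> - d)"
        using dg by (intro mult_right_mono) auto
      then show ?thesis by (simp add: power2_eq_square algebra_simps diff_divide_distrib)
    qed
    finally have "l * (?F (run ?G p x0) - ?F xs) \<le> l * (\<gamma> - sum_list p / D\<^sup>2 * \<gamma>\<^sup>2)"
      using l by (intro mult_left_mono) auto
    moreover have "l * (?F (run ?G p x0) - ?F xs) = f (run ?G p x0) - f xs"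
      using l by (simp add: right_diff_distrib)
    moreover have "l * (\<gamma> - sum_list p / D\<^sup>2 * \<gamma>\<^sup>2) = \<delta> - sum_list p / (l * D\<^sup>2) * \<delta>\<^sup>2"
      using l by (simp add: \<gamma>_def power2_eq_square right_diff_distrib)
    ultimately show "f (grad_descent (\<lambda>k. p ! k) l g x0 (length p)) - f xs
        \<le> \<delta> - sum_list p / (l * D\<^sup>2) * \<delta>\<^sup>2"
      unfolding run by simp
  qed
qed (use K in auto)

lemma straightforward_weaken:
  assumes "straightforward n h 0 \<Delta>" "0 \<le> \<epsilon>"
  shows "straightforward n h \<epsilon> \<Delta>"
  unfolding straightforward_def
proof (intro conjI allI impI ballI)
  fix L D \<delta> :: real assume LD: "0 < L" "0 < D" and \<delta>: "\<delta> \<in> {0..L * D\<^sup>2 * \<Delta>}"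
  have "worst_case_gap n h L D \<delta> \<le> ereal (\<delta> - (\<Sum>i<length h. h ! i - 0) / (L * D\<^sup>2) * \<delta>\<^sup>2)"
    using assms(1) LD \<delta> unfolding straightforward_def by blast
  also have "\<dots> \<le> ereal (\<delta> - (\<Sum>i<length h. h ! i - \<epsilon>) / (L * D\<^sup>2) * \<delta>\<^sup>2)"
    using assms(2) LD by (auto intro!: mult_right_mono divide_right_mono sum_mono)
  finally show "worst_case_gap n h L D \<delta> \<le> ereal (\<delta> - (\<Sum>i<length h. h ! i - \<epsilon>) / (L * D\<^sup>2) * \<delta>\<^sup>2)" .
qed (use assms(1) in \<open>auto simp: straightforward_def\<close>)

section \<open>From the decrease per pattern to the rate\<close>

lemma gradient_at_minimizer:
  assumes E: "subspace E" and L: "L > 0" and f: "smooth_with_gradient L E f g"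
    and xs: "xs \<in> E" "\<And>x. x \<in> E \<Longrightarrow> f xs \<le> f x"
  shows "g xs = 0"
proof -
  have g: "g xs \<in> E" using f xs(1) by (auto simp: smooth_with_gradient_def)
  \<comment> \<open>A gradient step with stepsize \<open>1 / L\<close> would lower the value by at
    least \<open>N / 2\<close>, half the squared gradient norm over \<open>L\<close>.\<close>
  define y where "y = xs - g xs /\<^sub>R L"
  have y: "y \<in> E" unfolding y_def using E g xs(1) by (intro subspace_diff subspace_scale)
  define N where "N = (norm (g xs))\<^sup>2 / L"
  have "f xs \<le> f xs + g xs \<bullet> (y - xs) + L / 2 * (norm (y - xs))\<^sup>2"
    using xs(2)[OF y] smooth_descent[OF E f y xs(1)] by linarith
  moreover have "g xs \<bullet> (y - xs) = - N"
    by (simp add: N_def y_def power2_norm_eq_inner divide_inverse mult.commute)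
  moreover have "L / 2 * (norm (y - xs))\<^sup>2 = N / 2"
  proof -
    have "norm (y - xs) = norm (g xs) / L" using L by (simp add: y_def divide_inverse)
    then show ?thesis using L by (simp add: N_def power_divide power2_eq_square)
  qed
  ultimately have "N \<le> 0" by linarith
  then show ?thesis using L by (simp add: N_def divide_le_0_iff)
qed

lemma geometric_then_small:
  fixes \<delta> :: "nat \<Rightarrow> real"
  assumes q: "0 \<le> q" "q \<le> 1" and b: "0 \<le> b"
    and dec: "\<And>s. \<delta> (Suc s) \<le> \<delta> s" and geo: "\<And>s. b < \<delta> s \<Longrightarrow> \<delta> (Suc s) \<le> q * \<delta> s"
    and init: "\<delta> 0 \<le> a" and s: "q ^ s0 * a \<le> b" "s0 \<le> s"
  shows "\<delta> s \<le> b"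
proof -
  have "\<delta> s \<le> max b (q ^ s * a)" for s
  proof (induction s)
    case (Suc s)
    show ?case
    proof (cases "b < \<delta> s")
      case True
      then have "\<delta> (Suc s) \<le> q * \<delta> s" by (rule geo)
      also have "\<dots> \<le> q * (q ^ s * a)" using Suc True q by (intro mult_left_mono) auto
      finally show ?thesis by (simp add: mult_ac)
    next
      case False
      then show ?thesis using dec[of s] by simp
    qed
  qed (use init in simp)
  then have "\<delta> s0 \<le> b" using s(1) by (metis max.absorb1 )
  moreover have "\<delta> s \<le> \<delta> s0" using dec s(2) by (simp add: lift_Suc_antimono_le)
  ultimately show ?thesis by simp
qed

text \<open>Large gaps contract by the factor \<open>q\<close> per pattern until they are admissible
  for the radius \<open>D\<close>; from then on \<open>rate_recursion\<close> applies. The initial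
  phase of \<open>s0\<close> patterns is paid for by the constant
  \<open>C = S * real s0\<close>.\<close>

lemma straightforward_rate:
  fixes h :: "real list"
  assumes sf: "\<And>n. straightforward n h 0 \<Delta>" and S: "0 < sum_list h" "sum_list h * \<Delta> \<le> 1 / 2"
    and c: "0 < c" "c * real (length h) \<le> sum_list h" and h: "h \<noteq> []"
  shows "\<exists>(s_bar::nat) (C::real). \<forall>(n::nat) (L::real) f g x0 xs D.
        L > 0 \<and> convex_on (Rn n) f \<and> smooth_with_gradient L (Rn n) f g \<and>
        x0 \<in> Rn n \<and> xs \<in> Rn n \<and> (\<forall>x\<in>Rn n. f xs \<le> f x) \<and>
        bdd_above {norm (x - xs) | x. x \<in> Rn n \<and> f x \<le> f x0} \<and>
        D = Sup {norm (x - xs) | x. x \<in> Rn n \<and> f x \<le> f x0} \<longrightarrow>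
        (\<forall>s>s_bar. \<forall>T. T = s * length h \<longrightarrow>
           f (grad_descent (\<lambda>k. h ! (k mod length h)) L g x0 T) - f xs
             \<le> L * D\<^sup>2 / (c * real T - C))"
proof -
  define S where "S = sum_list h"
  define t where "t = length h"
  have \<Delta>: "0 < \<Delta>" using sf[of 0] by (simp add: straightforward_def)
  have S0: "0 < S" "S * \<Delta> \<le> 1 / 2" and t: "0 < t" "c * real t \<le> S"
    using assms by (auto simp: S_def t_def)
  define q where "q = 1 - S * \<Delta>"
  have q: "0 \<le> q" "q < 1" using S0 \<Delta> by (auto simp: q_def)
  \<comment> \<open>The initial gap is at most \<open>L * D\<^sup>2\<close>, so \<open>s0\<close>
    patterns bring it below \<open>L * D\<^sup>2 * \<Delta>\<close> whatever \<open>L\<close> and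
    \<open>D\<close> are. The next number, \<open>s1\<close>, makes the denominator of the rate
    positive.\<close>
  obtain s0 where s0: "q ^ s0 < \<Delta>" using real_arch_pow_inv[OF \<Delta> q(2)] by blast
  obtain s1 where s1: "S * real s0 / (c * real t) < real s1" using reals_Archimedean2 by blast
  have large: "0 < c * real (s * t) - S * real s0" if "s > max s0 s1" for s
  proof -
    have "S * real s0 / (c * real t) < real s" using s1 that by simp
    then show ?thesis using c t by (simp add: field_simps)
  qed
  show ?thesis
  proof (intro exI allI impI)
    fix n L f g x0 xs D s T
    assume A: "L > 0 \<and> convex_on (Rn n) f \<and> smooth_with_gradient L (Rn n) f g \<and>
        x0 \<in> Rn n \<and> xs \<in> Rn n \<and> (\<forall>x\<in>Rn n. f xs \<le> f x) \<and>
        bdd_above {norm (x - xs) | x. x \<in> Rn n \<and> f x \<le> f x0} \<and>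
        D = Sup {norm (x - xs) | x. x \<in> Rn n \<and> f x \<le> f x0}"
      and s: "max s0 s1 < s" and T: "T = s * length h"
    let ?X = "\<lambda>T. grad_descent (\<lambda>k. h ! (k mod length h)) L g x0 T"
    let ?G = "\<lambda>x. g x /\<^sub>R L"
    have L: "L > 0" and f: "convex_on (Rn n) f" "smooth_with_gradient L (Rn n) f g"
      and x: "x0 \<in> Rn n" "xs \<in> Rn n" "\<And>x. x \<in> Rn n \<Longrightarrow> f xs \<le> f x" using A by auto
    have level: "norm (x - xs) \<le> D" if "x \<in> Rn n" "f x \<le> f x0" for x
      using A that by (auto intro!: cSup_upper)
    have gs: "g xs = 0" by (rule gradient_at_minimizer[OF subspace_Rn L f(2) x(2,3)])
    define \<delta> where "\<delta> s = f (?X (s * t)) - f xs" for s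
    have step: "?X (Suc s * t) = run ?G h (?X (s * t))" for s
      using grad_descent_run[of h "\<lambda>k. h ! (k mod length h)" "s * t" L g x0]
      by (simp add: t_def add.commute)
    have mem: "?X (s * t) \<in> Rn n" for s
    proof (induction s)
      case (Suc s)
      then show ?case unfolding step
        by (rule run_in_subspace[OF smooth_convex_interpolates[OF subspace_Rn L f]])
    qed (use x in simp)
    have \<delta>0: "0 \<le> \<delta> s" for s using x(3)[OF mem] by (simp add: \<delta>_def)
    have D0: "0 \<le> D" using level[OF x(1)] norm_ge_zero order_trans by blast
    have bound: "\<delta> (Suc s) \<le> \<delta> s - S / (L * R\<^sup>2) * (\<delta> s)\<^sup>2"
      if "0 < R" "norm (?X (s * t) - xs) \<le> R" "\<delta> s \<le> L * R\<^sup>2 * \<Delta>" for s R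
    proof -
      have "f (?X (s * t)) - f xs \<le> \<delta> s" by (simp add: \<delta>_def)
      from straightforward_decrease[OF sf L that(1) \<delta>0 that(3) f mem x(2) gs that(2) this]
      show ?thesis unfolding S_def \<delta>_def[of "Suc s"] step .
    qed
    have init: "\<delta> 0 \<le> L * D\<^sup>2"
    proof -
      have "f x0 \<le> f xs + g xs \<bullet> (x0 - xs) + L / 2 * (norm (x0 - xs))\<^sup>2"
        by (rule smooth_descent[OF subspace_Rn f(2) x(1,2)])
      moreover have "L / 2 * (norm (x0 - xs))\<^sup>2 \<le> L / 2 * D\<^sup>2"
        using level[OF x(1)] L by (intro mult_left_mono power_mono) auto
      moreover have "0 \<le> L * D\<^sup>2" using L by simp
      ultimately show ?thesis by (simp add: \<delta>_def gs)
    qed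
    show "f (?X T) - f xs \<le> L * D\<^sup>2 / (c * real T - S * real s0)"
    proof (cases "D = 0")
      case True
      \<comment> \<open>The level set is a single point, but straightforwardness asks for a positive
        radius; 1 serves.\<close>
      have "\<delta> s \<le> 0 \<and> f (?X (s * t)) \<le> f x0" for s
      proof (induction s)
        case 0
        then show ?case using init True by simp
      next
        case (Suc s)
        then have "\<delta> s = 0" using \<delta>0[of s] by simp
        moreover have "norm (?X (s * t) - xs) \<le> 1" using level[OF mem] Suc True by fastforce
        ultimately have "\<delta> (Suc s) \<le> 0" using bound[of 1 s] L \<Delta> by simp
        then show ?case using x(3)[OF x(1)] by (simp add: \<delta>_def)
      qed
      then show ?thesis using True T by (simp add: \<delta>_def t_def)
    next
      case False
      then have D: "0 < D" using D0 by simp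
      define M where "M = L * D\<^sup>2"
      have M: "0 < M" using L D by (simp add: M_def)
      have both: "(M * \<Delta> < \<delta> s \<longrightarrow> \<delta> (Suc s) \<le> q * \<delta> s) \<and> (\<delta> s \<le> M * \<Delta> \<longrightarrow> \<delta> (Suc s) \<le> \<delta> s - S / M * (\<delta> s)\<^sup>2)"
        if "norm (?X (s * t) - xs) \<le> D" for s
      proof (intro conjI impI)
        assume big: "M * \<Delta> < \<delta> s"
        then have pos: "0 < \<delta> s" using M \<Delta> by (meson less_trans mult_pos_pos)
        \<comment> \<open>Chosen such that \<open>\<delta> s = L * R\<^sup>2 * \<Delta>\<close>: the
          gap is just admissible for the radius \<open>R\<close>, and \<open>D \<le> R\<close>
          because the gap is large. Inserting \<open>R\<close> makes the quadratic term linear in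
          \<open>\<delta> s\<close>.\<close>
        define R where "R = sqrt (\<delta> s / (L * \<Delta>))"
        have R2: "R\<^sup>2 = \<delta> s / (L * \<Delta>)" using pos L \<Delta> by (simp add: R_def)
        have R: "0 < R" using pos L \<Delta> by (simp add: R_def)
        have "D\<^sup>2 * (L * \<Delta>) \<le> \<delta> s" using big by (simp add: M_def mult_ac)
        then have "D\<^sup>2 \<le> R\<^sup>2" using L \<Delta> unfolding R2 by (subst pos_le_divide_eq) auto
        then have "D \<le> R" by (rule power2_le_imp_le) (use R in simp)
        with that have nR: "norm (?X (s * t) - xs) \<le> R" by linarith
        have LR: "L * R\<^sup>2 = \<delta> s / \<Delta>" unfolding R2 using L by simp
        have "\<delta> s \<le> L * R\<^sup>2 * \<Delta>" unfolding LR using \<Delta> by simp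
        from bound[OF R nR this] have "\<delta> (Suc s) \<le> \<delta> s - S / (\<delta> s / \<Delta>) * (\<delta> s)\<^sup>2"
          unfolding LR .
        also have "S / (\<delta> s / \<Delta>) * (\<delta> s)\<^sup>2 = S * \<Delta> * \<delta> s"
          using pos by (simp add: power2_eq_square)
        finally show "\<delta> (Suc s) \<le> q * \<delta> s" by (simp add: q_def algebra_simps)
      next
        assume "\<delta> s \<le> M * \<Delta>"
        then show "\<delta> (Suc s) \<le> \<delta> s - S / M * (\<delta> s)\<^sup>2"
          using bound[OF D that] by (simp add: M_def)
      qed
      have mono: "\<delta> (Suc s) \<le> \<delta> s" if "norm (?X (s * t) - xs) \<le> D" for s
      proof (cases "M * \<Delta> < \<delta> s")
        case True
        then have "\<delta> (Suc s) \<le> q * \<delta> s" using both[OF that] by simp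
        also have "\<dots> \<le> 1 * \<delta> s" using q \<delta>0 by (intro mult_right_mono) auto
        finally show ?thesis by simp
      next
        case False
        then have "\<delta> (Suc s) \<le> \<delta> s - S / M * (\<delta> s)\<^sup>2" using both[OF that] by simp
        moreover have "0 \<le> S / M * (\<delta> s)\<^sup>2" using S0 M by simp
        ultimately show ?thesis by linarith
      qed
      \<comment> \<open>Distance bound and monotonicity support each other: an iterate in the level
        set of \<open>x0\<close> has distance at most \<open>D\<close> from the minimizer, so its
        successor has no larger value and stays in the level set.\<close>
      have lev: "f (?X (s * t)) \<le> f x0" for s
      proof (induction s)
        case (Suc s)
        then show ?case using mono[OF level[OF mem Suc]] by (simp add: \<delta>_def)
      qed simp
      note inD = level[OF mem lev]
      have small: "\<delta> s \<le> M * \<Delta>" if "s0 \<le> s" for s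
      proof (rule geometric_then_small[where q = q and a = M and \<delta> = \<delta>])
        show "q ^ s0 * M \<le> M * \<Delta>" using s0 M by (simp add: mult.commute)
        show "\<delta> 0 \<le> M" using init by (simp add: M_def)
        show "\<delta> (Suc s) \<le> \<delta> s" for s by (rule mono[OF inD])
        show "\<delta> (Suc s) \<le> q * \<delta> s" if "M * \<Delta> < \<delta> s" for s using both[OF inD] that by blast
      qed (use q M \<Delta> that in auto)
      have k: "s = s0 + (s - s0)" "0 < real (s - s0)" using s by auto
      have "\<delta> (s0 + (s - s0)) * (S * real (s - s0)) \<le> M"
        using small both[OF inD] by (intro rate_recursion[OF M S0(1) \<delta>0]) auto
      then have "\<delta> s \<le> M / (S * real (s - s0))"
        using k S0 by (simp add: pos_le_divide_eq)
      also have "\<dots> \<le> M / (c * real T - S * real s0)"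
      proof (rule divide_left_mono)
        have "c * real (s * t) = (c * real t) * real s" by simp
        also have "\<dots> \<le> S * real s" using t by (intro mult_right_mono) auto
        finally show "c * real T - S * real s0 \<le> S * real (s - s0)"
          using s by (simp add: T t_def of_nat_diff right_diff_distrib)
        have "0 < c * real T - S * real s0" using large[OF s] by (simp add: T t_def)
        then show "0 < S * real (s - s0) * (c * real T - S * real s0)"
          using k S0 by simp
      qed (use M in simp)
      finally show ?thesis by (simp add: \<delta>_def M_def T t_def)
    qed
  qed
qed

section \<open>Certificates\<close>

text \<open>In every tail certificate \<open>s1\<close> is \<open>sum_list h + s0\<close>, the total
  stepsize replaced. No larger value is possible: if all gradients and \<open>v\<close> equal one
  vector, the form is \<open>D * (sum_list h + s0 - s1)\<close> times its squared norm. With this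
  choice it vanishes on constant vectors, so it is semidefinite without being definite.\<close>

lemma tail_b: "
      check_tail [14, 20, 14, 39, 14, 20, 14] 0 135 5460000 [[0, 115440, 32760, 0, 0, 0, 0, 0],
      [421200, 0, 101283, 191100, 76440, 0, 16380, 0], [0, 554463, 0, 1282710, 38220, 27300, 0,
      0], [0, 524160, 2047110, 0, 93940, 0, 0, 0], [0, 0, 0, 361480, 0, 43680, 0, 0], [0, 0, 0,
      600600, 595140, 0, 40131, 0], [0, 0, 0, 682500, 92820, 932295, 0, 0], [0, 0, 0, 698880, 0,
      1111656, 2644824, 0]] [273000, 387660, 278460, 1152060, 491400, 879060, 993720, 1004640] 2
      [[1022, 1299, 876, 3947, 1685, 3012, 3405, 3442, -18688], [637, 621, 882, 34, 631, 794,
      868, -4467], [540, 122, 64, -36, 9, -66, -633], [928, 529, 525, 539, 563, -3084], [1014,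
      290, -87, -156, -1061], [563, 114, 233, -910], [974, -258, -716], [748, -748]]"
  by code_simp

text \<open>Here \<open>h\<close> is one block followed by the step 7.2, and the second block is
  already a fictitious point with correction 13.5. In this way a tail built by repeated doubling
  costs one form per level, of about half its length.\<close>

lemma tail_72: "
      check_tail [14, 20, 14, 39, 14, 20, 14, 72] 135 342 546000000 [[0, 2267850, 2238600, 0,
      442260, 0, 141960, 0, 0], [16027050, 0, 63882, 11979240, 0, 447720, 0, 879060, 0], [0,
      25714962, 0, 46567950, 0, 0, 234780, 1627080, 0], [0, 17220840, 82401930, 0, 61460, 0, 0,
      9587760, 0], [0, 0, 0, 16856420, 0, 21457800, 0, 4045860, 0], [0, 0, 0, 19273800, 54933060,
      0, 162708, 62167560, 0], [0, 0, 0, 11711700, 0, 76264188, 0, 212323410, 0], [0, 0, 704340,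
      11870040, 0, 56538300, 312109590, 0, 0], [0, 0, 0, 25913160, 0, 0, 175500, 175669260, 0]]
      [10936380, 15806700, 11263980, 34900320, 13076700, 18170880, 12525240, 85077720, 344242080]
      64 [[1125, 1445, 895, 3247, 1239, 1759, 1220, 8283, 33478, -52691], [820, 1255, 953, 149,
      170, 137, 1551, 6627, -11662], [501, -35, -110, -155, -152, -291, -1232, 1474], [2252,
      1152, 1128, 594, -130, -1905, -3091], [246, -18, -46, 7, 371, -560], [388, 214, 255, -526,
      -331], [614, -482, -285, 153], [1148, 4543, -5691], [1804, -1804]]"
  by code_simp

lemma tail_142: "
      check_tail [14, 20, 14, 39, 14, 20, 14, 72, 14, 20, 14, 39, 14, 20, 14, 142] 342 826
      32760000000 [[0, 187780320, 0, 0, 0, 0, 0, 0, 0, 0, 0, 0, 0, 0, 0, 0, 0], [463816080, 0,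
      10445526, 406125720, 23292360, 0, 0, 4750200, 0, 458640, 0, 3046680, 0, 0, 294840, 3636360,
      0], [0, 625285206, 0, 1746599400, 0, 491400, 0, 262080, 0, 0, 0, 196560, 0, 0, 0, 229320,
      0], [0, 495396720, 2638588680, 0, 9791040, 0, 71711640, 358165080, 0, 0, 0, 114528960, 0,
      0, 0, 150794280, 0], [0, 0, 0, 485990400, 0, 760975020, 0, 164782800, 0, 0, 0, 51072840, 0,
      0, 0, 75184200, 0], [0, 0, 0, 634037040, 1780498980, 0, 10702692, 2071513080, 0, 982800, 0,
      77575680, 0, 0, 0, 102473280, 0], [0, 0, 0, 452644920, 0, 2478349692, 0, 6913693800, 0, 0,
      0, 69123600, 0, 11105640, 0, 114725520, 0], [0, 0, 0, 441899640, 0, 1827844200,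
      10223567640, 0, 10083710, 0, 0, 142276680, 0, 14807520, 0, 502145280, 0], [0, 0, 0,
      43505280, 0, 0, 0, 371098910, 0, 644705100, 0, 34398000, 16445520, 0, 0, 92350440, 0], [0,
      0, 0, 43275960, 0, 0, 0, 575527680, 1516088340, 0, 9470916, 1479048480, 31318560, 0, 0,
      173955600, 0], [0, 0, 0, 51007320, 0, 0, 0, 339753960, 0, 2075971716, 0, 5785200720, 0, 0,
      3865680, 146863080, 0], [0, 131040, 0, 83243160, 0, 0, 0, 1015756560, 0, 1567500480,
      8712011880, 0, 9620520, 0, 151154640, 2427057360, 0], [0, 0, 0, 34954920, 0, 0, 0,
      331498440, 0, 0, 0, 1556121840, 0, 2516138820, 0, 1197181440, 0], [0, 0, 0, 49729680, 0,
      1048320, 0, 465879960, 0, 0, 0, 2233838880, 5937822540, 0, 9723168, 7634783520, 0], [0, 0,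
      0, 33316920, 0, 0, 0, 340048800, 0, 0, 0, 1555805160, 0, 8273596968, 0, 23771046780, 0],
      [0, 0, 0, 35675640, 0, 0, 0, 474626880, 0, 0, 0, 1182537720, 0, 6031083240, 34169716620, 0,
      0], [0, 0, 0, 61687080, 0, 0, 0, 1368843840, 0, 0, 0, 662014080, 0, 0, 1483560, 9735541920,
      0]] [276035760, 392726880, 275970240, 764716680, 275577120, 390925080, 266338800,
      1633577400, 323668800, 460933200, 318820320, 980310240, 359311680, 513906120, 362423880,
      4234328280, 20930429520] 2 [[31239, 43875, 30974, 85733, 30930, 43854, 29895, 183081,
      36318, 51697, 35775, 109889, 40312, 57632, 40660, 474470, 2345110, -3671444], [8287, 1694,
      -7123, -9456, -3463, -2523, -1068, 66, 253, 210, 4374, 1908, 2768, 1976, 41848, 212606,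
      -252357], [4438, 6588, 4523, 2885, 2203, 9451, 1805, 2507, 1718, 4373, 1495, 2122, 1490,
      12196, 58716, -116510], [42403, 23711, 26663, 21772, -54345, -13698, -22734, -12394,
      -23839, -5228, -7463, -5485, 16693, 108340, -94396], [6803, -3304, 3642, 22688, 5711, 9737,
      5259, 7620, 1013, 1389, 1180, 4134, 17026, -82898], [4126, -3088, -5921, -2327, -3664,
      -1110, -6940, -2037, -2480, -2100, -8095, -35094, 68730], [18408, -71759, -11670, -16870,
      -11502, -26562, -8612, -10547, -6516, 8196, 67642, 69792], [87151, 18806, 28974, 16373,
      67992, 24072, 35137, 27278, -30067, -234632, -41084], [7000, -4326, 5302, 22713, 10761,
      21425, 14058, -4618, -73987, 1672], [5880, -2661, -6093, -13133, 624, -3031, 3227, 26783,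
      -11596], [11235, -26071, -7864, -10869, -7566, 2905, 46356, -8126], [69951, 33252, 48010,
      34057, -11939, -186641, 13310], [13462, -9613, 4245, -7287, -1474, 667], [6447, -800, 2327,
      -11861, 3887], [36479, -36074, -3018, 2613], [26717, 138077, -164794], [19029, -19029]]"
  by code_simp

text \<open>Starts from the same tail of 15 steps as \<open>tail_142\<close>: the patterns of length
  63 and 127 share it and differ in the next long step.\<close>

lemma tail_126: "
      check_tail [14, 20, 14, 39, 14, 20, 14, 72, 14, 20, 14, 39, 14, 20, 14, 126] 342 810
      32760000000 [[0, 72933120, 51990120, 0, 5634720, 0, 6224400, 0, 0, 0, 0, 0, 0, 0, 0, 0, 0],
      [417404520, 0, 10681398, 321015240, 0, 5045040, 0, 7698600, 0, 1605240, 0, 1670760,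
      1015560, 163800, 0, 2489760, 0], [0, 663522678, 0, 1283120280, 0, 0, 8746920, 3276000, 0,
      2424240, 884520, 4946760, 0, 0, 0, 4488120, 0], [0, 406748160, 2191653360, 0, 10458000, 0,
      14479920, 156101400, 0, 2129400, 0, 72399600, 0, 16380000, 0, 99754200, 0], [0, 0, 0,
      436043160, 0, 593735220, 0, 55004040, 0, 0, 0, 39901680, 0, 0, 4127760, 50548680, 0], [0,
      0, 0, 526289400, 1452964500, 0, 11094174, 1581259680, 0, 0, 0, 50384880, 0, 0, 0, 76003200,
      0], [0, 0, 0, 328582800, 0, 2009192094, 0, 5526633060, 0, 0, 0, 46486440, 0, 0, 0,
      80851680, 0], [0, 18935280, 0, 414577800, 0, 1436657040, 8225762220, 0, 10616515, 0, 0,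
      116035920, 0, 0, 0, 357149520, 0], [0, 0, 0, 39017160, 0, 0, 0, 247241995, 0, 480797460, 0,
      22047480, 0, 2227680, 720720, 75970440, 0], [0, 163800, 0, 69221880, 0, 0, 0, 324520560,
      1185989220, 0, 11764116, 1114265880, 53169480, 0, 0, 127927800, 0], [0, 0, 655200,
      29123640, 0, 5470920, 6519240, 238984200, 0, 1605439836, 0, 4499501760, 0, 5438160, 0,
      76494600, 0], [0, 9140040, 0, 125798400, 0, 0, 0, 669123000, 0, 1261620360, 6782972040, 0,
      11553360, 0, 171269280, 1659064680, 0], [0, 0, 0, 29549520, 0, 0, 0, 283799880, 0, 0, 0,
      1256793720, 0, 1945082880, 0, 770744520, 0], [0, 0, 0, 57362760, 0, 15364440, 0, 328353480,
      0, 655200, 0, 1741062960, 4594154760, 0, 11590488, 5795866440, 0], [0, 0, 0, 21195720, 0,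
      42293160, 0, 232792560, 0, 0, 0, 1232300160, 0, 6400281888, 0, 18266964300, 0], [0, 0, 0,
      23423400, 0, 622440, 0, 517411440, 0, 0, 0, 886321800, 0, 4700339280, 26377373880, 0, 0],
      [0, 0, 0, 66142440, 0, 0, 0, 2072495880, 0, 0, 0, 607698000, 0, 0, 3292380, 8854684020, 0]]
      [280622160, 402653160, 283570560, 800359560, 289696680, 410384520, 281080800, 1664961480,
      328582800, 467649000, 327993120, 1001276640, 373922640, 525503160, 372546720, 3793509720,
      21155687280] 8 [[16092, 20672, 12840, 41808, 15280, 21916, 15127, 90615, 17952, 25513,
      17920, 54529, 20417, 28659, 20342, 206352, 1150395, -1776429], [11623, 17234, 12319, 2616,
      3429, 2341, 15932, 3006, 4384, 3120, 10453, 3766, 5387, 3818, 40959, 229319, -369706],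
      [6679, -889, -1212, -1647, -1010, -3400, -684, -1027, -620, -1327, -364, -785, -534, -5633,
      -31589, 44042], [31260, 16094, 17404, 9835, -2750, -2622, -2925, -3132, -1462, -1137, -445,
      -1196, 2927, 23668, -85519], [3361, 58, 2137, -2558, -156, -722, -196, -377, 776, -823,
      -932, -1358, -7973, 8763], [4182, 1331, -7849, -2136, -2449, -2036, -649, -482, 1071, 3480,
      572, 15911, -10946], [9207, -26571, -4205, -5601, -3873, -7080, -2628, -2006, 444, 4502,
      39375, -1564], [40865, 9297, 12746, 9145, 35574, 15126, 19226, 16654, -6842, -79729,
      -72062], [2625, -738, 110, -802, 8, -961, -2347, 2611, 8757, -9263], [4629, 203, -6375,
      -7336, -2547, -3885, 2887, 16570, -4146], [3112, 287, 577, 158, -1119, 2181, 5226, -10422],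
      [34177, 17184, 23224, 15833, -7346, -117553, 34481], [5504, -2440, 1987, -2726, 7572,
      -9897], [3990, -955, 4502, 11689, -19226], [14893, -16032, -10309, 11448], [24968, 141798,
      -166766], [23653, -23653]]"
  by code_simp

lemma tail_235: "
      check_tail [14, 20, 14, 39, 14, 20, 14, 72, 14, 20, 14, 39, 14, 20, 14, 126, 14, 20, 14,
      39, 14, 20, 14, 72, 14, 20, 14, 39, 14, 20, 14, 235] 810 1855 3276000000000 [[0,
      5443006140, 1242423000, 0, 0, 56478240, 0, 0, 0, 0, 0, 0, 0, 0, 130515840, 0, 0, 0,
      40524120, 0, 0, 0, 8026200, 0, 0, 0, 2489760, 0, 0, 0, 0, 0, 0], [19233491940, 0,
      327287142, 15770369160, 201572280, 0, 0, 386011080, 0, 0, 0, 42194880, 0, 107026920, 0,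
      190270080, 0, 32760, 0, 76494600, 0, 0, 0, 64963080, 0, 0, 0, 38427480, 0, 18640440, 0,
      43472520, 0], [0, 29158609662, 0, 64322278020, 0, 202620600, 0, 17133480, 0, 0, 0,
      12874680, 0, 32760, 297755640, 9696960, 0, 0, 0, 8157240, 0, 34529040, 201834360, 8681400,
      0, 0, 64176840, 9959040, 0, 0, 0, 10417680, 0], [0, 18551594880, 105095996460, 0,
      331016280, 0, 2578310280, 11332830600, 0, 0, 0, 1472955120, 0, 0, 0, 1210285440, 0, 0, 0,
      433775160, 0, 114823800, 0, 795281760, 0, 0, 0, 581064120, 0, 52678080, 0, 603832320, 0],
      [0, 32760, 0, 21516810000, 0, 30099518280, 0, 4689168120, 0, 53660880, 0, 525175560, 0, 0,
      352825200, 299066040, 0, 0, 32760, 233382240, 0, 0, 261523080, 231547680, 0, 0, 66830400,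
      279213480, 0, 0, 0, 296772840, 0], [0, 0, 0, 28621920600, 70797855960, 0, 336322350,
      79804310040, 0, 175659120, 0, 828533160, 0, 53038440, 32760, 556821720, 0, 0, 0, 314889120,
      0, 0, 165208680, 286944840, 0, 0, 0, 408418920, 0, 65520, 131040, 478721880, 0], [0, 0, 0,
      20883877560, 0, 97711523910, 0, 269711521560, 0, 0, 0, 807173640, 0, 64176840, 0,
      2014543440, 0, 0, 0, 644913360, 0, 0, 0, 637018200, 0, 0, 0, 534282840, 0, 133759080, 0,
      614086200, 0], [0, 202260240, 0, 14157234000, 0, 72510263280, 402992502120, 0, 330492435,
      0, 0, 2496017160, 0, 32760, 0, 6952359960, 0, 0, 0, 2151185400, 0, 0, 0, 2883273120, 0, 0,
      0, 3107613600, 0, 32760, 0, 3562322400, 0], [0, 0, 0, 453398400, 0, 0, 0, 16339059555, 0,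
      23946928200, 0, 1015953120, 0, 32760, 0, 1597312080, 0, 0, 0, 595085400, 0, 0, 49303800,
      684978840, 0, 0, 32760, 758885400, 0, 0, 56609280, 876067920, 0], [0, 0, 0, 381654000, 0,
      0, 0, 24577829640, 58913740080, 0, 338513994, 55941795000, 2274952680, 0, 0, 1936214280, 0,
      53103960, 0, 684651240, 0, 0, 32760, 934610040, 0, 0, 32760, 1096739280, 0, 0, 3079440,
      1261456560, 0], [0, 83308680, 0, 338410800, 0, 0, 0, 16119459720, 0, 80279498754, 0,
      224361163260, 0, 0, 0, 2280521880, 0, 0, 0, 673873200, 0, 0, 0, 817165440, 0, 0, 0,
      777689640, 0, 32497920, 0, 867779640, 0], [0, 276887520, 0, 411236280, 0, 0, 0,
      42128835840, 0, 62385523200, 339127666020, 0, 332511480, 0, 7355209680, 87548577480, 0, 0,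
      0, 3465680400, 0, 0, 0, 4378210200, 0, 0, 0, 4940502840, 0, 65520, 0, 6370837200, 0], [0,
      0, 0, 474168240, 0, 0, 0, 13782132000, 0, 0, 0, 55224610560, 0, 97747362180, 0,
      45441723600, 0, 0, 0, 1499457960, 0, 0, 0, 2186566200, 0, 0, 0, 1974379680, 0, 0, 196560,
      2431119600, 0], [0, 0, 0, 533660400, 0, 0, 0, 20029038120, 0, 0, 0, 80718183000,
      230937040620, 0, 337310064, 292962655440, 0, 32760, 0, 2258965800, 0, 0, 0, 2666893320, 0,
      0, 0, 3210152400, 0, 0, 65520, 4198128480, 0], [0, 32760, 0, 1426075560, 0, 0, 0,
      11599529760, 0, 0, 0, 53102223720, 0, 322203261744, 0, 924469474500, 0, 0, 0, 1565043480,
      0, 32760, 0, 2986794720, 0, 0, 0, 3165893640, 0, 32760, 0, 3759930720, 0], [0, 32760, 0,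
      2380177800, 0, 0, 0, 35717245200, 0, 0, 0, 63290911320, 0, 235762974720, 1328135049540, 0,
      328840460, 0, 0, 1857066120, 0, 32760, 0, 5686841160, 0, 0, 0, 12660527880, 0, 32760, 0,
      16548189840, 0], [0, 0, 0, 190040760, 0, 0, 0, 2638162800, 0, 0, 0, 2610578880, 0, 0, 0,
      9254269700, 0, 22564552140, 0, 343357560, 43210440, 0, 0, 682554600, 0, 0, 0, 1408286880,
      0, 294840, 0, 1405240200, 0], [0, 0, 0, 204651720, 0, 0, 0, 4389971040, 0, 0, 0,
      4326940800, 0, 0, 0, 11804443560, 55394167140, 0, 339467310, 51190874280, 2226238560, 0, 0,
      1847074320, 0, 28599480, 0, 1818999000, 0, 32760, 0, 2530382400, 0], [0, 14643720, 0,
      203537880, 0, 0, 0, 2091365640, 0, 0, 0, 2086812000, 0, 229320, 32760, 10524051720, 0,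
      75497393790, 0, 210391922520, 0, 0, 32760, 1903093920, 0, 0, 0, 906895080, 0, 32760,
      7436520, 1057885920, 0], [0, 45143280, 0, 365798160, 0, 0, 0, 4679798760, 0, 0, 0,
      6590820600, 0, 98280, 32760, 25785396000, 0, 58784412960, 318885835320, 0, 334724880, 0,
      7321401360, 54908773920, 0, 0, 0, 16479131760, 0, 0, 13890240, 26275321800, 0], [0, 0, 0,
      219655800, 0, 0, 0, 834397200, 0, 0, 0, 1889367480, 0, 0, 0, 9716550480, 0, 0, 0,
      54118880760, 0, 91459623060, 0, 26221759200, 0, 0, 0, 7975454760, 0, 32760, 0, 13111141680,
      0], [0, 0, 0, 270564840, 0, 0, 0, 1134675360, 0, 0, 0, 2559440520, 0, 0, 0, 15376790520, 0,
      0, 0, 73665970560, 216841446900, 0, 344332170, 260427225240, 0, 28566720, 0, 9643004280, 0,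
      0, 0, 15715168560, 0], [0, 262538640, 0, 369467280, 0, 0, 0, 826043400, 0, 0, 0,
      1885272480, 0, 117346320, 0, 5917962960, 0, 0, 0, 51352282800, 0, 302691646530, 0,
      858846706380, 0, 0, 0, 8689852080, 0, 210351960, 65520, 10441824120, 0], [0, 98280, 0,
      1102472280, 0, 0, 0, 3338080200, 0, 0, 0, 7626069360, 0, 65520, 0, 61906670280, 0, 0, 0,
      51287155920, 0, 221843545560, 1247031379620, 0, 332175480, 0, 0, 21028119840, 0,
      2484682200, 65520, 101759112000, 0], [0, 0, 0, 129893400, 0, 0, 0, 751809240, 0, 0, 0,
      1532349000, 0, 0, 0, 11087523720, 0, 0, 0, 4519733400, 0, 0, 0, 49178809680, 0,
      79316008200, 0, 4636064160, 2041570440, 32760, 0, 16988385960, 0], [0, 0, 0, 134741880, 0,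
      0, 0, 862570800, 0, 0, 0, 1946730240, 0, 0, 0, 16671072600, 0, 0, 0, 5207038200, 0, 0, 0,
      70093983960, 186700962240, 0, 345760506, 185404106160, 2646057960, 0, 0, 33983848080, 0],
      [0, 21359520, 0, 418312440, 0, 0, 0, 931104720, 0, 0, 0, 2035378800, 0, 11236680, 0,
      8127100800, 0, 0, 0, 5316816960, 0, 0, 0, 48663571320, 0, 256600672146, 0, 716049444240, 0,
      0, 771498000, 19004862240, 0], [0, 7895160, 0, 918295560, 0, 0, 0, 2465255520, 0, 0, 0,
      5108201280, 0, 1310400, 0, 31542540120, 0, 0, 0, 10318220640, 0, 0, 0, 134929267200, 0,
      191737302120, 1074101895360, 0, 336094080, 0, 16346945160, 326563833960, 0], [0, 0, 0,
      248124240, 0, 0, 0, 1054872000, 0, 0, 0, 2136377880, 0, 0, 0, 10542266280, 0, 0, 0,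
      4208677200, 0, 0, 0, 49751694720, 0, 0, 0, 189792382920, 0, 310660169040, 0, 151742026800,
      0], [0, 0, 0, 471547440, 0, 0, 0, 1624502880, 0, 0, 0, 3327564240, 0, 0, 0, 13665932280, 0,
      0, 0, 6286021560, 0, 0, 0, 66331825560, 0, 0, 0, 272113536240, 734423709240, 0, 341652402,
      955812279240, 0], [0, 0, 0, 172579680, 0, 0, 0, 893234160, 0, 0, 0, 2116820160, 0, 0, 0,
      12648439440, 0, 0, 0, 4302338040, 0, 0, 0, 49029762600, 0, 0, 0, 193755481920, 0,
      1023156878562, 0, 2939567726160, 0], [0, 0, 0, 175757400, 0, 0, 0, 980965440, 0, 0, 0,
      2409235920, 0, 0, 0, 29708569800, 0, 0, 0, 4202714880, 0, 0, 0, 40631015880, 0, 0, 0,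
      132452578440, 0, 744873358320, 4227846166440, 0, 0], [0, 0, 0, 410777640, 0, 0, 0,
      1928548440, 0, 0, 0, 4409627040, 0, 0, 0, 180835068960, 0, 0, 0, 6728085000, 0, 0, 0,
      65458476720, 0, 0, 0, 50408893080, 0, 32760, 19305000, 832840238880, 0]] [12310028640,
      17567189640, 12306949200, 34523044920, 12424885200, 17751530160, 12150258120, 66313873080,
      12870585000, 18442864440, 12834811080, 35715607200, 12782788200, 18216099720, 12330438120,
      130216249800, 14582458800, 20797686000, 14580493200, 39432130920, 13898757600, 20137047840,
      13771714320, 84415673160, 16850957760, 23714276040, 16629860520, 51728924520, 19310840640,
      27225132480, 19763845920, 307442051280, 2132960946480] 8 [[106799, 139917, 91757, 277561,
      99994, 143130, 98207, 535805, 104108, 149124, 103815, 288621, 103389, 147267, 99988,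
      1063242, 119203, 169945, 119282, 322974, 113933, 165007, 112911, 691658, 138187, 194409,
      136381, 423961, 158361, 223202, 162072, 2519012, 17475440, -26798662], [65733, 87606,
      49026, 8876, 14748, 9374, 79232, 15649, 22476, 16384, 47303, 16072, 23938, 16133, 182489,
      20591, 29394, 20526, 56188, 19825, 28798, 22081, 125777, 25206, 35474, 25048, 78911, 29553,
      41857, 30516, 484363, 3363707, -5092854], [51165, 12229, 3258, 2979, 4378, -16807, -4337,
      -6286, -4258, -13655, -5053, -9021, -5340, -44131, -5116, -7372, -4929, -15785, -5907,
      -8172, -4043, -19342, -3936, -5591, -3530, -10958, -4224, -6305, -4781, -88910, -621876,
      855656], [216536, 111231, 141804, 108888, 21415, -9271, -15402, -9494, -18159, -3267,
      -5974, 3970, -13278, -1787, -3079, -1628, -3732, -510, -619, 3428, 17568, 3231, 4089, 5724,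
      20391, 7432, 11623, 7168, 127036, 886897, -1612231], [27431, 5195, 18711, -23103, -3810,
      -3890, -2525, -21936, -9260, -12724, -7046, -45550, -5228, -7534, -5325, -13263, -4274,
      -7557, -5981, -13209, -2793, -4050, -2880, -4934, -1463, -3036, -2127, -37558, -262643,
      462362], [28895, -9221, 29961, 916, 4082, 5248, 7103, 3360, 5698, 7505, -8204, -1233,
      -2050, -1239, -1833, 142, -1379, -1383, -16462, -4047, -5994, -3448, -9225, -3123, -4839,
      -4195, -34776, -231340, 251081], [57342, -230320, -41105, -58699, -41058, -108596, -37823,
      -53153, -37184, -159150, -15661, -22460, -15671, -30357, -9106, -13418, -10678, -37685,
      -6534, -9488, -6703, -10612, -2543, -2424, -667, 66471, 486703, 350579], [423815, 89882,
      137640, 87682, 226705, 73245, 106527, 62679, 38973, -6527, -4302, -11347, -28594, -15296,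
      -22971, -12437, -56125, -9710, -16317, -5065, -1001, 2486, 6477, 1194, 21383, 144475,
      -1233471], [28221, -4893, 1264, 31655, 13823, 19848, 11232, -55689, -8510, -11296, -9502,
      -22854, -8541, -12467, -6994, -25214, -4218, -6749, -3348, -3168, 267, 183, -146, 40877,
      289993, -253774], [35393, 259, 2970, -27570, 17545, 12106, -23419, -3584, -4314, -2266,
      -10666, -4129, -5696, -2952, -15242, -2687, -4021, -2658, -2402, 49, -698, -640, 28124,
      206272, -189774], [32869, -25768, -5147, -7761, -8907, -82840, -10338, -13697, -11477,
      -24769, -9096, -13013, -7787, -18706, -2374, -4135, -1422, 3001, 2531, 4346, 2722, 53543,
      373980, -225755], [182804, 75776, 127330, 62399, -132832, -29371, -34933, -35634, -71426,
      -29100, -43142, -28615, -108938, -18667, -29592, -12847, -9005, 4047, 8875, 3342, 30349,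
      182453, -93273], [45536, -17648, 11651, -45803, -4396, -3695, -5470, -11339, -5420, -8224,
      -4718, 8328, 3393, 3784, 5092, 17527, 8186, 12103, 7592, 27987, 156726, -201192], [38060,
      -1195, -25005, -6237, -8201, -7151, -13614, -4875, -7299, -3311, -20545, -3451, -5340,
      -2680, -3202, -11, 403, 124, 6931, 47051, 19548], [110595, -328045, -27646, -37561, -29741,
      -75483, -28350, -40874, -27384, -97935, -17079, -25340, -15508, -18831, -2686, -2890,
      -2659, 69857, 516849, 80711], [610559, 72778, 105322, 72121, 173355, 51800, 87482, 13418,
      425977, 74635, 109425, 54985, 296103, 109624, 148667, 130659, -116577, -1206731, -1213602],
      [26410, -5197, 735, 21135, 9051, 14235, 8972, 72078, 14857, 20352, 15653, 50600, 19643,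
      28319, 19977, 7787, -40116, -284491], [33042, 373, -47383, -51620, -13442, -9965, 56824,
      14502, 21244, 14887, 25079, 6922, 9413, 6923, 13463, 64573, -144835], [29145, -37450,
      -12525, -19144, -14178, 133540, 32585, 44648, 35111, 86304, 31011, 45653, 31475, 24100,
      18048, -428323], [172335, 87542, 107114, 74530, -380728, -92885, -145894, -87194, -137941,
      -27662, -37987, -22842, 81547, 755802, -345737], [45523, -15572, 8509, -37036, -4692,
      -5078, -7327, 6081, 3049, 2937, 5470, 25640, 198236, -225740], [35292, 1988, -7211, -4185,
      -10453, 896, -1162, 3782, 7314, 3353, 9925, 41280, -80819], [101958, 18912, 25451, 36283,
      17274, 143440, 58020, 80874, 69345, -5310, -258446, -287801], [496701, 120450, 151041,
      129581, 422371, 187006, 237607, 187032, -138378, -1798679, 5268], [39430, -18907, 28892,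
      86153, 36195, 93521, 55426, 7488, -258732, -69466], [35779, -14025, -20518, -48798, -3991,
      -12894, 34305, 354540, -324398], [68471, -74037, -3918, -11891, -2045, 22744, 229035,
      -228359], [341467, 160166, 234597, 177340, -84480, -1353147, 524057], [80874, -58044,
      17180, -16595, 95008, -118423], [46444, 5052, 20196, -8247, -63445], [201842, -211402,
      -116691, 126251], [379601, 2709571, -3089172], [268305, -268305]]"
  by code_simp

text \<open>In all five certificates of this kind \<open>D * (sum_list h + s) = e * K\<close> holds
  exactly, so the reserve \<open>e\<close> carries no rounding.\<close>

lemma main_7: "
      check_main [15, 22, 15, 120, 15, 22, 15] 0 10000000 [[0, 9866667, 0, 0, 0, 0, 0, 0],
      [19782029, 0, 100216, 13738909, 0, 0, 0, 0], [3, 18522973, 0, 36634177, 1, 19873, 16473,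
      0], [2207, 5166441, 55093283, 0, 100000, 0, 0, 0], [308, 65073, 1, 1310138, 0, 328498,
      137672, 0], [80781, 0, 0, 2672542, 1741572, 0, 123729, 0], [672, 0, 0, 3015702, 14,
      2172810, 0, 0], [667, 0, 0, 2990463, 103, 2097443, 4911324, 0]] 100000 22400 2 [[553, 110,
      0, 5, 1, 183, 2, 2], [3981, 954, -4732, 49, 107, 1, 1], [109, 801, 567, 561, -363, 15],
      [16515, 2272, 4600, 5041, 4980], [459, 326, -606, -231], [299, 45, -331], [144, -4], [137]]"
  by code_simp

lemma main_15: "
      check_main [14, 20, 14, 45, 14, 20, 14, 297, 14, 20, 14, 45, 14, 20, 14] 0 100000000 [[0,
      24486447, 8057797, 16281846, 0, 0, 3, 4543, 0, 0, 0, 905, 0, 0, 0, 0], [119570472, 0,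
      6508051, 104180044, 0, 0, 3, 4826, 0, 0, 0, 955, 0, 0, 0, 0], [16668386, 122191701, 0,
      314932101, 0, 0, 3, 4573, 0, 0, 0, 898, 0, 0, 0, 0], [12580984, 83586203, 439231814, 0,
      10000, 0, 3, 151239525, 0, 0, 0, 14875, 0, 0, 0, 0], [11, 0, 0, 60636243, 0, 86948398, 0,
      59956449, 0, 0, 0, 62929, 0, 0, 0, 0], [11, 0, 0, 86421253, 207303884, 0, 10000, 292025800,
      0, 0, 0, 160536, 0, 0, 0, 0], [16, 0, 0, 60915624, 0, 287034861, 0, 847556548, 0, 0, 0,
      80508, 0, 0, 0, 0], [5766, 0, 0, 43006521, 0, 211456957, 1195577541, 0, 10000, 0, 0,
      196705, 0, 0, 0, 0], [289, 0, 0, 7420, 119473, 0, 0, 4714480, 0, 3444164, 0, 15044, 5449,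
      3, 5128, 0], [413, 0, 0, 6009, 170671, 0, 0, 6843563, 8301450, 0, 10000, 8046541, 92336, 3,
      19493, 0], [291, 0, 0, 35930, 1, 280769, 0, 4537783, 0, 11487368, 0, 31638206, 0, 0, 0, 0],
      [1367, 0, 0, 44844, 1, 200496, 0, 23213094, 0, 8558947, 47970348, 0, 10000, 0, 0, 0], [513,
      0, 0, 44431, 0, 0, 1, 8638186, 0, 0, 0, 5730594, 0, 10160, 519264, 0], [923, 0, 0, 50381,
      0, 1, 1, 15708750, 0, 0, 0, 10383813, 10068048, 0, 10355, 0], [1037, 0, 0, 50370, 0, 1, 1,
      17683006, 0, 0, 0, 11689514, 4761611, 12939680, 0, 0], [1062, 0, 0, 50387, 0, 1, 1,
      18122364, 0, 0, 0, 11977074, 5705, 23272426, 46570980, 0]] 1000000 57900 2 [[12332, -5139,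
      -4905, -2286, -2, -2, -2, -6, 0, 0, 0, 0, 0, 0, 0, 0], [4211, -4109, -93, -7, -10, -7, -20,
      -1, -1, -1, 1, 1, 1, 1, 1], [4822, -4804, -11, -16, -11, -35, -1, -2, -1, 1, 1, 2, 2, 2],
      [1147, 953, -147, 3106, -2628, 8, -24, 225, 328, 348, 401, 403, 403], [2846, -2653, 62,
      -533, -29, -35, -108, -108, -61, -71, -72, -72], [588, 187, -139, -1, -22, 114, 156, 193,
      216, 215, 214], [5878, -5176, 24, 50, 19, -65, -163, -187, -188, -189], [84772, 4095, 5938,
      4118, 19863, 7351, 13341, 15013, 15384], [512, -354, 68, 1198, 502, 985, 1142, 1196], [376,
      -31, -504, -902, -393, -250, -99], [1076, -980, -44, 21, 42, 49], [1477, 352, 1090, 1325,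
      1385], [3918, -147, -1377, -2286], [438, -360, 912], [2148, -1716], [683]]"
  by code_simp

text \<open>Up to this length all points are genuine (\<open>s = 0\<close>), and the form has 32
  vectors.\<close>

lemma main_31: "
      check_main [14, 20, 14, 39, 14, 20, 14, 82, 14, 20, 14, 39, 14, 20, 14, 723, 14, 20, 14,
      39, 14, 20, 14, 82, 14, 20, 14, 39, 14, 20, 14] 0 10000000000 [[0, 3485273443, 666211804,
      614517206, 76920854, 91635199, 86718493, 93139372, 4, 18, 35, 26709, 19, 19013, 514, 16003,
      0, 1, 1, 5, 1, 2, 2, 6, 1, 2, 2, 2, 2, 2, 2, 0], [11918622725, 0, 1341725812, 7802833267,
      108266921, 154958762, 179333093, 281932480, 4, 18, 35, 25466, 19, 18177, 515, 15257, 0, 1,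
      1, 5, 1, 2, 2, 6, 1, 2, 2, 2, 2, 2, 2, 0], [1399786399, 12773439318, 0, 27145038477,
      105564264, 167077501, 199129418, 285901557, 4, 18, 35, 27036, 19, 19255, 525, 16198, 0, 1,
      1, 5, 1, 2, 2, 6, 1, 2, 2, 2, 2, 2, 2, 0], [1279224346, 5156428559, 39295646534, 0,
      107711497, 231526039, 511489338, 12908081674, 4, 18, 35, 35465, 19, 25671, 529, 21247, 0,
      1, 1, 5, 1, 2, 2, 6, 1, 2, 2, 2, 2, 2, 2, 0], [116770596, 80770299, 156903845, 7087917430,
      0, 9659129740, 1096149779, 5588812746, 4, 18, 35, 29444, 19, 20403, 527, 17640, 0, 1, 1, 5,
      1, 2, 2, 6, 1, 2, 2, 2, 2, 2, 2, 0], [134612334, 93811939, 179058903, 9721431459,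
      22657833642, 0, 779876743, 30898890527, 4, 18, 36, 31877, 19, 22275, 535, 19097, 0, 1, 1,
      5, 1, 2, 2, 6, 1, 2, 2, 2, 2, 2, 2, 0], [146511583, 111077435, 250640041, 5923340359,
      336512122, 31603458457, 0, 90520969382, 4, 18, 36, 36003, 19, 25212, 545, 21569, 0, 1, 1,
      5, 1, 2, 2, 6, 1, 2, 2, 2, 2, 2, 2, 0], [118828765, 86928183, 185810519, 1195110525,
      393711417, 22557801916, 126039893974, 0, 1000004, 18, 36, 5272957880, 19, 158072336, 566,
      12926942106, 0, 1, 1, 5, 1, 2, 2, 6, 1, 2, 2, 2, 2, 2, 2, 0], [1001, 1, 2, 2, 4, 5, 13,
      4003345011, 0, 5506083102, 13, 874829590, 87568955, 108, 32, 2529823403, 0, 1, 1, 33709, 1,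
      2, 3, 1753, 8, 9, 9, 10, 11, 12, 14, 0], [1001, 1, 2, 2, 4, 5, 13, 5688499486, 13000658680,
      0, 1000013, 14324231864, 126446816, 108, 32, 3568238811, 0, 1, 1, 57954, 1, 2, 3, 1787, 8,
      9, 9, 10, 11, 12, 14, 0], [1007, 8, 9, 11, 19, 27, 66, 3812436421, 5, 17977195601, 0,
      50941430643, 10, 61, 34531654, 2233335609, 0, 1, 1, 3, 1, 2, 2, 4, 2, 2, 2, 2, 2, 2, 3, 0],
      [1007, 8, 9, 11, 19, 27, 66, 6995896629, 5, 13225779898, 74997930502, 0, 1000010, 61,
      812087682, 31491145217, 0, 1, 1, 3, 1, 2, 2, 4, 2, 2, 2, 2, 2, 2, 3, 0], [1003, 3, 4, 4, 8,
      11, 26, 1918437367, 7, 18, 14, 13616085420, 0, 21698003814, 43, 14403588866, 0, 1, 1, 456,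
      1, 3, 4, 513, 3, 3, 3, 3, 4, 4, 5, 0], [1003, 3, 4, 5, 9, 12, 30, 2710708595, 6, 16, 14,
      19476732811, 51416194433, 0, 1000042, 71923043288, 0, 1, 1, 3388648, 1, 3, 4, 2022, 3, 3,
      3, 3, 4, 4, 5, 0], [1008, 7, 9, 10, 19, 26, 64, 1877567364, 5, 31, 37, 13563645462, 18,
      71585819966, 0, 210118330099, 0, 1, 1, 4, 1, 2, 2, 5, 2, 2, 2, 2, 2, 2, 3, 0], [15270, 7,
      9, 10, 18, 26, 62, 1352437998, 5, 32, 37, 9453711138, 18, 52080559531, 296221554049, 0,
      1000000, 1, 1, 4, 1, 2, 2, 5, 2, 2, 2, 2, 2, 2, 3, 0], [1280, 1, 1, 1, 1, 2, 2, 4, 27919,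
      6, 3, 9, 2084878, 6, 5, 193931284, 0, 138101594, 0, 2, 1, 2, 1, 3, 3, 3, 3, 4, 4, 4, 4, 0],
      [1401, 1, 1, 1, 1, 2, 2, 3, 16, 5, 3, 9, 2822059, 6, 5, 277518554, 333147030, 0, 1000000,
      320776997, 6228623, 11, 2, 466188, 251674, 207, 340, 127, 175, 159, 229, 0], [1281, 1, 2,
      2, 3, 4, 8, 20, 24, 18465, 14, 51, 22, 4599965, 13722, 191357878, 0, 459880120, 0,
      1267708856, 0, 1, 4, 1327475, 31, 33, 32, 39, 36, 40, 44, 0], [1833, 1, 2, 2, 3, 4, 8, 20,
      25, 59129, 14, 49, 22, 3863347, 45246416, 532888875, 0, 344232091, 1923908147, 0, 1000000,
      1, 4, 434935570, 21352833, 6576259, 286, 17088093, 139, 177, 182, 0], [1312, 5, 5, 6, 8, 9,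
      11, 13, 4, 9, 12, 34, 20, 24, 21, 215728206, 0, 0, 0, 341512696, 0, 543425284, 2,
      196692712, 11719694, 449, 7591923, 216, 2119938, 969, 5148, 0], [49632, 243, 103, 74, 41,
      35, 29, 26, 3, 11, 20, 66, 17, 56, 47, 302953686, 0, 0, 0, 455956649, 1311570080, 0,
      1000002, 1606117555, 23365156, 448, 12450381, 205, 3482676, 946, 3567, 0], [6948, 2668,
      2207, 1960, 1544, 1490, 1413, 1369, 4, 21, 50, 3575, 15, 183, 30925468, 183509475, 0, 1, 1,
      327937207, 1, 1819469181, 0, 5354157818, 1, 1, 1, 1, 1, 1, 2, 0], [19053, 424, 203, 150,
      89, 78, 66, 60, 4, 12, 22, 149, 22, 849, 153, 1772911854, 0, 1, 1, 391461908, 1,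
      1354057216, 7715022530, 0, 1000001, 1, 1, 1, 1, 1, 1, 0], [1462, 3, 3, 4, 6, 7, 12, 19, 5,
      19, 15, 48, 18, 64, 61, 321848031, 0, 1, 1, 27056065, 1, 3, 3, 168330118, 0, 38107003,
      35740221, 1398, 833, 848, 1080, 0], [1672, 3, 4, 4, 7, 8, 14, 25, 5, 20, 17, 62, 19, 76,
      68, 469034970, 0, 1, 1, 26986288, 1, 3, 3, 260643637, 533390075, 0, 1001285, 347157888,
      42845775, 9202809, 29303, 0], [1499, 3, 3, 4, 6, 7, 12, 19, 5, 20, 16, 48, 17, 64, 66,
      347626875, 0, 1, 1, 21887736, 1, 3, 3, 190823298, 1240, 912308188, 0, 1755138978, 41987265,
      46716, 7756927, 0], [2850, 3, 3, 4, 6, 8, 13, 24, 6, 21, 17, 60, 19, 73, 67, 1294937771, 0,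
      1, 1, 42022452, 1, 3, 3, 760138277, 1362, 733262272, 3220782474, 0, 1000943, 1110, 1468,
      0], [1759, 3, 3, 4, 6, 8, 12, 21, 5, 20, 16, 53, 18, 68, 66, 529887664, 0, 1, 1, 24044072,
      1, 3, 3, 302493350, 1475, 14170, 3351, 539544129, 0, 1129455, 192880448, 0], [2427, 3, 3,
      4, 6, 8, 12, 21, 5, 20, 16, 53, 18, 68, 67, 998691790, 0, 1, 1, 25728564, 1, 3, 3,
      594577022, 1306, 9009, 2809, 1032770072, 1043167600, 0, 1220541, 0], [2609, 3, 3, 4, 6, 8,
      12, 21, 5, 20, 16, 53, 18, 68, 67, 1126288752, 0, 1, 1, 27801780, 1, 3, 3, 672058766, 1240,
      8190, 2965, 1164979693, 454431027, 1337726489, 0, 0], [2651, 3, 3, 4, 6, 8, 12, 21, 5, 20,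
      16, 53, 18, 68, 67, 1155588166, 0, 1, 1, 26791439, 1, 3, 3, 691706922, 1223, 7762, 2901,
      1195470418, 963718, 2348061673, 4581402814, 0]] 100000000 142700 1 [[171842, -57502,
      -42321, -42536, -11941, -11570, -4615, -1342, -3, -4, -3, -5, -1, -2, -1, 0, 0, 0, 0, 0, 0,
      1, 0, 0, 0, 0, 0, 0, 0, 0, 0, 0], [131059, 68910, -129823, -30295, -32338, -8511, 1020, -4,
      -6, -4, -8, -2, -2, -1, 0, 0, 0, 0, 0, 0, 4, 1, 2, 0, 0, 0, 0, 0, 0, 0, 0], [153523,
      -128413, -11817, -12965, -1966, 1646, -2, -2, -2, -3, -1, -1, 0, 0, 0, 0, 0, 0, 0, 1, 0, 0,
      0, 0, 0, 0, 0, 0, 0, 0], [152118, 50167, 47314, 8748, -258302, -9, -13, -9, -18, -5, -6,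
      -2, 1, 0, 0, 0, 0, 0, 11, 2, 4, 0, 0, 0, 1, 0, 1, 1, 1], [72924, -35277, 4334, -41962, -2,
      -3, -2, -5, -1, -1, -1, -1, 0, 0, 0, 0, 0, -1, 0, 0, 0, 0, 0, 0, 0, 0, 0, 0], [78969,
      61935, -140876, -4, -6, -4, -8, -2, -3, -1, 0, 0, 0, 0, 0, 0, 2, 1, 1, 0, 0, 0, 0, 0, 0, 0,
      0], [132628, -132619, -2, -3, -2, -4, -1, -1, -1, 0, 0, 0, 0, 0, 0, 2, 0, 1, 0, 0, 0, 0, 0,
      0, 0, 0], [279289, 55879, 75912, 31289, -106258, -80681, -116282, -81983, -57095, 0, 1, 0,
      1, 0, 19, 6, 7, 1, 1, 1, 1, 1, 1, 1, 1], [30090, -29047, 16381, -16789, -6962, 5784, 500,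
      -146, -7, -12, -9, -8, -1, -23, -7, -9, -1, -1, -1, -1, -1, -1, -1, -1], [8551, -3140,
      -258, -58883, 49035, 4168, -971, -43, -115, -71, -33, -8, -187, -52, -75, -5, -6, -6, -11,
      -7, -9, -10, -10], [61560, -61470, 123, -101, -1511, 1401, 3, -3, 1, 7, 0, -7, -2, -3, 0,
      0, 0, 0, 0, 0, 0, 0], [3130, 5638, -4213, -2481, 3997, 211, -102, 101, 496, 15, 663, 264,
      265, 20, 23, 21, 39, 25, 33, 36, 37], [29491, -27526, 30925, -36030, 22, -20, -157, -147,
      -17, -444, -134, -177, -13, -15, -13, -25, -16, -21, -23, -23], [3870, -12550, 14999, 282,
      -230, -221, 708, 10, 655, 227, 260, 20, 23, 21, 39, 24, 33, 36, 36], [148066, -143880, 124,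
      120, 237, 897, 5, 177, 475, 71, 5, 6, 5, 10, 6, 9, 9, 10], [1888082, 37027, 52951, 37035,
      110091, 40733, 57211, 40607, 334758, 60770, 88562, 65638, 244505, 100052, 188569, 212662,
      218194], [4964, -4505, 134, -465, 380, 474, -502, 3111, 567, 827, 613, 2287, 935, 1763,
      1989, 2041], [3335, -88, -8718, -10206, -1274, -3859, 1458, 577, 1391, 1032, 3848, 1575,
      2969, 3349, 3437], [9925, -11149, -876, -1138, -1243, 582, 230, 340, 252, 939, 384, 724,
      817, 838], [47115, 25703, 29659, 22465, -12855, -6081, -8486, -5043, -23297, -6684, -18625,
      -21378, -22467], [9432, -7368, -202, -297, 266, -11, 28, -440, -2192, -121, -15, 154],
      [4182, 208, 12, -7908, -2991, 1035, 1381, -4334, 2665, 2972, 2992], [4360, -1946, 26547,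
      16843, 8933, -6798, -6330, -12648, -14281, -14676], [2513, -4933, -3046, -1575, 1691, 1484,
      2671, 3017, 3102], [18501, -5687, -27760, -6733, 773, 6891, 7773, 7972], [25174, 47567,
      4467, -21153, -17948, -18170, -18636], [6529, -275, 33458, -9310, -18017, -12360], [2635,
      -15178, 7359, 4345, 4563], [35347, -8995, -9864, -14183], [15546, -15447, 38], [28827,
      -28284], [6169]]"
  by code_simp

text \<open>The list \<open>h\<close> ends with the long step 164.0. The correction
  \<open>s = 826\<close> is the total stepsize of the absorbed second half in tenths; it restores
  the full sum of the pattern, to which the decrease is proportional.\<close>

lemma main_63: "
      check_main [14, 20, 14, 39, 14, 20, 14, 72, 14, 20, 14, 39, 14, 20, 14, 142, 14, 20, 14,
      39, 14, 20, 14, 72, 14, 20, 14, 39, 14, 20, 14, 1640] 826 10000000 [[0, 300150, 96, 856535,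
      2, 3, 5, 24026, 0, 0, 0, 1, 0, 1, 1, 249811, 0, 0, 0, 0, 0, 0, 0, 0, 0, 0, 0, 0, 0, 0, 0,
      0, 0], [11392754, 0, 330732, 7778258, 2, 3, 5, 8214, 0, 0, 0, 1, 0, 1, 1, 248254, 0, 0, 0,
      0, 0, 0, 0, 0, 0, 0, 0, 0, 0, 0, 0, 0, 0], [37134, 19458013, 0, 32008252, 2, 3, 5, 59, 0,
      0, 0, 1, 0, 1, 1, 247727, 0, 0, 0, 0, 0, 0, 0, 0, 0, 0, 0, 0, 0, 0, 0, 0, 0], [56, 57,
      51420360, 0, 300002, 4, 7, 11781007, 0, 0, 0, 1, 0, 1, 1, 228710, 0, 0, 0, 0, 0, 0, 0, 0,
      0, 0, 0, 0, 0, 0, 0, 0, 0], [2, 1, 2, 8875745, 0, 11007376, 19, 5520769, 0, 0, 0, 3, 1, 2,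
      1, 239420, 0, 0, 0, 0, 0, 0, 0, 0, 0, 0, 0, 0, 0, 0, 0, 0, 0], [2, 1, 2, 8993047, 25343322,
      0, 300019, 28483934, 0, 0, 0, 3, 1, 2, 1, 211548, 0, 0, 0, 0, 0, 0, 0, 0, 0, 0, 0, 0, 0, 0,
      0, 0, 0], [3, 2, 5, 5218366, 3, 44273094, 0, 96881988, 0, 0, 0, 2, 0, 1, 1, 199345, 0, 0,
      0, 0, 0, 0, 0, 0, 0, 0, 0, 0, 0, 0, 0, 0, 0], [2, 1, 1, 3, 6, 8051397, 146272744, 0,
      300000, 0, 0, 5, 1, 2, 1, 14560221, 0, 0, 0, 0, 0, 0, 0, 0, 0, 0, 0, 0, 0, 0, 0, 0, 0], [1,
      0, 0, 0, 0, 0, 0, 5875363, 0, 6648871, 1, 57593, 0, 48992, 6, 3379475, 0, 0, 0, 0, 0, 0, 0,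
      0, 0, 0, 0, 0, 0, 0, 0, 0, 0], [1, 0, 0, 0, 0, 0, 0, 7577265, 15710302, 0, 300001,
      16384950, 0, 847153, 6, 3543785, 0, 0, 0, 0, 0, 0, 0, 0, 0, 0, 0, 0, 0, 0, 0, 0, 0], [1, 0,
      0, 0, 0, 0, 1, 5924998, 0, 21224780, 0, 59315103, 0, 3, 422379, 3162249, 0, 0, 0, 0, 0, 0,
      0, 0, 0, 0, 0, 0, 0, 0, 0, 0, 0], [1, 0, 0, 0, 0, 0, 1, 4603494, 0, 16489811, 89749511, 0,
      300000, 3, 3931412, 28216932, 0, 0, 0, 0, 0, 0, 0, 0, 0, 0, 0, 0, 0, 0, 0, 0, 0], [1, 0, 0,
      0, 1, 1, 2, 1601878, 0, 0, 0, 18459297, 0, 25329924, 1, 15708202, 0, 0, 0, 0, 0, 0, 0, 0,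
      0, 0, 0, 0, 0, 0, 0, 0, 0], [1, 0, 0, 0, 1, 1, 2, 901388, 0, 0, 0, 28913826, 60799304, 0,
      300001, 80222484, 0, 0, 0, 0, 0, 0, 0, 0, 0, 0, 0, 0, 0, 0, 0, 0, 0], [1, 0, 0, 0, 0, 0, 0,
      1, 0, 1, 1, 20160378, 0, 90836946, 0, 244460521, 0, 0, 0, 0, 0, 0, 0, 0, 0, 0, 0, 0, 0, 0,
      0, 0, 0], [1, 0, 0, 0, 0, 0, 0, 0, 0, 0, 0, 1, 0, 54073976, 350804036, 0, 300000, 0, 0,
      3223494, 0, 0, 0, 14784140, 0, 0, 0, 3773088, 0, 0, 0, 3885597, 0], [1, 0, 0, 0, 0, 0, 0,
      0, 0, 0, 0, 0, 0, 0, 0, 2794492, 0, 3900605, 0, 302680, 69695, 0, 0, 1437548, 736, 0, 0,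
      442617, 283, 0, 0, 405750, 0], [1, 0, 0, 0, 0, 0, 0, 0, 0, 0, 0, 0, 0, 0, 0, 3960521,
      9054407, 0, 300000, 8608827, 464958, 0, 0, 2235412, 4951, 0, 0, 545096, 1915, 0, 0, 591485,
      0], [1, 0, 0, 0, 0, 0, 0, 0, 0, 0, 0, 0, 0, 0, 0, 2783082, 0, 12201135, 0, 34741802, 0, 0,
      18, 1488711, 0, 0, 0, 427916, 0, 0, 26, 401711, 0], [1, 0, 0, 0, 0, 0, 0, 0, 0, 0, 0, 0, 0,
      0, 0, 6910483, 0, 9665833, 51744402, 0, 300000, 0, 1417425, 17105745, 0, 0, 0, 1857737, 0,
      0, 155, 2477097, 0], [1, 0, 0, 0, 0, 0, 0, 0, 0, 0, 0, 0, 0, 0, 0, 2390322, 0, 0, 0,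
      8344316, 0, 14742973, 0, 8270231, 0, 0, 0, 712428, 0, 0, 0, 1053262, 0], [1, 0, 0, 0, 0, 0,
      0, 0, 0, 0, 0, 0, 0, 0, 0, 3403460, 0, 0, 0, 11690488, 34678880, 0, 300000, 46010503, 0,
      92, 0, 1150595, 0, 0, 0, 1495242, 0], [1, 0, 0, 0, 0, 0, 0, 0, 0, 0, 0, 0, 0, 0, 0,
      2430290, 0, 0, 0, 7937688, 0, 48449838, 0, 140343980, 0, 0, 0, 651784, 0, 14425, 0,
      1007779, 0], [1, 0, 0, 0, 0, 0, 0, 0, 0, 0, 0, 0, 0, 0, 0, 5305171, 0, 0, 0, 9000563, 0,
      35536450, 199118342, 0, 300000, 0, 0, 13894629, 0, 486034, 0, 24849082, 0], [1, 0, 0, 0, 0,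
      0, 0, 0, 0, 0, 0, 0, 0, 0, 0, 825590, 0, 0, 0, 840988, 0, 0, 0, 7177283, 0, 12731226, 0,
      2536295, 344184, 0, 0, 5396076, 0], [1, 0, 0, 0, 0, 0, 0, 0, 0, 0, 0, 0, 0, 0, 0, 1174466,
      0, 0, 0, 1126939, 0, 0, 0, 10306866, 29545956, 0, 300000, 32819741, 544745, 0, 0, 7767722,
      0], [1, 0, 0, 0, 0, 0, 0, 0, 0, 0, 0, 0, 0, 0, 0, 839796, 0, 0, 0, 901195, 0, 0, 0,
      7039424, 0, 40481807, 0, 115203637, 0, 0, 121237, 5299963, 0], [1, 0, 0, 0, 0, 0, 0, 0, 0,
      0, 0, 0, 0, 0, 0, 1416566, 0, 0, 0, 1894082, 0, 0, 0, 14333909, 0, 30373311, 169587060, 0,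
      300000, 0, 2789136, 71490178, 0], [1, 0, 0, 0, 0, 0, 0, 0, 0, 0, 0, 0, 0, 0, 0, 411879, 0,
      0, 0, 695412, 0, 0, 0, 4364790, 0, 0, 0, 28863593, 0, 49048042, 0, 33287407, 0], [1, 0, 0,
      0, 0, 0, 0, 0, 0, 0, 0, 0, 0, 0, 0, 578573, 0, 0, 0, 952625, 0, 0, 0, 6185019, 0, 0, 0,
      41044064, 115479997, 0, 300000, 162952526, 0], [2, 0, 0, 0, 0, 0, 0, 0, 0, 0, 0, 0, 0, 0,
      0, 490564, 0, 0, 0, 687431, 0, 0, 0, 4530887, 0, 0, 0, 28635370, 0, 160852866, 0,
      472305046, 0], [323, 0, 0, 0, 0, 0, 0, 0, 0, 0, 0, 0, 0, 0, 0, 229441, 0, 0, 0, 499138, 0,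
      0, 0, 2833248, 0, 0, 0, 19538530, 0, 117091438, 664291612, 0, 0], [331, 0, 0, 0, 0, 0, 0,
      0, 0, 0, 0, 0, 0, 0, 0, 20953, 0, 0, 0, 31210, 0, 0, 0, 42576, 0, 0, 0, 87123, 0, 0, 0,
      9817807, 0]] 10000000 3292 4 [[3317, 752, -591, -725, -144, -206, -144, -687, -132, -188,
      -132, -367, -132, -188, -132, -94, 0, 0, 0, 0, 0, 0, 0, 0, 0, 0, 0, 0, 0, 0, 0, 0, 0],
      [2634, 3942, -3958, -129, -184, -129, -656, -127, -182, -127, -355, -127, -182, -127, -91,
      0, 0, 0, 0, 0, 0, 0, 0, 0, 0, 0, 0, 0, 0, 0, 0, 0], [726, -456, -14, -19, -14, -68, -13,
      -19, -13, -37, -13, -19, -13, -9, 0, 0, 0, 0, 0, 0, 0, 0, 0, 0, 0, 0, 0, 0, 0, -1, -1],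
      [4779, 2126, 353, -570, -4166, -210, -301, -210, -586, -210, -301, -210, -150, 0, 0, 0, 0,
      0, 0, 0, 0, 0, 0, 0, 0, 0, 0, 0, 1, 1], [895, -619, 252, -429, -8, -12, -8, -23, -8, -12,
      -8, -6, 0, 0, 0, 0, 0, 0, 0, 0, 0, 0, 0, 0, 0, 0, 0, -1, -1], [3564, 5078, -7436, -99,
      -141, -99, -275, -99, -141, -99, -71, 0, 0, 0, 0, 0, 0, 0, 0, 0, 0, 0, 0, 0, 0, 0, 0, 0],
      [613, -591, -2, -2, -2, -4, -2, -2, -2, -1, 0, 0, 0, 0, 0, 0, 0, 0, 0, 0, 0, 0, 0, 0, 0, 1,
      1], [9018, 1984, 2192, 2068, -4468, -1647, -3545, -3024, -2160, 0, 0, 0, 0, 0, 0, 0, 0, 0,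
      0, 0, 0, 0, 0, 0, 1, 1], [684, -562, 114, -163, -24, -37, -5, -3, 0, 0, 0, 0, 0, 0, 0, 0,
      0, 0, 0, 0, 0, 0, 0, -1, -1], [409, 42, -1014, -508, -230, 730, 521, 0, 0, 0, 0, 0, 0, 0,
      0, 0, 0, 0, 0, 0, 0, 0, -3, -3], [730, -1063, -174, -225, 101, 589, 0, 0, 0, 0, 0, 0, 0, 0,
      0, 0, 0, 0, 0, 0, 0, -1, -1], [4355, 2246, 2794, 1350, -10090, 0, 0, 0, 0, 0, 0, 0, 0, 0,
      0, 0, 0, 0, 0, 0, 0, 0], [958, -787, 82, -239, 0, 0, 0, 0, 0, 0, 0, 0, 0, 0, 0, 0, 0, 0, 0,
      0, 0], [1972, 4474, -6177, 0, 0, 0, 0, 0, 0, 0, 0, 0, 0, 0, 0, 0, 0, 0, 1, 1], [1163,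
      -1124, 0, 0, 0, 0, 0, 0, 0, 0, 0, 0, 0, 0, 0, 0, 0, 1, 1], [2938, 278, 403, 342, 199, 56,
      17, 281, 43, 75, 79, 155, -97, -1, -57, 441, -359, 124], [535, -333, 227, 320, 146, 438,
      323, -317, -116, -165, -109, -50, 20, 26, 48, -10, 5], [565, -36, -203, -871, 354, 278, 97,
      -6, 6, 15, -18, -1, -1, 53, -42, 9], [409, 8, 104, 165, 89, 41, -16, -20, -24, 72, 33, 53,
      -11, 57, -15], [1631, 790, 1074, 751, -1101, -302, -606, -134, -365, 115, 51, 280, -62,
      118], [759, -510, 207, -264, 98, 156, 112, 62, -4, -1, 17, -17, 0], [469, -5, 8, -77, -124,
      -71, -19, 26, 34, -20, 58, -1], [2022, -1371, 105, 147, 91, 148, 27, 53, -34, 88, -17],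
      [2521, 554, 808, 610, -75, -149, -349, 987, -985, 359], [772, -601, 587, -473, -230, 294,
      76, 50, -5], [515, -184, 101, -1045, 712, 134, 18, 17], [1279, -1036, 110, 109, -66, 180,
      -38], [1327, 814, 648, 2428, -837, 620], [1258, -993, 123, -507, -98], [510, 351, 93, 152],
      [2883, -3357, -581], [44696, 45566], [478]]"
  by code_simp

text \<open>The common weight \<open>c\<close> sets the scale of the rank-one factors. A large one,
  here 2048, keeps their integers short at the price of coarser rounding, which the diagonally
  dominant remainder absorbs.\<close>

lemma main_127: "
      check_main [14, 20, 14, 39, 14, 20, 14, 72, 14, 20, 14, 39, 14, 20, 14, 126, 14, 20, 14,
      39, 14, 20, 14, 72, 14, 20, 14, 39, 14, 20, 14, 235, 14, 20, 14, 39, 14, 20, 14, 72, 14,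
      20, 14, 39, 14, 20, 14, 126, 14, 20, 14, 39, 14, 20, 14, 72, 14, 20, 14, 39, 14, 20, 14,
      3700] 1855 1000000000 [[0, 64830803, 177787, 78016379, 1793, 3486, 5256, 8210348, 229,
      1030, 851, 1710, 838, 1780, 1542, 8019148, 14, 79, 78, 835, 70, 371, 162, 558, 68, 321,
      167, 572, 188, 404, 442, 6030150, 0, 1, 0, 0, 0, 0, 0, 0, 0, 0, 0, 0, 0, 0, 0, 0, 0, 0, 0,
      0, 0, 0, 0, 0, 0, 0, 0, 0, 0, 0, 0, 0, 0], [1164639505, 0, 64915296, 770621625, 1798, 4331,
      6955, 6370601, 222, 957, 873, 1897, 889, 1963, 1619, 8020629, 14, 81, 81, 773, 67, 369,
      167, 516, 64, 298, 171, 536, 177, 393, 447, 6027359, 0, 1, 0, 0, 0, 0, 0, 0, 0, 0, 0, 0, 0,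
      0, 0, 0, 0, 0, 0, 0, 0, 0, 0, 0, 0, 0, 0, 0, 0, 0, 0, 0, 0], [288739, 1955691788, 0,
      3201811048, 1794, 3913, 6089, 5365572, 225, 1002, 868, 1812, 866, 1880, 1585, 8024277, 14,
      80, 79, 809, 68, 372, 165, 540, 66, 312, 169, 557, 182, 399, 445, 6030126, 0, 1, 0, 0, 0,
      0, 0, 0, 0, 0, 0, 0, 0, 0, 0, 0, 0, 0, 0, 0, 0, 0, 0, 0, 0, 0, 0, 0, 0, 0, 0, 0, 0],
      [75732, 83492, 5112124043, 0, 30001823, 4781, 7896, 1187327870, 220, 960, 895, 1982, 903,
      2042, 1656, 3074801, 14, 82, 81, 771, 66, 372, 169, 515, 63, 297, 173, 536, 175, 393, 450,
      6035812, 0, 1, 0, 0, 0, 0, 0, 0, 0, 0, 0, 0, 0, 0, 0, 0, 0, 0, 0, 0, 0, 0, 0, 0, 0, 0, 0,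
      0, 0, 0, 0, 0, 0], [1660, 1133, 2712, 877491525, 0, 1062934415, 20955, 560653635, 210,
      2220, 2426, 3561, 706, 3152, 3000, 5722813, 13, 77, 83, 1635, 72, 572, 194, 1091, 72, 453,
      194, 959, 208, 531, 532, 6035294, 0, 1, 0, 1, 0, 0, 0, 0, 0, 0, 0, 0, 0, 0, 0, 0, 0, 0, 0,
      0, 0, 0, 0, 0, 0, 0, 0, 0, 0, 0, 0, 0, 0], [1661, 1134, 2712, 889701753, 2482849019, 0,
      30020951, 2826614232, 210, 2214, 2419, 3548, 706, 3136, 2983, 1731058, 13, 77, 83, 1630,
      72, 572, 194, 1089, 72, 452, 194, 957, 208, 531, 532, 5903845, 0, 1, 0, 1, 0, 0, 0, 0, 0,
      0, 0, 0, 0, 0, 0, 0, 0, 0, 0, 0, 0, 0, 0, 0, 0, 0, 0, 0, 0, 0, 0, 0, 0], [3111, 2230, 5923,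
      521093732, 3680, 4275128544, 0, 9493411136, 204, 1118, 1319, 2831, 812, 2453, 1901, 7688,
      13, 83, 86, 853, 64, 439, 191, 591, 60, 317, 192, 609, 172, 430, 500, 5849236, 0, 1, 0, 1,
      0, 0, 0, 0, 0, 0, 0, 0, 0, 0, 0, 0, 0, 0, 0, 0, 0, 0, 0, 0, 0, 0, 0, 0, 0, 0, 0, 0, 0],
      [1270, 814, 1534, 3732, 6184, 898754012, 14265429481, 0, 30000206, 1864, 2880, 6879, 805,
      5185, 3852, 1432364278, 13, 82, 89, 1338, 66, 573, 211, 893, 63, 390, 207, 834, 186, 508,
      554, 4458039, 0, 1, 0, 1, 0, 0, 0, 0, 0, 0, 0, 0, 0, 0, 0, 0, 0, 0, 0, 0, 0, 0, 0, 0, 0, 0,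
      0, 0, 0, 0, 0, 0, 0], [191, 86, 100, 113, 170, 252, 590, 592132792, 0, 634008608, 709,
      4667059, 8874, 142058, 3426, 322359689, 13, 109, 114, 2331, 59, 413, 215, 1560, 70, 428,
      200, 1653, 257, 719, 641, 5631357, 0, 1, 0, 1, 0, 0, 0, 0, 0, 0, 0, 0, 0, 0, 0, 0, 0, 0, 0,
      0, 0, 0, 0, 0, 0, 0, 0, 0, 0, 0, 0, 0, 0], [194, 87, 101, 114, 171, 253, 591, 762359755,
      1528960306, 0, 30000687, 1541521840, 3865032, 151860323, 3098, 301888335, 13, 110, 114,
      2138, 59, 386, 208, 1430, 72, 428, 196, 1515, 257, 712, 625, 5654606, 0, 1, 0, 1, 0, 0, 0,
      0, 0, 0, 0, 0, 0, 0, 0, 0, 0, 0, 0, 0, 0, 0, 0, 0, 0, 0, 0, 0, 0, 0, 0, 0, 0], [766, 464,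
      799, 1629, 15888, 9926, 13306, 587099040, 218, 2054837257, 0, 5784119224, 828, 14821, 7008,
      322268645, 13, 80, 90, 4160, 71, 694, 216, 2771, 76, 644, 212, 1695, 229, 701, 613,
      5628136, 0, 1, 0, 1, 0, 0, 0, 0, 0, 0, 0, 0, 0, 0, 0, 0, 0, 0, 0, 0, 0, 0, 0, 0, 0, 0, 0,
      0, 0, 0, 0, 0, 0], [384, 201, 272, 361, 732, 1083, 2633, 383176345, 264, 1637237733,
      8724006924, 0, 30000627, 11160, 172712756, 2833541520, 13, 81, 95, 12675, 70, 1425, 267,
      8480, 68, 578, 245, 3166, 230, 741, 713, 3383587, 0, 1, 0, 1, 0, 0, 0, 1, 0, 0, 0, 0, 0, 0,
      0, 0, 0, 0, 0, 0, 0, 0, 0, 0, 0, 0, 0, 0, 0, 0, 0, 0, 0], [385, 189, 224, 256, 359, 561,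
      1304, 159558537, 384, 2486, 901, 1818644449, 0, 2314698480, 2459, 1561416974, 13, 102, 103,
      1073, 58, 332, 189, 716, 66, 361, 187, 737, 196, 533, 535, 4539100, 0, 1, 0, 1, 0, 0, 0, 0,
      0, 0, 0, 0, 0, 0, 0, 0, 0, 0, 0, 0, 0, 0, 0, 0, 0, 0, 0, 0, 0, 0, 0, 0, 0], [418, 207, 245,
      281, 387, 616, 1439, 58228597, 356, 2173, 913, 2806137128, 5824981932, 0, 30002425,
      7567831076, 13, 102, 103, 1005, 58, 328, 188, 671, 64, 348, 187, 693, 190, 516, 529,
      3668618, 0, 1, 0, 1, 0, 0, 0, 0, 0, 0, 0, 0, 0, 0, 0, 0, 0, 0, 0, 0, 0, 0, 0, 0, 0, 0, 0,
      0, 0, 0, 0, 0, 0], [315, 159, 206, 259, 461, 640, 1195, 2891, 268, 8285, 5027, 1828987083,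
      791, 8978760094, 0, 23192261665, 13, 88, 102, 9304, 66, 1024, 272, 6219, 67, 574, 248,
      2907, 225, 789, 738, 3726613, 0, 1, 0, 1, 0, 0, 0, 1, 0, 0, 0, 0, 0, 0, 0, 0, 0, 0, 0, 0,
      0, 0, 0, 0, 0, 0, 0, 0, 0, 0, 0, 0, 0], [196, 90, 109, 128, 197, 248, 362, 522, 251, 1235,
      1056, 2537, 936, 4845337235, 33777641592, 0, 30000013, 102, 119, 15839192, 61, 890, 310,
      49770085, 65, 607, 270, 5596, 227, 1013, 868, 1588674656, 0, 1, 0, 1, 0, 0, 0, 1, 0, 0, 0,
      0, 0, 0, 0, 0, 0, 0, 0, 0, 0, 0, 0, 0, 0, 0, 0, 0, 0, 0, 0, 0, 0], [24, 4, 4, 4, 4, 5, 5,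
      5, 8, 9, 11, 12, 21, 30, 69, 485613457, 0, 466242711, 34, 3393280, 303111, 811792, 270,
      1331899, 50, 195, 234, 7642384, 244, 3068936, 5457485, 183813776, 0, 3198, 0, 3393, 0, 1,
      0, 2698, 0, 0, 0, 2088, 0, 1, 1, 1792, 0, 0, 0, 1402, 0, 1, 1, 1271, 0, 1, 1, 1127, 0, 16,
      5, 1041, 0], [24, 4, 4, 4, 4, 5, 5, 5, 8, 9, 11, 12, 21, 30, 69, 612703635, 1127697658, 0,
      30000034, 1096549000, 31374211, 45323743, 270, 3169725, 50, 195, 234, 33471312, 244,
      16883629, 84854256, 112016472, 0, 3178, 0, 3364, 0, 1, 0, 2675, 0, 0, 0, 2070, 0, 1, 1,
      1776, 0, 0, 0, 1390, 0, 1, 1, 1260, 0, 1, 1, 1117, 0, 16, 5, 1032, 0], [78, 27, 31, 34, 46,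
      55, 71, 86, 135, 173, 183, 345, 4797, 13056, 23381257, 417076592, 14, 1519033867, 0,
      4256884475, 38, 518, 33787776, 37459500, 42, 399, 771, 2994436, 166, 5305678, 28824,
      149810043, 0, 13, 0, 11, 0, 2, 0, 9, 0, 0, 0, 7, 0, 1, 1, 6, 0, 0, 0, 4, 0, 1, 1, 4, 0, 0,
      0, 3, 0, 3, 2, 3, 0], [68, 22, 25, 27, 35, 40, 48, 55, 77, 102, 120, 170, 380, 732, 2511,
      637386025, 14, 1208782712, 6415781050, 0, 30000035, 305, 233932933, 1816133363, 42, 360,
      689, 101710970, 172, 18318406, 226544986, 49698870, 0, 9405, 0, 9788, 0, 2, 0, 7769, 0, 0,
      0, 6000, 0, 2, 1, 5147, 0, 0, 0, 4040, 0, 1, 1, 3660, 0, 1, 1, 3240, 0, 45, 9, 2994, 0],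
      [33, 7, 7, 8, 8, 9, 10, 10, 14, 17, 20, 23, 38, 55, 122, 234699256, 29, 99, 39, 1211121660,
      0, 1818866486, 164, 955775037, 90, 469, 186, 5144, 272, 835, 798, 154047379, 0, 1, 0, 1, 0,
      0, 0, 1, 0, 0, 0, 0, 0, 0, 0, 0, 0, 0, 0, 0, 0, 0, 0, 0, 0, 0, 0, 0, 0, 0, 0, 0, 0], [103,
      37, 39, 40, 43, 44, 46, 50, 58, 80, 87, 98, 131, 200, 383, 220311181, 15, 54, 46,
      1924210215, 4312775750, 0, 30000121, 5623908595, 314, 10028248, 145, 2729, 391, 518, 418,
      160813720, 0, 0, 0, 0, 0, 0, 0, 0, 0, 0, 0, 0, 0, 0, 0, 0, 0, 0, 0, 0, 0, 0, 0, 0, 0, 0, 0,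
      0, 0, 0, 0, 0, 0], [50, 13, 14, 15, 18, 20, 22, 24, 32, 41, 49, 59, 100, 161, 415,
      121124461, 16, 328, 135, 1507231644, 52, 6061223292, 0, 17177581625, 39, 239, 500, 46522,
      191, 7444, 8425, 154184797, 0, 9, 0, 8, 0, 1, 0, 6, 0, 0, 0, 4, 0, 1, 1, 4, 0, 0, 0, 3, 0,
      1, 1, 3, 0, 0, 0, 2, 0, 2, 2, 2, 0], [42, 10, 11, 11, 13, 14, 16, 17, 24, 29, 35, 42, 72,
      111, 274, 8907631, 18, 528, 112, 721576476, 55, 4355813079, 24723683339, 0, 30000039, 221,
      486, 568647676, 193, 167818845, 31849873, 2536226399, 0, 7442, 0, 7934, 0, 2, 0, 6304, 0,
      0, 0, 4875, 0, 1, 1, 4180, 0, 0, 0, 3271, 0, 1, 1, 2965, 0, 1, 1, 2628, 0, 31, 8, 2428, 0],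
      [276831, 7530, 3491, 5826, 1290, 811, 1078, 534662, 421, 13763, 544, 653, 454, 683, 782,
      6288, 14, 55, 56, 18933, 171, 351, 109, 1435056583, 0, 1465719639, 120, 3336, 1522, 651,
      375, 716331227, 0, 0, 0, 0, 0, 0, 0, 0, 0, 0, 0, 0, 0, 0, 0, 0, 0, 0, 0, 0, 0, 0, 0, 0, 0,
      0, 0, 0, 0, 0, 0, 0, 0], [124, 49, 52, 55, 63, 64, 72, 83, 100, 137, 121, 139, 172, 223,
      297, 588, 14, 58, 56, 1768, 134, 273, 109, 1991252861, 3587986131, 0, 30000121, 3510339703,
      140031444, 1169, 435, 914933813, 0, 0, 0, 0, 0, 0, 0, 0, 0, 0, 0, 0, 0, 0, 0, 0, 0, 0, 0,
      0, 0, 0, 0, 0, 0, 0, 0, 0, 0, 0, 0, 0, 0], [49, 13, 14, 15, 18, 19, 21, 22, 30, 38, 46, 54,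
      88, 134, 283, 1137, 16, 223, 110, 3407, 56, 1020, 683, 1532591644, 50, 4998033184, 0,
      13490883917, 117, 902, 212059202, 678173770, 0, 4, 0, 3, 0, 1, 0, 2, 0, 0, 0, 2, 0, 1, 1,
      2, 0, 0, 0, 1, 0, 1, 0, 1, 0, 0, 0, 1, 0, 1, 1, 1, 0], [45, 12, 12, 13, 15, 16, 18, 19, 27,
      33, 39, 46, 78, 116, 255, 1527, 17, 253, 101, 4561, 57, 867, 617, 1694910175, 51,
      3700758712, 20879301981, 0, 30000115, 794, 787166101, 6911428301, 0, 4, 0, 3, 0, 1, 0, 2,
      0, 0, 0, 2, 0, 1, 1, 2, 0, 0, 0, 1, 0, 1, 0, 1, 0, 0, 0, 1, 0, 1, 1, 1, 0], [70, 22, 24,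
      25, 30, 31, 35, 38, 51, 65, 71, 83, 123, 178, 313, 974, 15, 82, 68, 2937, 94, 593, 178,
      459070225, 94, 295, 138, 4306795794, 0, 5966431488, 620, 3558940305, 0, 1, 0, 1, 0, 0, 0,
      1, 0, 0, 0, 0, 0, 0, 0, 0, 0, 0, 0, 0, 0, 0, 0, 0, 0, 0, 0, 0, 0, 0, 0, 0, 0], [62, 18, 20,
      21, 25, 26, 29, 32, 44, 55, 63, 75, 116, 183, 418, 915019, 16, 105, 78, 1467679, 80, 1591,
      280, 366526469, 59, 180, 149, 6623846635, 14112049390, 0, 30000741, 18577101627, 0, 1, 0,
      1, 0, 0, 0, 1, 0, 0, 0, 0, 0, 0, 0, 0, 0, 0, 0, 0, 0, 0, 0, 0, 0, 0, 0, 0, 0, 0, 0, 0, 0],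
      [42, 10, 11, 12, 14, 14, 16, 17, 23, 28, 33, 38, 60, 81, 134, 251, 17, 165, 85, 579, 56,
      394, 320, 1665, 55, 941, 505, 4873249445, 164, 21252438628, 0, 56728376150, 0, 8, 0, 7, 0,
      1, 0, 5, 0, 0, 0, 4, 0, 1, 1, 3, 0, 0, 0, 3, 0, 1, 1, 2, 0, 0, 0, 2, 0, 2, 2, 2, 0], [40,
      9, 10, 10, 12, 13, 14, 15, 21, 25, 28, 32, 46, 61, 93, 139, 16, 108, 69, 290, 54, 315, 254,
      634, 50, 308, 316, 480134612, 234, 12281624008, 81408881321, 0, 30000000, 397673, 0,
      153565138, 0, 2, 0, 1010090406, 0, 0, 0, 792081572, 0, 1, 1, 1042378423, 0, 0, 0,
      145980106, 0, 1, 1, 132857040, 0, 1, 1, 98406006, 0, 35, 8, 98989398, 0], [19, 0, 0, 0, 0,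
      0, 0, 0, 0, 0, 0, 0, 0, 0, 0, 0, 0, 0, 0, 0, 0, 0, 0, 0, 0, 0, 0, 0, 0, 0, 0, 227396514, 0,
      289297625, 0, 4482754, 0, 0, 0, 62851291, 0, 24, 0, 49285969, 18, 0, 0, 64859955, 6, 35, 0,
      9083742, 32, 0, 0, 8267303, 13, 1, 0, 6123459, 18, 0, 0, 6159814, 0], [4, 0, 0, 0, 0, 0, 0,
      0, 0, 0, 0, 0, 0, 0, 0, 0, 0, 0, 0, 0, 0, 0, 0, 0, 0, 0, 0, 0, 0, 0, 0, 322881057,
      697808592, 0, 30000000, 609015526, 41615523, 3, 0, 93702968, 0, 0, 0, 70217119, 0, 3, 0,
      83032622, 0, 0, 0, 15353040, 2, 1, 0, 13083209, 3, 12, 0, 9699125, 16, 4, 1, 8875815, 0],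
      [34, 2, 2, 2, 2, 3, 3, 3, 5, 4, 4, 4, 4, 5, 6, 6, 6, 5, 5, 10, 36417, 41, 20, 16, 7, 14,
      1431524, 2185960, 5349630, 15, 39239528, 172699396, 0, 936054076, 0, 2608419746, 0,
      12683777, 0, 55918041, 0, 993394, 0, 49664779, 0, 786577, 1, 60427821, 0, 0, 0, 10507690,
      0, 1, 7, 8755247, 0, 0, 1, 6774676, 0, 3, 9, 6148318, 0], [73, 8, 8, 9, 9, 9, 8, 8, 7, 8,
      9, 7, 5, 7, 8, 8, 4, 5, 6, 14, 26909, 107, 32, 24, 10, 21, 1008994, 1590900, 3807266, 26,
      27967432, 587302691, 0, 748028089, 3948076847, 0, 30000000, 0, 124523683, 1011721448, 0, 0,
      552135, 205109370, 0, 0, 1, 198000444, 0, 0, 0, 48071859, 0, 1, 2, 43396282, 0, 0, 1,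
      34261134, 0, 3, 6, 34381888, 0], [5, 0, 0, 0, 0, 0, 0, 0, 0, 0, 0, 0, 0, 0, 0, 0, 0, 0, 0,
      0, 0, 0, 0, 0, 0, 0, 0, 0, 0, 0, 0, 224925847, 0, 968296, 0, 623230519, 0, 1124656002, 0,
      479245629, 0, 0, 0, 83192622, 1, 1063, 0, 83897413, 0, 0, 0, 18251160, 0, 1, 0, 16956611,
      0, 1, 0, 13755687, 1, 3, 1, 14425033, 0], [8, 0, 0, 0, 0, 0, 0, 0, 0, 0, 0, 0, 0, 0, 0, 0,
      0, 0, 0, 0, 0, 0, 0, 0, 0, 0, 0, 0, 0, 0, 0, 319137674, 0, 291860, 0, 860625799,
      2611890372, 0, 30000000, 3314002028, 3688278, 5724377, 0, 106188247, 14, 4293008, 0,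
      101747885, 0, 0, 0, 28961352, 0, 1, 0, 26155705, 0, 1, 0, 20667306, 0, 2, 1, 20278388, 0],
      [16, 0, 0, 0, 0, 0, 0, 0, 0, 0, 0, 0, 0, 0, 0, 0, 0, 0, 0, 0, 0, 0, 0, 0, 0, 0, 0, 0, 0, 1,
      1, 232094024, 0, 255476, 0, 605530711, 0, 3621998849, 0, 10407002183, 0, 0, 0, 73081117, 0,
      12494, 2, 58156542, 0, 0, 0, 28733488, 0, 2, 1, 23312426, 0, 1, 1, 17762371, 0, 6, 5,
      14743143, 0], [15, 0, 0, 0, 0, 0, 0, 0, 0, 0, 0, 0, 0, 0, 0, 0, 0, 0, 0, 0, 0, 0, 0, 0, 0,
      0, 0, 0, 0, 0, 1, 764118262, 0, 293462, 0, 596176776, 0, 2687029269, 14928159177, 0,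
      30000000, 0, 0, 402201161, 0, 48735392, 1, 2007893149, 0, 0, 0, 127172252, 0, 1, 1,
      120433691, 0, 1, 1, 90796880, 0, 6, 3, 107401002, 0], [8, 0, 0, 0, 0, 0, 0, 0, 0, 0, 0, 0,
      0, 0, 0, 0, 0, 0, 0, 0, 0, 0, 0, 0, 0, 0, 0, 0, 0, 0, 0, 139098657, 0, 1661450, 0,
      55257226, 0, 1, 0, 481581469, 0, 901629288, 0, 81753296, 11628368, 1, 0, 427662889, 0, 0,
      0, 30318973, 0, 1, 0, 26913015, 0, 1, 0, 19780236, 1, 2, 1, 21314684, 0], [7, 0, 0, 0, 0,
      0, 0, 0, 0, 0, 0, 0, 0, 0, 0, 0, 0, 0, 0, 0, 0, 0, 0, 0, 0, 0, 0, 0, 0, 0, 0, 196853006, 0,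
      4403940, 0, 59087258, 0, 1, 0, 713193237, 2164911289, 0, 30000000, 2123769080, 90823433, 1,
      0, 631215820, 0, 1, 0, 35501734, 0, 1, 0, 34389692, 0, 1, 0, 25784657, 1, 2, 1, 32735630,
      0], [12, 0, 0, 0, 0, 0, 0, 0, 0, 0, 0, 0, 0, 0, 0, 0, 0, 0, 0, 0, 0, 0, 0, 0, 0, 0, 0, 0,
      0, 0, 1, 138808447, 0, 3108237, 0, 52908546, 0, 0, 0, 484839911, 0, 2944428222, 0,
      8326039000, 0, 0, 9, 425484351, 0, 0, 0, 33287810, 0, 1, 1, 28175328, 0, 1, 1, 21112901, 0,
      4, 4, 19498377, 0], [15, 0, 0, 0, 0, 0, 0, 0, 0, 0, 0, 0, 0, 0, 0, 0, 0, 0, 0, 0, 0, 0, 0,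
      0, 0, 0, 0, 0, 0, 0, 1, 291085304, 0, 990674, 0, 130222365, 0, 0, 0, 1208212385, 0,
      2289893487, 12447139029, 0, 30000000, 0, 274231314, 4824275302, 0, 0, 0, 105071756, 0, 1,
      1, 108978397, 0, 1, 1, 82509506, 0, 4, 4, 107608236, 0], [9, 0, 0, 0, 0, 0, 0, 0, 0, 0, 0,
      0, 0, 0, 0, 0, 0, 0, 0, 0, 0, 0, 0, 0, 0, 0, 0, 0, 0, 0, 0, 94256872, 0, 407862, 0,
      55695778, 0, 24, 0, 404270415, 0, 0, 0, 2018033556, 0, 3579266292, 0, 2240960023, 0, 0, 0,
      46221182, 0, 1, 0, 46703978, 0, 1, 0, 35881797, 1, 2, 1, 42501154, 0], [9, 0, 0, 0, 0, 0,
      0, 0, 0, 0, 0, 0, 0, 0, 0, 0, 0, 0, 0, 0, 0, 0, 0, 0, 0, 0, 0, 0, 0, 0, 0, 132184438, 0,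
      285500, 0, 63901573, 0, 7284320, 0, 576409148, 0, 0, 0, 2867520360, 8431747112, 0,
      30000000, 11638285410, 0, 1, 0, 61104849, 0, 1, 0, 63271794, 0, 1, 0, 47766352, 1, 2, 1,
      62292879, 0], [15, 0, 0, 0, 0, 0, 0, 0, 0, 0, 0, 0, 0, 0, 0, 0, 0, 0, 0, 0, 0, 0, 0, 0, 0,
      0, 0, 0, 0, 0, 1, 98937833, 0, 590165, 0, 81425656, 0, 15, 0, 361507609, 0, 0, 0,
      1992802662, 0, 11754182322, 0, 34325717934, 0, 0, 0, 51586333, 0, 5, 1, 51336053, 0, 0, 1,
      42799659, 0, 15, 7, 41127355, 0], [15, 0, 0, 0, 0, 0, 0, 0, 0, 0, 0, 0, 0, 0, 0, 0, 0, 0,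
      0, 0, 0, 0, 0, 0, 0, 0, 0, 0, 0, 0, 1, 213843535, 0, 618852, 0, 148683846, 0, 14, 0,
      643098318, 0, 0, 0, 1694073329, 0, 8594776567, 48497782291, 0, 30000000, 0, 0, 469228088,
      0, 5, 1, 2477499252, 0, 0, 1, 703843538, 0, 16, 7, 1159612009, 0], [7, 0, 0, 0, 0, 0, 0, 0,
      0, 0, 0, 0, 0, 0, 0, 0, 0, 0, 0, 0, 0, 0, 0, 0, 0, 0, 0, 0, 0, 0, 0, 18920500, 0, 298639,
      0, 19696186, 0, 0, 0, 37320570, 0, 0, 0, 49412866, 1, 0, 0, 508846503, 0, 847502780, 0,
      47769207, 13173451, 0, 0, 275391181, 283923, 4, 0, 95033253, 108167, 1, 0, 132103795, 0],
      [7, 0, 0, 0, 0, 0, 0, 0, 0, 0, 0, 0, 0, 0, 0, 0, 0, 0, 0, 0, 0, 0, 0, 0, 0, 0, 0, 0, 0, 0,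
      0, 25755952, 0, 296016, 0, 23979130, 0, 0, 0, 53285132, 0, 0, 0, 58249240, 1, 0, 0,
      759661339, 2015861028, 0, 30000000, 1946837965, 77208224, 0, 0, 418201468, 1668685, 4, 0,
      109052547, 637531, 1, 0, 197277802, 0], [11, 0, 0, 0, 0, 0, 0, 0, 0, 0, 0, 0, 0, 0, 0, 0,
      0, 0, 0, 0, 0, 0, 0, 0, 0, 0, 0, 0, 0, 1, 1, 17422416, 0, 524459, 0, 20883272, 0, 2, 0,
      37777949, 0, 0, 0, 53090906, 0, 2, 3, 502895016, 0, 2738758428, 0, 7722391779, 0, 0, 4107,
      275700609, 0, 1, 2, 99732182, 0, 2, 5581, 129065572, 0], [13, 0, 0, 0, 0, 0, 0, 0, 0, 0, 0,
      0, 0, 0, 0, 0, 0, 0, 0, 0, 0, 0, 0, 0, 0, 0, 0, 0, 0, 1, 1, 39303138, 0, 540392, 0,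
      43828835, 0, 2, 0, 87752580, 0, 0, 0, 133651600, 0, 2, 3, 1278566155, 0, 2131710827,
      11568252301, 0, 30000000, 0, 273626095, 3825890707, 0, 1, 2, 394866811, 0, 2, 61158,
      603736094, 0], [9, 0, 0, 0, 0, 0, 0, 0, 0, 0, 0, 0, 0, 0, 0, 0, 0, 0, 0, 0, 0, 0, 0, 0, 0,
      0, 0, 0, 0, 0, 0, 13736454, 0, 390056, 0, 18471194, 0, 0, 0, 32207081, 0, 0, 0, 55985416,
      0, 0, 0, 408973373, 0, 0, 0, 1863807579, 0, 3309930319, 0, 1846873704, 0, 1, 0, 161998811,
      2, 3, 1, 240871325, 0], [10, 0, 0, 0, 0, 0, 0, 0, 0, 0, 0, 0, 0, 0, 0, 0, 0, 0, 0, 0, 0, 0,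
      0, 0, 0, 0, 0, 0, 0, 0, 0, 15731086, 0, 367682, 0, 21228936, 0, 1, 0, 39941639, 0, 0, 0,
      74015974, 0, 1, 0, 632068013, 0, 0, 0, 2623460636, 7832863619, 0, 30000000, 10396668612, 1,
      33046, 0, 248750852, 1, 3, 1, 345413588, 0], [16, 0, 0, 0, 0, 0, 0, 0, 0, 0, 0, 0, 0, 0, 0,
      0, 0, 0, 0, 0, 0, 0, 0, 0, 0, 0, 0, 0, 0, 0, 1, 17044140, 0, 760311, 0, 26150012, 0, 2, 0,
      40851103, 0, 0, 0, 76190277, 0, 2, 1, 329018838, 0, 0, 0, 1814726115, 0, 10936364020, 0,
      31697161919, 0, 0, 1, 176883183, 0, 4808798, 11, 222228876, 0], [15, 0, 0, 0, 0, 0, 0, 0,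
      0, 0, 0, 0, 0, 0, 0, 0, 0, 0, 0, 0, 0, 0, 0, 0, 0, 0, 0, 0, 0, 0, 1, 37627757, 0, 765128,
      0, 49688773, 0, 1, 0, 93569024, 0, 0, 0, 161014116, 0, 2, 1, 1047899742, 0, 0, 0,
      1784416170, 0, 8014249321, 45038557397, 0, 30000000, 0, 1, 2795489531, 0, 96939630, 9,
      5831206813, 0], [8, 0, 0, 0, 0, 0, 0, 0, 0, 0, 0, 0, 0, 0, 0, 0, 0, 0, 0, 0, 0, 0, 0, 0, 0,
      0, 0, 0, 0, 0, 0, 8715715, 0, 278078, 0, 12354116, 0, 1, 0, 20661705, 0, 0, 0, 35288551, 0,
      1, 0, 131248653, 0, 0, 0, 140500985, 0, 0, 0, 1679005493, 0, 2860151254, 0, 541461453,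
      63585824, 2, 1, 1261641850, 0], [8, 0, 0, 0, 0, 0, 0, 0, 0, 0, 0, 0, 0, 0, 0, 0, 0, 0, 0,
      0, 0, 0, 0, 0, 0, 0, 0, 0, 0, 0, 0, 10440782, 0, 280813, 0, 14510752, 0, 1, 0, 25886646, 0,
      0, 0, 44751307, 0, 1, 0, 214506775, 0, 0, 0, 177196289, 0, 0, 0, 2439112795, 6722941065, 0,
      30000000, 7391395747, 111069370, 2, 1, 1826210930, 0], [13, 0, 0, 0, 0, 0, 0, 0, 0, 0, 0,
      0, 0, 0, 0, 0, 0, 0, 0, 0, 0, 0, 0, 0, 0, 0, 0, 0, 0, 0, 1, 10909967, 0, 596720, 0,
      16508740, 0, 1, 0, 24318057, 0, 0, 0, 40299851, 0, 1, 1, 99886838, 0, 0, 0, 163726079, 0,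
      1, 1, 1640022310, 0, 9241958171, 0, 26224939546, 0, 1, 24585817, 1231382490, 0], [13, 0, 0,
      0, 0, 0, 0, 0, 0, 0, 0, 0, 0, 0, 0, 0, 0, 0, 0, 0, 0, 0, 0, 0, 0, 0, 0, 0, 0, 0, 1,
      18666333, 0, 602079, 0, 25597147, 0, 1, 0, 41948789, 0, 0, 0, 71633550, 0, 1, 1, 264827236,
      0, 0, 0, 327878200, 0, 1, 1, 3276813432, 0, 6906160771, 38689134585, 0, 30000000, 1,
      600455279, 16379348766, 0], [10, 0, 0, 0, 0, 0, 0, 0, 0, 0, 0, 0, 0, 0, 0, 0, 0, 0, 0, 0,
      0, 0, 0, 0, 0, 0, 0, 0, 0, 0, 0, 8118553, 0, 424995, 0, 11625824, 0, 1, 0, 16731335, 0, 0,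
      0, 27295647, 0, 1, 0, 56804253, 0, 0, 0, 131113884, 0, 1, 0, 960306563, 0, 0, 0,
      6629162692, 0, 11194949261, 1, 7597971684, 0], [12, 0, 0, 0, 0, 0, 0, 0, 0, 0, 0, 0, 0, 0,
      0, 0, 0, 0, 0, 0, 0, 0, 0, 0, 0, 0, 0, 0, 0, 0, 0, 10725042, 0, 519786, 0, 15554849, 0, 1,
      0, 22496106, 0, 0, 0, 37825660, 0, 1, 0, 84073980, 0, 0, 0, 182300294, 0, 1, 0, 1384422226,
      0, 0, 0, 9421631059, 26429103771, 0, 30000001, 37291803433, 0], [14, 0, 0, 0, 0, 0, 0, 0,
      0, 0, 0, 0, 0, 0, 0, 0, 0, 0, 0, 0, 0, 0, 0, 0, 0, 0, 0, 0, 0, 0, 1, 6735650, 0, 408563, 0,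
      10145600, 0, 1, 0, 14716278, 0, 0, 0, 24768357, 0, 2, 1, 55731508, 0, 0, 0, 120956291, 0,
      1, 1, 1004489291, 0, 1, 1, 6557188731, 0, 36817887544, 0, 108154276620, 0], [7379, 0, 0, 0,
      0, 0, 0, 0, 0, 0, 0, 0, 0, 0, 0, 0, 0, 0, 0, 0, 0, 0, 0, 0, 0, 0, 0, 0, 0, 0, 1, 6591155,
      0, 402129, 0, 9143847, 0, 1, 0, 13046664, 0, 0, 0, 21431391, 0, 2, 1, 43703805, 0, 0, 0,
      99721210, 0, 1, 1, 630105837, 0, 1, 1, 4505954550, 0, 26795870743, 152112196499, 0, 0],
      [7439, 0, 0, 0, 0, 0, 0, 0, 0, 0, 0, 0, 0, 0, 0, 0, 0, 0, 0, 0, 0, 0, 0, 0, 0, 0, 0, 0, 0,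
      0, 0, 147590, 0, 152282, 0, 206869, 0, 1, 0, 233883, 0, 0, 0, 284783, 0, 1, 0, 338763, 0,
      0, 0, 538508, 0, 1, 0, 763095, 0, 1, 0, 1791828, 0, 2, 1, 995534953, 0]] 100000000 74100
      2048 [[1430, 342, -240, -282, -53, -76, -53, -187, -34, -48, -34, -94, -34, -48, -34, -144,
      -14, -21, -14, -40, -14, -21, -14, -74, -14, -21, -14, -40, -14, -21, -14, -10, 0, 0, 0, 0,
      0, 0, 0, 0, 0, 0, 0, 0, 0, 0, 0, 0, 0, 0, 0, 0, 0, 0, 0, 0, 0, 0, 0, 0, 0, 0, 0, 0, 0],
      [1147, 1740, -1725, -45, -64, -45, -173, -32, -46, -32, -89, -32, -46, -32, -136, -14, -20,
      -14, -38, -14, -20, -14, -70, -13, -20, -14, -38, -14, -20, -14, -10, 0, 0, 0, 0, 0, 0, 0,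
      0, 0, 0, 0, 0, 0, 0, 0, 0, 0, 0, 0, 0, 0, 0, 0, 0, 0, 0, 0, 0, 0, 0, 0, 0, 0], [317, -237,
      -3, -4, -3, -11, -2, -3, -2, -6, -2, -3, -2, -9, -1, -1, -1, -3, -1, -1, -1, -5, -4, -1,
      -1, -3, -1, -1, -1, -1, 0, 0, 0, 0, 0, 0, 0, 0, 0, 0, 0, 0, 0, 0, 0, 0, 0, 0, 0, 0, 0, 0,
      0, 0, 0, 0, 0, 0, 0, 0, 0, 0, 0], [2100, 932, 154, -235, -1626, -46, -65, -46, -128, -46,
      -65, -46, -224, -23, -33, -23, -64, -23, -33, -23, -119, -21, -33, -23, -64, -23, -33, -23,
      -16, 0, 0, 0, 0, 0, 0, 0, 0, 0, 0, 0, 0, 0, 0, 0, 0, 0, 0, 0, 0, 0, 0, 0, 0, 0, 0, 0, 0, 0,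
      0, 0, 0, 0], [378, -199, 102, -208, -2, -3, -2, -6, -2, -3, -2, -13, -1, -2, -1, -4, -1,
      -2, -1, -7, -3, -2, -1, -4, -1, -2, -1, -1, 0, 0, 0, 0, 0, 0, 0, 0, 0, 0, 0, 0, 0, 0, 0, 0,
      0, 0, 0, 0, 0, 0, 0, 0, 0, 0, 0, 0, 0, 0, 0, 0, 0], [1528, 2141, -3049, -16, -23, -16, -44,
      -16, -23, -16, -114, -12, -18, -12, -34, -12, -18, -12, -64, -12, -18, -12, -34, -12, -18,
      -12, -9, 0, 0, 0, 0, 0, 0, 0, 0, 0, 0, 0, 0, 0, 0, 0, 0, 0, 0, 0, 0, 0, 0, 0, 0, 0, 0, 0,
      0, 0, 0, 0, 0, 0], [371, -348, 0, 0, 0, 0, 0, 0, 0, -5, -1, -1, -1, -2, -1, -1, -1, -3, 1,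
      -1, -1, -2, -1, -1, -1, 0, 0, 0, 0, 0, 0, 0, 0, 0, 0, 0, 0, 0, 0, 0, 0, 0, 0, 0, 0, 0, 0,
      0, 0, 0, 0, 0, 0, 0, 0, 0, 0, 0, 0], [4171, 922, 1038, 921, -1980, -631, -1517, -1210,
      -1055, -23, -33, -23, -64, -23, -33, -23, -118, -19, -33, -23, -64, -23, -33, -23, -16, 0,
      0, 0, 0, 0, 0, 0, 0, 0, 0, 0, 0, 0, 0, 0, 0, 0, 0, 0, 0, 0, 0, 0, 0, 0, 0, 0, 0, 0, 0, 0,
      0, 0], [273, -137, 58, -53, 2, -42, -39, -35, -1, -1, -1, -2, -1, -1, -1, -4, -5, -1, -1,
      -2, -1, -1, -1, -1, 0, 0, 0, 0, 0, 0, 0, 0, 0, 0, 0, 0, 0, 0, 0, 0, 0, 0, 0, 0, 0, 0, 0, 0,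
      0, 0, 0, 0, 0, 0, 0, 0, 0], [268, 12, -1031, -567, -104, 722, 557, 5, 7, 5, 14, 5, 7, 5,
      26, 2, 7, 5, 14, 5, 7, 5, 4, 0, 0, 0, 0, 0, 0, 0, 0, 0, 0, 0, 0, 0, 0, 0, 0, 0, 0, 0, 0, 0,
      0, 0, 0, 0, 0, 0, 0, 0, 0, 0, 0, 0], [178, 41, 42, -43, -96, -80, -1, -2, -1, -4, -1, -2,
      -1, -7, -6, -2, -1, -4, -1, -2, -1, -1, 0, 0, 0, 0, 0, 0, 0, 0, 0, 0, 0, 0, 0, 0, 0, 0, 0,
      0, 0, 0, 0, 0, 0, 0, 0, 0, 0, 0, 0, 0, 0, 0, 0], [2080, 1052, 1249, 562, -4132, -28, -40,
      -28, -78, -28, -40, -28, -144, -21, -40, -28, -78, -28, -40, -28, -20, 0, 0, 0, 0, 0, 0, 0,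
      0, 0, 0, 0, 0, 0, 0, 0, 0, 0, 0, 0, 0, 0, 0, 0, 0, 0, 0, 0, 0, 0, 0, 0, 0, 0], [416, -368,
      -113, 68, 0, 0, 0, 0, 0, 0, 0, 1, -7, 0, 0, 0, 0, 0, 0, 0, 0, 0, 0, 0, 0, 0, 0, 0, 0, 0, 0,
      0, 0, 0, 0, 0, 0, 0, 0, 0, 0, 0, 0, 0, 0, 0, 0, 0, 0, 0, 0, 0, 0], [1103, 2160, -2856, -14,
      -20, -14, -38, -14, -20, -14, -71, -14, -20, -14, -39, -14, -20, -14, -10, 0, 0, 0, 0, 0,
      0, 0, 0, 0, 0, 0, 0, 0, 0, 0, 0, 0, 0, 0, 0, 0, 0, 0, 0, 0, 0, 0, 0, 0, 0, 0, 0, 0], [631,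
      -629, -2, -3, 34, -5, -2, -2, -2, -8, 9, -2, -2, -4, -2, -2, -2, -1, 0, 0, 0, 0, 0, 0, 0,
      0, 0, 0, 0, 0, 0, 0, 0, 0, 0, 0, 0, 0, 0, 0, 0, 0, 0, 0, 0, 0, 0, 0, 0, 0, 0], [8121, 964,
      1108, 826, 231, 105, -251, -291, -3545, -684, -989, -692, -1929, -692, -986, -692, -495, 0,
      0, 0, 0, 0, 0, 0, 0, 0, 0, 0, 0, 0, 0, 0, 0, 0, 0, 0, 0, 0, 0, 0, 0, 0, 0, 0, 0, 0, 0, 0,
      0, 0], [227, -89, 13, 58, 29, 27, 17, -366, -101, -116, -81, 13, 34, 82, 104, 112, 0, 0, 0,
      -1, 0, 0, 0, -1, 0, 0, 0, 0, 0, 0, 0, -1, 0, 0, 0, 0, 0, 0, 0, 0, 0, 0, 0, 0, 0, 0, 0, 0,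
      0], [291, 9, 37, -202, 60, 192, -1490, -326, -435, -305, 37, 123, 331, 627, 964, 0, 0, 0,
      -1, 0, 0, 0, -1, 0, 0, 0, 0, 0, 0, 0, -1, 0, 0, 0, 0, 0, 0, 0, 0, 0, 0, 0, 0, 0, 0, 0, 0,
      0], [212, -941, -328, -774, -476, 434, 138, 219, 154, 475, 176, 306, 236, 144, 0, 0, 0, 0,
      0, 0, 0, 0, 0, 0, 0, 0, 0, 0, 0, 0, 0, 0, 0, 0, 0, 0, 0, 0, 0, 0, 0, 0, 0, 0, 0, 0, 0],
      [2058, 991, 1502, 1601, -2401, -509, -723, -506, -1061, -338, -431, -184, 38, 0, 0, 0, 0,
      0, 0, 0, 0, 0, 0, 0, 0, 0, 0, 0, 0, 0, 0, 0, 0, 0, 0, 0, 0, 0, 0, 0, 0, 0, 0, 0, 0, 0],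
      [346, -77, 277, 131, 94, 150, 105, -164, -115, -151, -211, -360, 0, 0, 0, 0, 0, 0, 0, 0, 0,
      0, 0, 0, 0, 0, 0, 0, 0, 0, 0, 0, 0, 0, 0, 0, 0, 0, 0, 0, 0, 0, 0, 0, 0], [285, 103, 2137,
      510, 816, 632, -280, -353, -617, -1140, -1938, 0, 1, 1, 1, 0, 0, 0, 1, 0, 0, 0, 1, 0, 0, 0,
      1, 0, 0, 0, 0, 0, 0, 0, 0, 0, 0, 0, 0, 0, 0, 0, 0, 0], [788, -103, 177, 224, 149, -58, -79,
      -202, -343, -509, 0, 0, 0, 0, 0, 0, 0, 0, 0, 0, 0, 0, 0, 0, 0, 0, 0, 0, 0, 0, 0, 0, 0, 0,
      0, 0, 0, 0, 0, 0, 0, 0, 0], [4358, 1157, 1426, 1451, -2464, -1102, -2340, -1918, -532, 0,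
      -1, -1, -1, 0, 0, 0, -1, 0, 0, 0, 0, 0, 0, 0, -1, 0, 0, 0, 0, 0, 0, 0, 0, 0, 0, 0, 0, 0, 0,
      0, 0, 0], [413, -288, -265, 181, -68, 33, 111, -89, 0, 0, 0, 0, 0, 0, 0, 0, 0, 0, 0, 0, 0,
      0, 0, 0, 0, 0, 0, 0, 0, 0, 0, 0, 0, 0, 0, 0, 0, 0, 0, 0, 0], [341, 200, -715, -783, 140,
      266, 542, 0, 0, 0, 0, 0, 0, 0, 0, 0, 0, 0, 0, 0, 0, 0, 0, 0, 0, 0, 0, 0, 0, 0, 0, 0, 0, 0,
      0, 0, 0, 0, 0, 0], [467, -1186, -279, -254, 650, 591, 0, 0, 3, 3, 0, 0, 0, 1, 0, 0, 0, 0,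
      0, 0, 0, 1, 0, 0, 0, 0, 0, 0, 0, 0, 0, 0, 0, 0, 0, 0, 0, 0, 0], [2357, 1261, 1742, 1326,
      -6505, 0, 0, 14, 9, 0, 0, 0, -1, 0, 0, 0, 0, 0, 0, 0, -1, 0, 0, 0, 0, 0, 0, 0, 0, 0, 0, 0,
      0, 0, 0, 0, 0, 0], [554, -319, -28, -171, 0, 0, 2, 2, 0, 0, 0, 1, 0, 0, 0, 0, 0, 0, 0, 1,
      0, 0, 0, 0, 0, 0, 0, 0, 0, 0, 0, 0, 0, 0, 0, 0, 0], [1266, 2819, -4038, 0, 0, 17, 12, 0, 0,
      0, 0, 0, 0, 0, 0, 0, 0, 0, 0, 0, 0, 0, 0, 0, 0, 0, 0, 0, 0, 0, 0, 0, 0, 0, 0, 0], [607,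
      -590, 0, 0, 3, 3, 0, 0, 0, 0, 0, 0, 0, 0, 0, 0, 0, 0, 0, 0, 0, 0, 0, 0, 0, 0, 0, 0, 0, 0,
      0, 0, 0, 0, 0], [3068, 176, 251, 175, 767, 328, 429, 456, -362, -84, -153, -89, -132, -4,
      -50, 80, -1776, -192, -297, -219, -437, -122, -244, -63, -563, -64, -127, -25, -51, 35, 34,
      10, 40, 3], [166, 22, 16, 68, 29, 38, 40, -32, -7, -13, -8, -12, 0, -4, 7, -157, -17, -26,
      -19, -39, -11, -22, -6, -50, -6, -11, -2, -5, 3, 3, 1, 3, 0], [295, 61, -48, -300, 51, 47,
      252, 68, 111, 79, 161, 60, 81, 68, -522, -65, -95, -64, -119, -32, -51, -25, -103, -14,
      -23, -9, -9, 5, 5, 3, 5, 1], [173, 64, 32, 31, 157, -42, -3, 42, 41, 8, 8, 15, 32, -341,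
      -38, -57, -35, -66, -13, -26, -4, -66, -7, -15, 0, 2, 10, 12, 8, 9, 2], [891, 460, 564,
      505, -658, -143, -333, -146, -110, 87, 8, 269, -1059, -87, -152, -68, -177, -27, -62, 22,
      -180, -14, -36, 12, -8, 21, 25, 16, 18, 2], [280, -49, 230, -258, -15, 1, -9, -71, -36,
      -40, -56, 50, 5, 10, 4, 14, 3, 7, -2, 15, 1, 3, -1, 1, -1, -1, 0, -1, 0], [228, -134, 138,
      -55, -3, 56, -63, -39, 48, 61, -110, -8, -16, -6, -15, 0, -4, 6, -2, 3, 2, 5, 12, 7, 10, 6,
      5, -1], [626, -346, 58, 100, 68, 34, -27, 45, -46, -158, -28, -31, -24, -23, -11, 5, -31,
      54, 0, 12, -14, -2, -14, -15, -7, -14, -2], [1704, 362, 542, 412, 437, 139, 100, 245,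
      -2202, -231, -401, -226, -467, -51, -240, 168, -640, -11, -113, 105, 91, 153, 181, 100,
      140, 8], [307, -175, 73, 171, 85, 172, 44, -315, -49, -70, -50, -66, -13, -25, -6, -17, 3,
      0, 6, 27, 16, 21, 14, 13, 0], [313, -70, -51, -467, 181, 81, 64, 10, 7, 11, -3, 4, -9, 25,
      -64, -4, -14, 8, -16, 4, 2, -1, 5, 1], [322, -98, 23, 101, -27, -145, -30, -32, -32, -11,
      -8, 8, -34, 91, 7, 22, -7, 41, 5, 11, 11, 0, -1], [1097, 534, 717, 594, -1728, -203, -394,
      -179, -336, 1, -111, 227, -482, -2, -83, 79, 56, 105, 125, 64, 101, 5], [490, -305, 155,
      -227, 8, 18, 7, 17, -3, 10, -21, 35, -2, 5, -12, -4, -10, -11, -6, -10, -1], [287, -28,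
      -102, -31, -56, -28, -41, 1, -10, 25, -34, 3, -4, 11, 18, 15, 20, 11, 14, 0], [1323, -1137,
      8, 32, 4, 27, -14, 18, -67, 92, -6, 14, -33, -1, -23, -24, -11, -23, -2], [1921, 209, 350,
      236, 236, 31, 59, 1, -1028, -232, -379, -208, -92, 107, 46, -144, 270, 39], [271, -138,
      141, 150, 45, 270, 102, -300, -123, -153, -143, -1, 24, 34, 16, 27, 2], [308, -52, -117,
      -507, 197, 203, 12, 6, 12, 40, -20, 3, 8, 4, 7, 1], [307, -110, 9, 112, 31, -100, -50, -55,
      -64, 55, 27, 49, 47, 5, -3], [1118, 520, 753, 445, -1346, -360, -631, -255, -265, 108, 102,
      -19, 168, 13], [451, -276, 118, -207, 23, 68, 20, 16, -19, -14, -7, -13, -1], [290, -25,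
      -70, -62, -108, -48, -21, 27, 33, 17, 23, 1], [1234, -1140, -16, 10, -69, 50, -11, 2, 10,
      -3, -2], [2030, 408, 701, 336, -395, -427, -559, -330, -301, 55], [468, -363, 298, -276,
      -161, 146, 45, -17, 2], [315, -96, 57, -642, 458, 31, 54, 2], [868, -812, 14, 13, 22, 3,
      0], [606, 369, 255, 1035, -512, 111], [830, -670, 205, -390, -10], [317, 187, 22, 35],
      [2286, -2263, -36], [29896, 30133], [298]]"
  by code_simp

section \<open>The five patterns\<close>

lemma virtual_end_extend:
  assumes "interpolates E F G" "virtual_end E F G h' (real_of_int s0 / 10)"
    and "check_tail h s0 s1 D cols mu c L" "p = map (\<lambda>a. real_of_int a / 10) h @ h'"
  shows "virtual_end E F G p (real_of_int s1 / 10)"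
  unfolding assms(4) by (rule virtual_end_step[OF assms(3,1,2)])

text \<open>Every stage uses the preceding fictitious endpoint as its tail. The final corrections
  82.6 and 185.5 are the sums of the two lists.\<close>

lemma virtual_ends:
  assumes I: "interpolates E F G"
  shows "virtual_end E F G (pat_b @ [7.2] @ pat_b @ [14.2] @ pat_b @ [7.2] @ pat_b) (real_of_int 826 / 10)"
    and "virtual_end E F G (pat_b @ [7.2] @ pat_b @ [12.6] @ pat_b @ [7.2] @ pat_b @ [23.5] @
      pat_b @ [7.2] @ pat_b @ [12.6] @ pat_b @ [7.2] @ pat_b) (real_of_int 1855 / 10)"
proof -
  note ext = virtual_end_extend[OF I]
  have "virtual_end E F G [] (real_of_int 0 / 10)"
    using virtual_end_Nil[OF I] by simp
  then have "virtual_end E F G pat_b (real_of_int 135 / 10)"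
    by (rule ext[OF _ tail_b]) (simp add: pat_b_def)
  then have 1: "virtual_end E F G (pat_b @ [7.2] @ pat_b) (real_of_int 342 / 10)"
    by (rule ext[OF _ tail_72]) (simp add: pat_b_def)
  from 1 show "virtual_end E F G (pat_b @ [7.2] @ pat_b @ [14.2] @ pat_b @ [7.2] @ pat_b) (real_of_int 826 / 10)"
    by (rule ext[OF _ tail_142]) (simp add: pat_b_def)
  from 1 have "virtual_end E F G (pat_b @ [7.2] @ pat_b @ [12.6] @ pat_b @ [7.2] @ pat_b) (real_of_int 810 / 10)"
    by (rule ext[OF _ tail_126]) (simp add: pat_b_def)
  then show "virtual_end E F G (pat_b @ [7.2] @ pat_b @ [12.6] @ pat_b @ [7.2] @ pat_b @ [23.5] @
      pat_b @ [7.2] @ pat_b @ [12.6] @ pat_b @ [7.2] @ pat_b) (real_of_int 1855 / 10)"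
    by (rule ext[OF _ tail_235]) (simp add: pat_b_def)
qed

lemma virtual_end_Nil': "interpolates E F G \<Longrightarrow> virtual_end E F G [] (real_of_int 0 / 10)"
  using virtual_end_Nil[of E F G] by simp

lemma sum_patterns:
  "sum_list h7 = 22.4" "sum_list h15 = 57.9" "sum_list h31 = 142.7"
  "sum_list h63 = 329.2" "sum_list h127 = 741"
  by (simp_all add: h7_def h15_def h31_def h63_def h127_def pat_b_def Let_def)

lemma straightforward_patterns:
  shows "straightforward n h7 0 (1 / 10 ^ 5)" and "straightforward n h15 0 (1 / 10 ^ 6)"
    and "straightforward n h31 0 (1 / 10 ^ 8)" and "straightforward n h63 0 (1 / 10 ^ 7)"
    and "straightforward n h127 0 (1 / 10 ^ 8)"
proof -
  have "straightforward n h7 0 (1 / real_of_int 100000)"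
    by (rule pattern_straightforward[OF main_7 virtual_end_Nil']) (simp_all add: sum_patterns, simp add: h7_def)
  then show "straightforward n h7 0 (1 / 10 ^ 5)" by simp
  have "straightforward n h15 0 (1 / real_of_int 1000000)"
    by (rule pattern_straightforward[OF main_15 virtual_end_Nil']) (simp_all add: sum_patterns, simp add: h15_def Let_def)
  then show "straightforward n h15 0 (1 / 10 ^ 6)" by simp
  have "straightforward n h31 0 (1 / real_of_int 100000000)"
    by (rule pattern_straightforward[OF main_31 virtual_end_Nil']) (simp_all add: sum_patterns, simp add: h31_def pat_b_def)
  then show "straightforward n h31 0 (1 / 10 ^ 8)" by simp
  have "straightforward n h63 0 (1 / real_of_int 10000000)"
    by (rule pattern_straightforward[OF main_63 virtual_ends(1)])
       (simp_all add: sum_patterns, simp add: h63_def pat_b_def Let_def)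
  then show "straightforward n h63 0 (1 / 10 ^ 7)" by simp
  have "straightforward n h127 0 (1 / real_of_int 100000000)"
    by (rule pattern_straightforward[OF main_127 virtual_ends(2)])
       (simp_all add: sum_patterns, simp add: h127_def pat_b_def Let_def)
  then show "straightforward n h127 0 (1 / 10 ^ 8)" by simp
qed

theorem theorem3p4:
  fixes h :: "real list" and \<epsilon> \<Delta> c :: real
  assumes "(h, \<epsilon>, \<Delta>, c) \<in>
    {(h7,   1 / 10 ^ 9,  1 / 10 ^ 5, 3.1999999),
     (h15,  1 / 10 ^ 9,  1 / 10 ^ 6, 3.8599999),
     (h31,  1 / 10 ^ 11, 1 / 10 ^ 8, 4.6032258),
     (h63,  1 / 10 ^ 3,  1 / 10 ^ 7, 5.2253968),
     (h127, 1 / 10 ^ 4,  1 / 10 ^ 8, 5.8346303)}"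
  shows "(\<forall>n. straightforward n h \<epsilon> \<Delta>) \<and>
    (\<exists>(s_bar::nat) (C::real). \<forall>(n::nat) (L::real) f g x0 xs D.
        L > 0 \<and> convex_on (Rn n) f \<and> smooth_with_gradient L (Rn n) f g \<and>
        x0 \<in> Rn n \<and> xs \<in> Rn n \<and> (\<forall>x\<in>Rn n. f xs \<le> f x) \<and>
        bdd_above {norm (x - xs) | x. x \<in> Rn n \<and> f x \<le> f x0} \<and>
        D = Sup {norm (x - xs) | x. x \<in> Rn n \<and> f x \<le> f x0} \<longrightarrow>
        (\<forall>s>s_bar. \<forall>T. T = s * length h \<longrightarrow>
           f (grad_descent (\<lambda>k. h ! (k mod length h)) L g x0 T) - f xs
             \<le> L * D\<^sup>2 / (c * real T - C)))"
proof -
  let ?P = "\<lambda>h \<epsilon> \<Delta> c. (\<forall>n. straightforward n h 0 \<Delta>) \<and> (0::real) \<le> \<epsilon> \<and> 0 < sum_list h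
    \<and> sum_list h * \<Delta> \<le> 1 / 2 \<and> 0 < c \<and> c * real (length h) \<le> sum_list h \<and> h \<noteq> []"
  have ne: "h7 \<noteq> []" "h15 \<noteq> []" "h31 \<noteq> []" "h63 \<noteq> []" "h127 \<noteq> []"
    using length_patterns by auto
  \<comment> \<open>Each \<open>c\<close> lies slightly below the mean stepsize
    \<open>sum_list h / length h\<close>, the rate constant that straightforwardness with \<epsilon>
    = 0 yields.\<close>
  have "?P h7 (1 / 10 ^ 9) (1 / 10 ^ 5) 3.1999999"
    "?P h15 (1 / 10 ^ 9) (1 / 10 ^ 6) 3.8599999"
    "?P h31 (1 / 10 ^ 11) (1 / 10 ^ 8) 4.6032258"
    "?P h63 (1 / 10 ^ 3) (1 / 10 ^ 7) 5.2253968"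
    "?P h127 (1 / 10 ^ 4) (1 / 10 ^ 8) 5.8346303"
    by (intro conjI allI straightforward_patterns ne; simp add: sum_patterns length_patterns)+
  then have "?P h \<epsilon> \<Delta> c"
    using assms by (elim insertE emptyE) (simp_all only: prod.inject simp_thms)
  then have sf: "\<And>n. straightforward n h 0 \<Delta>" and \<epsilon>: "0 \<le> \<epsilon>"
    and S: "0 < sum_list h" "sum_list h * \<Delta> \<le> 1 / 2"
    and c: "0 < c" "c * real (length h) \<le> sum_list h" "h \<noteq> []" by auto
  show ?thesis
    using straightforward_weaken[OF sf \<epsilon>] straightforward_rate[OF sf S c] by blast
qed

end
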